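(* Let $\boldsymbol u\in K_{\boldsymbol u}$ be the minimiser of $I$ and $\boldsymbol T\in K_{\boldsymbol T}$ a maximiser of $D$. For every $\boldsymbol v\in K_{\boldsymbol u}$ and $\boldsymbol\tau\in K_{\boldsymbol T}$, there holds $$\rho^2_{\mathrm{tot}}(\boldsymbol v,\boldsymbol\tau)=\eta^2_{\mathrm{gap}}(\boldsymbol v,\boldsymbol\tau),$$ where $$\eta^2_{\mathrm{gap}}(\boldsymbol v,\boldsymbol\tau)=I(\boldsymbol v)-D(\boldsymbol\tau),\qquad\rho^2_{\mathrm{tot}}(\boldsymbol v,\boldsymbol\tau)=\big(I(\boldsymbol v)-I(\boldsymbol u)\big)+\big(-D(\boldsymbol\tau)+D(\boldsymbol T)\big).$$
   Context: $d\ge 2$; $\Omega\subset\mathbb R^d$ is a bounded polyhedral Lipschitz domain whose boundary is divided into disjoint relatively open parts $\Gamma_D\neq\emptyset$ and $\Gamma_N$ with $\overline\Gamma_D\cup\overline\Gamma_N=\partial\Omega$. $(\cdot,\cdot)_\Omega$, $\|\cdot\|_\Omega$ denote the $L^2(\Omega)$ inner product and norm (scalar, vector or matrix valued). $\mathrm{dev}\,\boldsymbol A=\boldsymbol A-\frac1d\mathrm{tr}(\boldsymbol A)\boldsymbol I$; $(\nabla\boldsymbol v)_{ij}=\partial_j v_i$; the divergence of a matrix field is taken row-wise. $\mathbf H^1_D(\Omega)$: fields in $(H^1(\Omega))^d$ with zero trace on $\Gamma_D$. $\mathbf H_N(\mathrm{div};\Omega)$: matrix fields $\boldsymbol\tau\in(L^2(\Omega))^{d\times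 d}$ with $\mathrm{div}\,\boldsymbol\tau\in(L^2(\Omega))^d$ and $\boldsymbol\tau\boldsymbol n=\boldsymbol 0$ weakly on $\Gamma_N$ (in the dual of $\mathbf H^{1/2}_{00}(\Gamma_N)$), i.e. $(\boldsymbol\tau,\nabla\boldsymbol v)_\Omega+(\mathrm{div}\,\boldsymbol\tau,\boldsymbol v)_\Omega=0$ for all $\boldsymbol v\in\mathbf H^1_D(\Omega)$. Incompressible Stokes problem. $\nu>0$; $\widehat{\boldsymbol u}_D\in(H^1(\Omega))^d$ with $\mathrm{div}\,\widehat{\boldsymbol u}_D=0$ a.e. in $\Omega$ (lift of the Dirichlet datum); the load $\boldsymbol f^*\in(\mathbf H^1_D(\Omega))^*$ is represented by fixed $\boldsymbol f\in(L^2(\Omega))^d$, $\boldsymbol F\in(L^2(\Omega))^{d\times d}$ via $\langle\boldsymbol f^*,\boldsymbol v\rangle_\Omega=(\boldsymbol f,\boldsymbol v)_\Omega+(\boldsymbol F,\nabla\boldsymbol v)_\Omega$. $K_{\boldsymbol u}=\{\boldsymbol v\in\mathbf H^1_D(\Omega):\mathrm{div}\,\boldsymbol v=0\text{ a.e. in }\Omega\}$ and $I(\boldsymbol v)=\frac\nu2\|\nabla(\boldsymbol v+\widehat{\boldsymbol u}_D)\|_\Omega^2-\langle\boldsymbol f^*,\boldsymbol v\rangle_\Omega$ for $\boldsymbol v\in K_{\boldsymbol u}$. $K_{\boldsymbol T}=\{\boldsymbol\tau\in\boldsymbol F+\mathbf H_N(\mathrm{div};\Omega):\mathrm{div}(\boldsymbol\tau-\boldsymbol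 F)=-\boldsymbol f\text{ a.e. in }\Omega\}$ and $D(\boldsymbol\tau)=-\frac1{2\nu}\|\mathrm{dev}\,\boldsymbol\tau\|_\Omega^2+(\mathrm{dev}\,\boldsymbol\tau,\nabla\widehat{\boldsymbol u}_D)_\Omega$ for $\boldsymbol\tau\in K_{\boldsymbol T}$. *)

theory Defs
  imports "HOL-Analysis.Analysis"
begin

text \<open>
  A Lipschitz domain is locally the strict epigraph of a Lipschitz function: in the coordinates
  given by a unit vector \<open>e\<close>, a point \<open>y\<close> has height \<open>y \<bullet> e\<close> and
  foot point \<open>y - (y \<bullet> e) *\<^sub>R e\<close> in the hyperplane orthogonal to \<open>e\<close>.
  Boundedness makes the radii and Lipschitz constants uniform, so they may depend on the point.
\<close>

definition lipschitz_boundary :: "'a::euclidean_space set \<Rightarrow> bool" where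
  "lipschitz_boundary \<Omega> \<longleftrightarrow>
     (\<forall>x\<in>frontier \<Omega>. \<exists>r>0. \<exists>e L g. norm e = 1 \<and> L-lipschitz_on {z. z \<bullet> e = 0} g \<and>
        (\<forall>y\<in>ball x r. y \<in> \<Omega> \<longleftrightarrow> (g (y - (y \<bullet> e) *\<^sub>R e) :: real) < y \<bullet> e))"

definition bounded_polyhedral_lipschitz_domain :: "'a::euclidean_space set \<Rightarrow> bool" where
  "bounded_polyhedral_lipschitz_domain \<Omega> \<longleftrightarrow>
     open \<Omega> \<and> connected \<Omega> \<and> \<Omega> \<noteq> {} \<and> bounded \<Omega> \<and> lipschitz_boundary \<Omega> \<and>
     (\<exists>P. finite P \<and> (\<forall>p\<in>P. polytope p) \<and> closure \<Omega> = \<Union>P)"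

definition boundary_partition :: "'a::euclidean_space set \<Rightarrow> 'a set \<Rightarrow> 'a set \<Rightarrow> bool" where
  "boundary_partition \<Omega> \<Gamma>D \<Gamma>N \<longleftrightarrow>
     openin (top_of_set (frontier \<Omega>)) \<Gamma>D \<and> openin (top_of_set (frontier \<Omega>)) \<Gamma>N \<and>
     \<Gamma>D \<inter> \<Gamma>N = {} \<and> \<Gamma>D \<noteq> {} \<and> closure \<Gamma>D \<union> closure \<Gamma>N = frontier \<Omega>"

text \<open>
  The surface measure is the Hausdorff measure of dimension \<open>d - 1\<close>, normalised to agree
  with the \<open>(d - 1)\<close>-dimensional area. The definition is meant for \<open>d \<ge> 2\<close>
  only: for \<open>d = 1\<close> the empty set would contribute \<open>0 ^ 0 = 1\<close>. The covering
  sets have to be bounded because \<^const>\<open>diameter\<close> is not meaningful otherwise.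
\<close>

definition surface_outer_measure :: "'a::euclidean_space set \<Rightarrow> ennreal" where
  "surface_outer_measure A =
     (SUP \<delta>\<in>{0<..}. INF C\<in>{C :: nat \<Rightarrow> 'a set. A \<subseteq> (\<Union>i. C i) \<and>
                                   (\<forall>i. bounded (C i) \<and> diameter (C i) \<le> (\<delta>::real))}.
        \<Sum>i. ennreal (unit_ball_vol (real (DIM('a) - 1)) * (diameter (C i) / 2) ^ (DIM('a) - 1)))"

definition surface_measure :: "'a::euclidean_space measure" where
  "surface_measure = measure_of UNIV (sets borel) surface_outer_measure"

definition L2 :: "'a::euclidean_space set \<Rightarrow> ('a \<Rightarrow> 'b::euclidean_space) \<Rightarrow> bool" where
  "L2 \<Omega> f \<longleftrightarrow> f \<in> borel_measurable (lebesgue_on \<Omega>) \<and>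
              integrable (lebesgue_on \<Omega>) (\<lambda>x. (norm (f x))\<^sup>2)"

text \<open>On \<^typ>\<open>real^'d^'d\<close> the inner product is the Frobenius inner product.\<close>

definition l2_inner :: "'a::euclidean_space set \<Rightarrow> ('a \<Rightarrow> 'b::euclidean_space) \<Rightarrow> ('a \<Rightarrow> 'b) \<Rightarrow> real" where
  "l2_inner \<Omega> f g = integral\<^sup>L (lebesgue_on \<Omega>) (\<lambda>x. f x \<bullet> g x)"

definition l2_norm :: "'a::euclidean_space set \<Rightarrow> ('a \<Rightarrow> 'b::euclidean_space) \<Rightarrow> real" where
  "l2_norm \<Omega> f = sqrt (l2_inner \<Omega> f f)"

definition partial_deriv :: "'d::finite \<Rightarrow> (real^'d \<Rightarrow> real) \<Rightarrow> real^'d \<Rightarrow> real" where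
  "partial_deriv j \<phi> x = frechet_derivative \<phi> (at x) (axis j 1)"

primrec C_k :: "nat \<Rightarrow> (real^'d::finite \<Rightarrow> real) \<Rightarrow> bool" where
  "C_k 0 \<phi> \<longleftrightarrow> continuous_on UNIV \<phi>"
| "C_k (Suc k) \<phi> \<longleftrightarrow> \<phi> differentiable_on UNIV \<and> (\<forall>j. C_k k (partial_deriv j \<phi>))"

definition smooth :: "(real^'d::finite \<Rightarrow> real) \<Rightarrow> bool" where
  "smooth \<phi> \<longleftrightarrow> (\<forall>k. C_k k \<phi>)"

definition test_function :: "(real^'d::finite) set \<Rightarrow> (real^'d \<Rightarrow> real) \<Rightarrow> bool" where
  "test_function \<Omega> \<phi> \<longleftrightarrow>
     smooth \<phi> \<and> compact (closure {x. \<phi> x \<noteq> 0}) \<and> closure {x. \<phi> x \<noteq> 0} \<subseteq> \<Omega>"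

definition is_weak_grad ::
    "(real^'d::finite) set \<Rightarrow> (real^'d \<Rightarrow> real^'d) \<Rightarrow> (real^'d \<Rightarrow> real^'d^'d) \<Rightarrow> bool" where
  "is_weak_grad \<Omega> v G \<longleftrightarrow>
     (\<forall>\<phi> i j. test_function \<Omega> \<phi> \<longrightarrow>
        integral\<^sup>L (lebesgue_on \<Omega>) (\<lambda>x. v x $ i * partial_deriv j \<phi> x) =
        - integral\<^sup>L (lebesgue_on \<Omega>) (\<lambda>x. G x $ i $ j * \<phi> x))"

definition is_weak_div ::
    "(real^'d::finite) set \<Rightarrow> (real^'d \<Rightarrow> real^'d^'d) \<Rightarrow> (real^'d \<Rightarrow> real^'d) \<Rightarrow> bool" where
  "is_weak_div \<Omega> \<tau> w \<longleftrightarrow>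
     (\<forall>\<phi> i. test_function \<Omega> \<phi> \<longrightarrow>
        integral\<^sup>L (lebesgue_on \<Omega>) (\<lambda>x. \<Sum>j\<in>UNIV. \<tau> x $ i $ j * partial_deriv j \<phi> x) =
        - integral\<^sup>L (lebesgue_on \<Omega>) (\<lambda>x. w x $ i * \<phi> x))"

definition H1 :: "(real^'d::finite) set \<Rightarrow> (real^'d \<Rightarrow> real^'d) \<Rightarrow> bool" where
  "H1 \<Omega> v \<longleftrightarrow> L2 \<Omega> v \<and> (\<exists>G. L2 \<Omega> G \<and> is_weak_grad \<Omega> v G)"

definition Hdiv :: "(real^'d::finite) set \<Rightarrow> (real^'d \<Rightarrow> real^'d^'d) \<Rightarrow> bool" where
  "Hdiv \<Omega> \<tau> \<longleftrightarrow> L2 \<Omega> \<tau> \<and> (\<exists>w. L2 \<Omega> w \<and> is_weak_div \<Omega> \<tau> w)"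

text \<open>
  Weak derivatives are unique only up to null sets in \<open>\<Omega>\<close>; a representative is chosen.
  Fields on \<open>\<Omega>\<close> are total functions whose values outside \<open>\<Omega>\<close> are irrelevant.
\<close>

definition grad :: "(real^'d::finite) set \<Rightarrow> (real^'d \<Rightarrow> real^'d) \<Rightarrow> real^'d \<Rightarrow> real^'d^'d" where
  "grad \<Omega> v = (SOME G. L2 \<Omega> G \<and> is_weak_grad \<Omega> v G)"

definition mat_div :: "(real^'d::finite) set \<Rightarrow> (real^'d \<Rightarrow> real^'d^'d) \<Rightarrow> real^'d \<Rightarrow> real^'d" where
  "mat_div \<Omega> \<tau> = (SOME w. L2 \<Omega> w \<and> is_weak_div \<Omega> \<tau> w)"

definition vec_div :: "(real^'d::finite) set \<Rightarrow> (real^'d \<Rightarrow> real^'d) \<Rightarrow> real^'d \<Rightarrow> real" where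
  "vec_div \<Omega> v x = trace (grad \<Omega> v x)"

definition H1_norm :: "(real^'d::finite) set \<Rightarrow> (real^'d \<Rightarrow> real^'d) \<Rightarrow> real" where
  "H1_norm \<Omega> v = sqrt ((l2_norm \<Omega> v)\<^sup>2 + (l2_norm \<Omega> (grad \<Omega> v))\<^sup>2)"

text \<open>
  The trace operator is the continuous extension to \<^const>\<open>H1\<close> of the restriction of
  functions that are smooth up to the boundary. So \<open>g\<close> is the trace of \<open>v\<close> on
  \<open>\<Gamma>\<close> if it is the limit in \<open>L\<^sup>2(\<Gamma>)\<close> of the boundary values of
  a smooth sequence converging to \<open>v\<close> in \<^const>\<open>H1\<close>.
\<close>

definition has_boundary_trace ::
    "(real^'d::finite) set \<Rightarrow> (real^'d) set \<Rightarrow> (real^'d \<Rightarrow> real^'d) \<Rightarrow> (real^'d \<Rightarrow> real^'d) \<Rightarrow> bool" where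
  "has_boundary_trace \<Omega> \<Gamma> v g \<longleftrightarrow>
     g \<in> borel_measurable borel \<and>
     (\<exists>\<phi> :: nat \<Rightarrow> real^'d \<Rightarrow> real^'d.
        (\<forall>n i. smooth (\<lambda>x. \<phi> n x $ i)) \<and>
        (\<lambda>n. H1_norm \<Omega> (\<lambda>x. \<phi> n x - v x)) \<longlonglongrightarrow> 0 \<and>
        (\<lambda>n. \<integral>\<^sup>+x\<in>\<Gamma>. ennreal ((norm (\<phi> n x - g x))\<^sup>2) \<partial>surface_measure) \<longlonglongrightarrow> 0)"

definition H1_D :: "(real^'d::finite) set \<Rightarrow> (real^'d) set \<Rightarrow> (real^'d \<Rightarrow> real^'d) set" where
  "H1_D \<Omega> \<Gamma>D = {v. H1 \<Omega> v \<and> has_boundary_trace \<Omega> \<Gamma>D v (\<lambda>_. 0)}"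

text \<open>
  The condition \<open>\<tau> n = 0\<close> weakly on the Neumann part of the boundary is imposed by
  testing against fields that vanish on the complementary Dirichlet part.
\<close>

definition HN_div :: "(real^'d::finite) set \<Rightarrow> (real^'d) set \<Rightarrow> (real^'d \<Rightarrow> real^'d^'d) set" where
  "HN_div \<Omega> \<Gamma>D = {\<tau>. Hdiv \<Omega> \<tau> \<and>
     (\<forall>v\<in>H1_D \<Omega> \<Gamma>D. l2_inner \<Omega> \<tau> (grad \<Omega> v) + l2_inner \<Omega> (mat_div \<Omega> \<tau>) v = 0)}"

definition dev :: "real^'d^'d \<Rightarrow> real^'d^'d::finite" where
  "dev A = A - (trace A / real CARD('d)) *\<^sub>R mat 1"

definition K_u :: "(real^'d::finite) set \<Rightarrow> (real^'d) set \<Rightarrow> (real^'d \<Rightarrow> real^'d) set" where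
  "K_u \<Omega> \<Gamma>D = {v \<in> H1_D \<Omega> \<Gamma>D. AE x in lebesgue_on \<Omega>. vec_div \<Omega> v x = 0}"

definition load ::
    "(real^'d::finite) set \<Rightarrow> (real^'d \<Rightarrow> real^'d) \<Rightarrow> (real^'d \<Rightarrow> real^'d^'d) \<Rightarrow> (real^'d \<Rightarrow> real^'d) \<Rightarrow> real" where
  "load \<Omega> f F v = l2_inner \<Omega> f v + l2_inner \<Omega> F (grad \<Omega> v)"

definition primal_energy ::
    "(real^'d::finite) set \<Rightarrow> real \<Rightarrow> (real^'d \<Rightarrow> real^'d) \<Rightarrow> (real^'d \<Rightarrow> real^'d) \<Rightarrow>
     (real^'d \<Rightarrow> real^'d^'d) \<Rightarrow> (real^'d \<Rightarrow> real^'d) \<Rightarrow> real" where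
  "primal_energy \<Omega> \<nu> uD f F v =
     \<nu> / 2 * (l2_norm \<Omega> (grad \<Omega> (\<lambda>x. v x + uD x)))\<^sup>2 - load \<Omega> f F v"

definition K_T ::
    "(real^'d::finite) set \<Rightarrow> (real^'d) set \<Rightarrow> (real^'d \<Rightarrow> real^'d) \<Rightarrow> (real^'d \<Rightarrow> real^'d^'d) \<Rightarrow>
     (real^'d \<Rightarrow> real^'d^'d) set" where
  "K_T \<Omega> \<Gamma>D f F = {\<tau>. (\<lambda>x. \<tau> x - F x) \<in> HN_div \<Omega> \<Gamma>D \<and>
     (AE x in lebesgue_on \<Omega>. mat_div \<Omega> (\<lambda>x. \<tau> x - F x) x = - f x)}"

definition dual_energy ::
    "(real^'d::finite) set \<Rightarrow> real \<Rightarrow> (real^'d \<Rightarrow> real^'d) \<Rightarrow> (real^'d \<Rightarrow> real^'d^'d) \<Rightarrow> real" where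
  "dual_energy \<Omega> \<nu> uD \<tau> =
     - (1 / (2 * \<nu>)) * (l2_norm \<Omega> (\<lambda>x. dev (\<tau> x)))\<^sup>2 + l2_inner \<Omega> (\<lambda>x. dev (\<tau> x)) (grad \<Omega> uD)"

definition eta_gap_sq ::
    "(real^'d::finite) set \<Rightarrow> real \<Rightarrow> (real^'d \<Rightarrow> real^'d) \<Rightarrow> (real^'d \<Rightarrow> real^'d) \<Rightarrow>
     (real^'d \<Rightarrow> real^'d^'d) \<Rightarrow> (real^'d \<Rightarrow> real^'d) \<Rightarrow> (real^'d \<Rightarrow> real^'d^'d) \<Rightarrow> real" where
  "eta_gap_sq \<Omega> \<nu> uD f F v \<tau> = primal_energy \<Omega> \<nu> uD f F v - dual_energy \<Omega> \<nu> uD \<tau>"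

definition rho_tot_sq ::
    "(real^'d::finite) set \<Rightarrow> real \<Rightarrow> (real^'d \<Rightarrow> real^'d) \<Rightarrow> (real^'d \<Rightarrow> real^'d) \<Rightarrow>
     (real^'d \<Rightarrow> real^'d^'d) \<Rightarrow> (real^'d \<Rightarrow> real^'d) \<Rightarrow> (real^'d \<Rightarrow> real^'d^'d) \<Rightarrow>
     (real^'d \<Rightarrow> real^'d) \<Rightarrow> (real^'d \<Rightarrow> real^'d^'d) \<Rightarrow> real" where
  "rho_tot_sq \<Omega> \<nu> uD f F u T v \<tau> =
     (primal_energy \<Omega> \<nu> uD f F v - primal_energy \<Omega> \<nu> uD f F u) +
     (- dual_energy \<Omega> \<nu> uD \<tau> + dual_energy \<Omega> \<nu> uD T)"

end

theory Submission
  imports Defs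
begin

text \<open>
  Put \<open>E = \<nu> \<nabla>(u + u\<^sub>D) - dev T\<close>. Since \<open>I u - D T = \<parallel>E\<parallel>\<^sup>2 / (2 \<nu>)\<close>, the claim amounts
  to \<open>E = 0\<close>. Maximality of \<open>T\<close> makes \<open>E\<close> orthogonal to all divergence-free stresses
  without normal trace on the Neumann boundary, and minimality of \<open>u\<close> makes it orthogonal to the
  gradients of \<^const>\<open>K_u\<close>. The gradients of \<^const>\<open>H1_D\<close> form a closed subspace of
  \<open>L\<^sup>2\<close> whose orthogonal complement consists of such stresses, so \<open>E = \<nabla>w\<close> for
  some \<open>w\<close> in \<^const>\<open>H1_D\<close>. As \<open>E\<close> is trace-free, \<open>w\<close> lies in
  \<^const>\<open>K_u\<close>, hence \<open>E\<close> is orthogonal to itself. No pressure and no inf-sup condition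
  are needed, because the maximiser \<open>T\<close> is given.

  Closedness of the gradients rests on a Poincare inequality modulo constants, obtained by chaining
  balls and by translating boundary patches into the interior, and on the trace condition, which
  keeps the constants bounded.
\<close>

section \<open>Square-integrable fields\<close>

text \<open>The obstacle is the way back from gradients to fields. Convergence of
  \<open>grad \<Omega> (w n)\<close> controls \<open>w n\<close> only up to constants, and
  \<open>has_boundary_trace\<close> offers nothing but smooth approximants with small boundary
  integrals. The constants are therefore pinned down at one generic interior point: moved along a
  fixed direction \<open>z\<close> it meets the Dirichlet part where the boundary values tend to
  zero, and line integrals of the gradient connect the two ends. Such points exist because a
  Hausdorff null set of the boundary, swept along \<open>z\<close>, is Lebesgue null. A second
  obstacle is \<open>surface_measure\<close>: by the convention of \<open>measure_of\<close> it is
  the zero measure unless its outer measure is countably additive on the Borel sets. Instead of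
  settling additivity, the closedness proof distinguishes whether the Dirichlet part has measure
  zero, and finds the limit field in either case. The stresses \<open>\<sigma>\<close> tested
  against \<open>E\<close> may have any trace: the dual energy sees only
  \<open>dev \<sigma>\<close>, and so does the trace-free \<open>E\<close>.\<close>

lemma L2_measurable [measurable_dest]: "L2 \<Omega> f \<Longrightarrow> f \<in> borel_measurable (lebesgue_on \<Omega>)"
  by (simp add: L2_def)

lemma L2_bounded_by:
  assumes f: "f \<in> borel_measurable (lebesgue_on \<Omega>)" and g: "L2 \<Omega> g"
    and le: "\<And>x. norm (f x) \<le> C * norm (g x)"
  shows "L2 \<Omega> f"
  unfolding L2_def
proof
  show "integrable (lebesgue_on \<Omega>) (\<lambda>x. (norm (f x))\<^sup>2)"
  proof (rule Bochner_Integration.integrable_bound)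
    show "integrable (lebesgue_on \<Omega>) (\<lambda>x. C\<^sup>2 * (norm (g x))\<^sup>2)"
      using g by (simp add: L2_def)
    show "AE x in lebesgue_on \<Omega>. norm ((norm (f x))\<^sup>2) \<le> norm (C\<^sup>2 * (norm (g x))\<^sup>2)"
      using power_mono[OF le norm_ge_zero, of _ 2] by (simp add: power_mult_distrib)
  qed (use f in measurable)
qed (fact f)

lemma L2_linear:
  assumes "bounded_linear h" "L2 \<Omega> f"
  shows "L2 \<Omega> (\<lambda>x. h (f x))"
proof -
  obtain K where K: "\<And>x. norm (h x) \<le> norm x * K"
    using bounded_linear.bounded[OF assms(1)] by blast
  show ?thesis
  proof (rule L2_bounded_by[OF _ assms(2)])
    have "h \<in> borel_measurable borel"
      by (intro borel_measurable_continuous_onI linear_continuous_on assms(1))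
    then show "(\<lambda>x. h (f x)) \<in> borel_measurable (lebesgue_on \<Omega>)"
      using assms(2) by (auto simp: L2_def intro: measurable_compose)
    show "norm (h (f x)) \<le> K * norm (f x)" for x
      using K[of "f x"] by (simp only: mult.commute)
  qed
qed

lemma L2_inner_integrable:
  assumes "L2 \<Omega> f" "L2 \<Omega> g"
  shows "integrable (lebesgue_on \<Omega>) (\<lambda>x. f x \<bullet> g x)"
proof (rule Bochner_Integration.integrable_bound)
  show "integrable (lebesgue_on \<Omega>) (\<lambda>x. (norm (f x))\<^sup>2 + (norm (g x))\<^sup>2)"
    using assms by (simp add: L2_def)
  show "AE x in lebesgue_on \<Omega>. norm (f x \<bullet> g x) \<le> norm ((norm (f x))\<^sup>2 + (norm (g x))\<^sup>2)"
  proof (rule AE_I2)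
    fix x
    have "\<bar>f x \<bullet> g x\<bar> \<le> norm (f x) * norm (g x)" by (rule Cauchy_Schwarz_ineq2)
    also have "\<dots> \<le> (norm (f x))\<^sup>2 + (norm (g x))\<^sup>2"
      using sum_squares_bound[of "norm (f x)" "norm (g x)"]
        mult_nonneg_nonneg[OF norm_ge_zero[of "f x"] norm_ge_zero[of "g x"]] by linarith
    finally show "norm (f x \<bullet> g x) \<le> norm ((norm (f x))\<^sup>2 + (norm (g x))\<^sup>2)" by simp
  qed
qed (use assms in \<open>auto simp: L2_def\<close>)

lemma L2_zero [simp]: "L2 \<Omega> (\<lambda>x. 0)"
  by (simp add: L2_def)

lemma L2_add [intro]:
  assumes "L2 \<Omega> f" "L2 \<Omega> g"
  shows "L2 \<Omega> (\<lambda>x. f x + g x)"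
proof -
  have "(norm (f x + g x))\<^sup>2 = (norm (f x))\<^sup>2 + (norm (g x))\<^sup>2 + 2 * (f x \<bullet> g x)" for x
    by (simp add: power2_norm_eq_inner inner_add inner_commute)
  then show ?thesis
    using assms L2_inner_integrable[OF assms] by (auto simp: L2_def)
qed

lemma L2_scaleR [intro]: "L2 \<Omega> f \<Longrightarrow> L2 \<Omega> (\<lambda>x. c *\<^sub>R f x)"
  by (rule L2_linear[OF bounded_linear_scaleR_right])

lemma L2_minus [intro]: "L2 \<Omega> f \<Longrightarrow> L2 \<Omega> (\<lambda>x. - f x)"
  by (rule L2_linear[OF bounded_linear_minus[OF bounded_linear_ident]])

lemma L2_diff [intro]:
  assumes "L2 \<Omega> f" "L2 \<Omega> g"
  shows "L2 \<Omega> (\<lambda>x. f x - g x)"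
  using L2_add[OF assms(1) L2_minus[OF assms(2)]] by simp

lemma L2_component: "L2 \<Omega> f \<Longrightarrow> L2 \<Omega> (\<lambda>x. f x $ i)"
  by (rule L2_linear[OF bounded_linear_vec_nth])

lemma l2_inner_commute: "l2_inner \<Omega> f g = l2_inner \<Omega> g f"
  by (simp add: l2_inner_def inner_commute)

lemma l2_inner_add_left:
  "L2 \<Omega> f \<Longrightarrow> L2 \<Omega> g \<Longrightarrow> L2 \<Omega> h \<Longrightarrow>
    l2_inner \<Omega> (\<lambda>x. f x + g x) h = l2_inner \<Omega> f h + l2_inner \<Omega> g h"
  by (simp add: l2_inner_def inner_add_left L2_inner_integrable)

lemma l2_inner_diff_left:
  "L2 \<Omega> f \<Longrightarrow> L2 \<Omega> g \<Longrightarrow> L2 \<Omega> h \<Longrightarrow>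
    l2_inner \<Omega> (\<lambda>x. f x - g x) h = l2_inner \<Omega> f h - l2_inner \<Omega> g h"
  by (simp add: l2_inner_def inner_diff_left L2_inner_integrable)

lemma l2_inner_scaleR_left: "l2_inner \<Omega> (\<lambda>x. c *\<^sub>R f x) g = c * l2_inner \<Omega> f g"
  by (simp add: l2_inner_def)

lemma l2_inner_zero_left [simp]: "l2_inner \<Omega> (\<lambda>x. 0) g = 0"
  by (simp add: l2_inner_def)

lemma l2_inner_add_right:
  "L2 \<Omega> f \<Longrightarrow> L2 \<Omega> g \<Longrightarrow> L2 \<Omega> h \<Longrightarrow>
    l2_inner \<Omega> h (\<lambda>x. f x + g x) = l2_inner \<Omega> h f + l2_inner \<Omega> h g"
  by (simp add: l2_inner_add_left l2_inner_commute[of _ h])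

lemma l2_inner_scaleR_right: "l2_inner \<Omega> g (\<lambda>x. c *\<^sub>R f x) = c * l2_inner \<Omega> g f"
  by (simp add: l2_inner_def)

lemma l2_inner_cong_AE:
  assumes "L2 \<Omega> f" "L2 \<Omega> f'" "L2 \<Omega> g" "L2 \<Omega> g'"
    and "AE x in lebesgue_on \<Omega>. f x = f' x" "AE x in lebesgue_on \<Omega>. g x = g' x"
  shows "l2_inner \<Omega> f g = l2_inner \<Omega> f' g'"
  unfolding l2_inner_def
  by (rule integral_cong_AE)
    (use assms L2_inner_integrable[OF assms(1,3)] L2_inner_integrable[OF assms(2,4)]
      in \<open>auto dest: borel_measurable_integrable\<close>)

lemma l2_inner_self_nonneg: "0 \<le> l2_inner \<Omega> f f"
  by (simp add: l2_inner_def)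

lemma l2_norm_sq: "(l2_norm \<Omega> f)\<^sup>2 = l2_inner \<Omega> f f"
  by (simp add: l2_norm_def l2_inner_self_nonneg)

lemma l2_norm_nonneg [simp]: "0 \<le> l2_norm \<Omega> f"
  by (simp add: l2_norm_def l2_inner_self_nonneg)

lemma l2_norm_cong_AE:
  assumes "L2 \<Omega> f" "L2 \<Omega> g" "AE x in lebesgue_on \<Omega>. f x = g x"
  shows "l2_norm \<Omega> f = l2_norm \<Omega> g"
  unfolding l2_norm_def using l2_inner_cong_AE[OF assms(1,2,1,2,3,3)] by simp

lemma nn_integral_norm_sq:
  assumes "L2 \<Omega> f"
  shows "(\<integral>\<^sup>+x. ennreal ((norm (f x))\<^sup>2) \<partial>lebesgue_on \<Omega>) = ennreal ((l2_norm \<Omega> f)\<^sup>2)"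
  using assms unfolding l2_norm_sq
  by (simp add: l2_inner_def L2_def power2_norm_eq_inner nn_integral_eq_integral)

lemma L2_I_nn:
  assumes "f \<in> borel_measurable (lebesgue_on \<Omega>)"
    and "(\<integral>\<^sup>+x. ennreal ((norm (f x))\<^sup>2) \<partial>lebesgue_on \<Omega>) < \<infinity>"
  shows "L2 \<Omega> f"
  using assms unfolding L2_def by (auto intro!: integrableI_bounded)

lemma l2_norm_zero_AE:
  assumes "L2 \<Omega> f" "l2_norm \<Omega> f = 0"
  shows "AE x in lebesgue_on \<Omega>. f x = 0"
proof -
  have "(\<integral>\<^sup>+x. ennreal ((norm (f x))\<^sup>2) \<partial>lebesgue_on \<Omega>) = 0"
    using nn_integral_norm_sq[OF assms(1)] assms(2) by simp
  then show ?thesis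
    using L2_measurable[OF assms(1)] by (subst (asm) nn_integral_0_iff_AE) auto
qed

lemma l2_norm_scaleR: "l2_norm \<Omega> (\<lambda>x. c *\<^sub>R f x) = \<bar>c\<bar> * l2_norm \<Omega> f"
  by (simp add: l2_norm_def l2_inner_scaleR_left l2_inner_scaleR_right real_sqrt_mult
      flip: power2_eq_square mult.assoc)

lemma l2_norm_minus_commute: "l2_norm \<Omega> (\<lambda>x. f x - g x) = l2_norm \<Omega> (\<lambda>x. g x - f x)"
  by (simp add: l2_norm_def l2_inner_def inner_diff algebra_simps)

lemma l2_inner_expand:
  assumes "L2 \<Omega> f" "L2 \<Omega> g"
  shows "l2_inner \<Omega> (\<lambda>x. f x + c *\<^sub>R g x) (\<lambda>x. f x + c *\<^sub>R g x) =
     l2_inner \<Omega> f f + 2 * c * l2_inner \<Omega> f g + c\<^sup>2 * l2_inner \<Omega> g g"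
proof -
  have cg: "L2 \<Omega> (\<lambda>x. c *\<^sub>R g x)" using assms by blast
  show ?thesis
    using assms cg L2_add[OF assms(1) cg]
    by (simp add: l2_inner_add_left l2_inner_add_right l2_inner_scaleR_left l2_inner_scaleR_right
        l2_inner_commute[of _ g f] power2_eq_square algebra_simps)
qed

text \<open>Source of every Euler equation below: along a line, the increment of an energy at its
  minimiser is such a quadratic.\<close>

lemma nonneg_quadratic_linear_coeff:
  fixes a b :: real
  assumes "\<And>t. 0 \<le> 2 * t * b + t\<^sup>2 * a"
  shows "b = 0"
proof (rule ccontr)
  assume b: "b \<noteq> 0"
  \<comment> \<open>Since \<open>a\<close> may have either sign, \<open>s\<close> is chosen with
    \<open>s * a < 1\<close>; the step \<open>- s * b\<close> then makes the factor
    \<open>s * a - 2\<close> negative.\<close>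
  define s where "s = 1 / (\<bar>a\<bar> + 1)"
  have s: "0 < s" "s * a < 1"
    by (auto simp: s_def field_simps)
  have "0 \<le> 2 * (- s * b) * b + (- s * b)\<^sup>2 * a" by (rule assms)
  also have "\<dots> = s * b\<^sup>2 * (s * a - 2)" by (simp add: power2_eq_square algebra_simps)
  also have "\<dots> < 0" using s b by (intro mult_pos_neg) auto
  finally show False by simp
qed

lemma l2_cauchy_schwarz:
  assumes "L2 \<Omega> f" "L2 \<Omega> g"
  shows "\<bar>l2_inner \<Omega> f g\<bar> \<le> l2_norm \<Omega> f * l2_norm \<Omega> g"
proof -
  let ?a = "l2_inner \<Omega> f f" and ?b = "l2_inner \<Omega> f g" and ?c = "l2_inner \<Omega> g g"
  have q: "0 \<le> ?a + 2 * t * ?b + t\<^sup>2 * ?c" for t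
    using l2_inner_expand[OF assms, of t] l2_inner_self_nonneg by metis
  have "?b\<^sup>2 \<le> ?a * ?c"
  proof (cases "?c = 0")
    case True
    \<comment> \<open>With \<open>?c = 0\<close> the quadratic \<open>q\<close> is affine in
      \<open>t\<close>; a nonzero slope would let it reach -1.\<close>
    have "?b = 0"
    proof (rule ccontr)
      assume "?b \<noteq> 0"
      then have "?a + 2 * (- (?a + 1) / (2 * ?b)) * ?b = -1" by (simp add: field_simps)
      then show False using q[of "- (?a + 1) / (2 * ?b)"] True by simp
    qed
    then show ?thesis using True by simp
  next
    case False
    then have c: "?c > 0" using l2_inner_self_nonneg[of \<Omega> g] by simp
    have "0 \<le> ?a + 2 * (- ?b / ?c) * ?b + (- ?b / ?c)\<^sup>2 * ?c" by (rule q)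
    also have "\<dots> = ?a - ?b\<^sup>2 / ?c" using c by (simp add: field_simps power2_eq_square)
    finally show ?thesis using c by (simp add: field_simps)
  qed
  then have "sqrt (?b\<^sup>2) \<le> sqrt (?a * ?c)" by (rule real_sqrt_le_mono)
  then show ?thesis by (simp add: l2_norm_def real_sqrt_mult)
qed

lemma l2_norm_triangle:
  assumes "L2 \<Omega> f" "L2 \<Omega> g"
  shows "l2_norm \<Omega> (\<lambda>x. f x + g x) \<le> l2_norm \<Omega> f + l2_norm \<Omega> g"
proof (rule power2_le_imp_le)
  have "(l2_norm \<Omega> (\<lambda>x. f x + g x))\<^sup>2 = (l2_norm \<Omega> f)\<^sup>2 + 2 * l2_inner \<Omega> f g + (l2_norm \<Omega> g)\<^sup>2"
    using l2_inner_expand[OF assms, of 1] by (simp add: l2_norm_sq)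
  also have "\<dots> \<le> (l2_norm \<Omega> f + l2_norm \<Omega> g)\<^sup>2"
    using l2_cauchy_schwarz[OF assms] by (simp add: power2_sum)
  finally show "(l2_norm \<Omega> (\<lambda>x. f x + g x))\<^sup>2 \<le> (l2_norm \<Omega> f + l2_norm \<Omega> g)\<^sup>2" .
qed simp

lemma l2_norm_triangle_diff:
  assumes "L2 \<Omega> f" "L2 \<Omega> g" "L2 \<Omega> h"
  shows "l2_norm \<Omega> (\<lambda>x. f x - h x) \<le> l2_norm \<Omega> (\<lambda>x. f x - g x) + l2_norm \<Omega> (\<lambda>x. g x - h x)"
  using l2_norm_triangle[of \<Omega> "\<lambda>x. f x - g x" "\<lambda>x. g x - h x"] assms by auto

lemma l2_inner_tendsto_left:
  assumes "\<And>n. L2 \<Omega> (f n)" "L2 \<Omega> g" "L2 \<Omega> h"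
    and "(\<lambda>n. l2_norm \<Omega> (\<lambda>x. f n x - g x)) \<longlonglongrightarrow> 0"
  shows "(\<lambda>n. l2_inner \<Omega> (f n) h) \<longlonglongrightarrow> l2_inner \<Omega> g h"
proof -
  have "(\<lambda>n. l2_inner \<Omega> (f n) h - l2_inner \<Omega> g h) \<longlonglongrightarrow> 0"
  proof (rule Lim_null_comparison)
    show "\<forall>\<^sub>F n in sequentially. norm (l2_inner \<Omega> (f n) h - l2_inner \<Omega> g h)
            \<le> l2_norm \<Omega> (\<lambda>x. f n x - g x) * l2_norm \<Omega> h"
      using l2_cauchy_schwarz[OF L2_diff[OF assms(1,2)] assms(3)] assms
      by (intro always_eventually allI) (simp add: l2_inner_diff_left)
    show "(\<lambda>n. l2_norm \<Omega> (\<lambda>x. f n x - g x) * l2_norm \<Omega> h) \<longlonglongrightarrow> 0"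
      using tendsto_mult_left_zero[OF assms(4)] .
  qed
  then show ?thesis by (simp add: LIM_zero_iff)
qed

section \<open>Completeness of \<open>L2\<close>\<close>

lemma rapidly_cauchy_subseq:
  fixes d :: "nat \<Rightarrow> nat \<Rightarrow> real"
  assumes "\<And>e. e > 0 \<Longrightarrow> \<exists>N. \<forall>m\<ge>N. \<forall>n\<ge>N. d m n < e"
  shows "\<exists>r. strict_mono r \<and> (\<forall>k. \<forall>m\<ge>r k. \<forall>n\<ge>r k. d m n < (1/2) ^ k)"
proof -
  have "\<exists>N. \<forall>m\<ge>N. \<forall>n\<ge>N. d m n < (1/2) ^ k" for k by (rule assms) simp
  then obtain N where N: "\<And>k m n. m \<ge> N k \<Longrightarrow> n \<ge> N k \<Longrightarrow> d m n < (1/2) ^ k"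
    by metis
  \<comment> \<open>The sum of all thresholds up to \<open>k\<close> dominates \<open>N k\<close>
    and is monotone; adding \<open>k\<close> makes the index strictly increasing.\<close>
  define r where "r k = (\<Sum>i\<le>k. N i) + k" for k
  have "strict_mono r" by (rule strict_monoI_Suc) (simp add: r_def)
  moreover have "N k \<le> r k" for k
    unfolding r_def using member_le_sum[of k "{..k}" N] by simp
  ultimately show ?thesis by (intro exI[of _ r]) (auto intro!: N intro: order_trans)
qed

text \<open>Weighting the increments of the subsequence by \<open>2 ^ n\<close> replaces Minkowski's inequality.\<close>

lemma L2_complete:
  fixes f :: "nat \<Rightarrow> 'a::euclidean_space \<Rightarrow> 'b::euclidean_space"
  assumes f: "\<And>n. L2 \<Omega> (f n)"
    and cauchy: "\<And>e. e > 0 \<Longrightarrow> \<exists>N. \<forall>m\<ge>N. \<forall>n\<ge>N. l2_norm \<Omega> (\<lambda>x. f m x - f n x) < e"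
  shows "\<exists>g. L2 \<Omega> g \<and> (\<lambda>n. l2_norm \<Omega> (\<lambda>x. f n x - g x)) \<longlonglongrightarrow> 0"
proof -
  let ?M = "lebesgue_on \<Omega>"
  have [measurable]: "f n \<in> borel_measurable ?M" for n using f by (simp add: L2_def)
  obtain r where r: "strict_mono r"
    and rb: "\<And>k m n. m \<ge> r k \<Longrightarrow> n \<ge> r k \<Longrightarrow> l2_norm \<Omega> (\<lambda>x. f m x - f n x) < (1/2) ^ k"
    using rapidly_cauchy_subseq[of "\<lambda>m n. l2_norm \<Omega> (\<lambda>x. f m x - f n x)", OF cauchy]
    by blast
  define h where "h k x = f (r (Suc k)) x - f (r k) x" for k x
  have hL2: "L2 \<Omega> (h k)" for k unfolding h_def using f by blast
  have [measurable]: "h n \<in> borel_measurable ?M" for n using hL2 by (simp add: L2_def)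
  have hb: "(l2_norm \<Omega> (h k))\<^sup>2 \<le> (1/4) ^ k" for k
  proof -
    have "l2_norm \<Omega> (h k) \<le> (1/2) ^ k"
      unfolding h_def using rb[of k "r (Suc k)" "r k"] strict_mono_leD[OF r, of k "Suc k"] by simp
    then have "(l2_norm \<Omega> (h k))\<^sup>2 \<le> ((1/2) ^ k)\<^sup>2"
      by (intro power_mono) auto
    also have "((1/2::real) ^ k)\<^sup>2 = (1/4) ^ k"
      unfolding power2_eq_square power_mult_distrib[symmetric] by simp
    finally show ?thesis .
  qed
  \<comment> \<open>The weights are affordable because the squared norms decay like
    \<open>4^-k\<close>: the weighted sum has a finite integral, hence finite values almost
    everywhere.\<close>
  have "(\<integral>\<^sup>+x. (\<Sum>k. ennreal (2 ^ k * (norm (h k x))\<^sup>2)) \<partial>?M) =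
          (\<Sum>k. \<integral>\<^sup>+x. ennreal (2 ^ k * (norm (h k x))\<^sup>2) \<partial>?M)"
    by (rule nn_integral_suminf) measurable
  also have "\<dots> = (\<Sum>k. ennreal (2 ^ k * (l2_norm \<Omega> (h k))\<^sup>2))"
    by (intro suminf_cong) (simp add: ennreal_mult nn_integral_cmult nn_integral_norm_sq[OF hL2])
  also have "\<dots> \<le> (\<Sum>k. ennreal ((1/2) ^ k))"
  proof (intro suminf_le ennreal_leI)
    fix k :: nat
    have "2 ^ k * (l2_norm \<Omega> (h k))\<^sup>2 \<le> 2 ^ k * (1/4) ^ k" using hb by simp
    also have "\<dots> = (1/2::real) ^ k" by (simp flip: power_mult_distrib)
    finally show "2 ^ k * (l2_norm \<Omega> (h k))\<^sup>2 \<le> (1/2) ^ k" .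
  qed auto
  also have "\<dots> = ennreal (\<Sum>k. (1/2) ^ k)"
    by (rule suminf_ennreal2) (auto intro: summable_geometric)
  also have "\<dots> < \<infinity>" by simp
  finally have "AE x in ?M. (\<Sum>k. ennreal (2 ^ k * (norm (h k x))\<^sup>2)) \<noteq> \<infinity>"
    by (intro nn_integral_noteq_infinite) auto
  then have conv: "AE x in ?M. convergent (\<lambda>k. f (r k) x)"
  proof eventually_elim
    case (elim x)
    then have s: "summable (\<lambda>k. 2 ^ k * (norm (h k x))\<^sup>2)"
      by (intro summable_suminf_not_top) auto
    have "summable (\<lambda>k. norm (h k x))"
    proof (rule summable_comparison_test)
      show "summable (\<lambda>k. 2 ^ k * (norm (h k x))\<^sup>2 + (1/2) ^ k)"
        by (intro summable_add s summable_geometric) simp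
      \<comment> \<open>Young's inequality, by expanding
        \<open>2 ^ k * (norm (h k x) - (1/2) ^ k)\<^sup>2 \<ge> 0\<close>: the weighted squares plus
        a geometric series dominate the increments.\<close>
      have "norm (h k x) \<le> 2 ^ k * (norm (h k x))\<^sup>2 + (1/2) ^ k" for k
      proof -
        have eq: "(2::real) ^ k * (1/2) ^ k = 1" by (simp flip: power_mult_distrib)
        have "0 \<le> 2 ^ k * (norm (h k x) - (1/2) ^ k)\<^sup>2" by simp
        also have "\<dots> = 2 ^ k * (norm (h k x))\<^sup>2 + (2 ^ k * (1/2) ^ k) * (1/2) ^ k
              - 2 * (2 ^ k * (1/2) ^ k) * norm (h k x)"
          by (simp add: power2_eq_square algebra_simps)
        finally show ?thesis unfolding eq using norm_ge_zero[of "h k x"] by linarith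
      qed
      then show "\<exists>N. \<forall>k\<ge>N. norm (norm (h k x)) \<le> 2 ^ k * (norm (h k x))\<^sup>2 + (1/2) ^ k"
        by simp
    qed
    then have "summable (\<lambda>k. h k x)" by (rule summable_norm_cancel)
    then have "convergent (\<lambda>n. \<Sum>k<n. h k x)" by (simp add: summable_iff_convergent)
    then have "convergent (\<lambda>n. f (r 0) x + (\<Sum>k<n. h k x))"
      by (intro convergent_add convergent_const)
    moreover have "f (r 0) x + (\<Sum>k<n. h k x) = f (r n) x" for n
      using sum_lessThan_telescope[of "\<lambda>n. f (r n) x" n] by (simp add: h_def)
    ultimately show ?case by simp
  qed
  \<comment> \<open>\<open>lim\<close> is total, so \<open>g\<close> is measurable as it stands; the
    points where the sequence diverges form a null set.\<close>
  define g where "g x = lim (\<lambda>k. f (r k) x)" for x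
  have gm [measurable]: "g \<in> borel_measurable ?M" unfolding g_def by measurable
  have lim: "AE x in ?M. (\<lambda>k. f (r k) x) \<longlonglongrightarrow> g x"
    using conv unfolding g_def by eventually_elim (simp add: convergent_LIMSEQ_iff)
  \<comment> \<open>Fatou along the subsequence transfers the Cauchy bound to the limit. It is
    stated with \<open>ennreal\<close> integrals because \<open>L2 \<Omega> g\<close> is only
    deduced from it.\<close>
  have bound: "(\<integral>\<^sup>+x. ennreal ((norm (f m x - g x))\<^sup>2) \<partial>?M) \<le> ennreal (e\<^sup>2)"
    if e: "\<And>n. n \<ge> m \<Longrightarrow> l2_norm \<Omega> (\<lambda>x. f m x - f n x) \<le> e" for m e
  proof -
    have "(\<integral>\<^sup>+x. ennreal ((norm (f m x - g x))\<^sup>2) \<partial>?M) =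
          (\<integral>\<^sup>+x. liminf (\<lambda>k. ennreal ((norm (f m x - f (r k) x))\<^sup>2)) \<partial>?M)"
    proof (rule nn_integral_cong_AE)
      show "AE x in ?M. ennreal ((norm (f m x - g x))\<^sup>2) =
              liminf (\<lambda>k. ennreal ((norm (f m x - f (r k) x))\<^sup>2))"
        using lim
      proof eventually_elim
        case (elim x)
        then have "(\<lambda>k. ennreal ((norm (f m x - f (r k) x))\<^sup>2)) \<longlonglongrightarrow> ennreal ((norm (f m x - g x))\<^sup>2)"
          by (intro tendsto_ennrealI tendsto_intros)
        then show ?case by (rule lim_imp_Liminf[OF sequentially_bot, symmetric])
      qed
    qed
    also have "\<dots> \<le> liminf (\<lambda>k. \<integral>\<^sup>+x. ennreal ((norm (f m x - f (r k) x))\<^sup>2) \<partial>?M)"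
      by (rule nn_integral_liminf) measurable
    also have "\<dots> = liminf (\<lambda>k. ennreal ((l2_norm \<Omega> (\<lambda>x. f m x - f (r k) x))\<^sup>2))"
      using f by (simp add: nn_integral_norm_sq L2_diff)
    also have "\<dots> \<le> limsup (\<lambda>k. ennreal ((l2_norm \<Omega> (\<lambda>x. f m x - f (r k) x))\<^sup>2))"
      by (rule Liminf_le_Limsup) simp
    also have "\<dots> \<le> ennreal (e\<^sup>2)"
    proof (rule Limsup_bounded)
      show "\<forall>\<^sub>F k in sequentially. ennreal ((l2_norm \<Omega> (\<lambda>x. f m x - f (r k) x))\<^sup>2) \<le> ennreal (e\<^sup>2)"
        using eventually_ge_at_top[of m]
      proof eventually_elim
        case (elim k)
        then have "r k \<ge> m" using seq_suble[OF r, of k] by simp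
        then show ?case using e[of "r k"] by (intro ennreal_leI power_mono) auto
      qed
    qed
    finally show ?thesis .
  qed
  obtain N where N: "\<And>m n. m \<ge> N \<Longrightarrow> n \<ge> N \<Longrightarrow> l2_norm \<Omega> (\<lambda>x. f m x - f n x) < 1"
    using cauchy[of 1] by auto
  have "(\<integral>\<^sup>+x. ennreal ((norm (f N x - g x))\<^sup>2) \<partial>?M) \<le> ennreal (1\<^sup>2)"
    using N[of N] by (intro bound) (auto intro: less_imp_le)
  then have "L2 \<Omega> (\<lambda>x. f N x - g x)"
    by (intro L2_I_nn) (auto simp: top_unique ennreal_one_neq_top less_top intro: le_less_trans)
  from L2_diff[OF f[of N] this] have g: "L2 \<Omega> g" by simp
  moreover have "(\<lambda>n. l2_norm \<Omega> (\<lambda>x. f n x - g x)) \<longlonglongrightarrow> 0"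
  proof (rule LIMSEQ_I)
    fix e :: real assume "e > 0"
    then obtain N where N: "\<And>m n. m \<ge> N \<Longrightarrow> n \<ge> N \<Longrightarrow> l2_norm \<Omega> (\<lambda>x. f m x - f n x) < e/2"
      using cauchy[of "e/2"] by auto
    have "norm (l2_norm \<Omega> (\<lambda>x. f m x - g x) - 0) < e" if "m \<ge> N" for m
    proof -
      have "ennreal ((l2_norm \<Omega> (\<lambda>x. f m x - g x))\<^sup>2) \<le> ennreal ((e/2)\<^sup>2)"
        using bound[of m "e/2"] N[OF that] that f g
        by (simp add: nn_integral_norm_sq L2_diff less_imp_le)
      then have "l2_norm \<Omega> (\<lambda>x. f m x - g x) \<le> e/2"
        using \<open>e > 0\<close> by (subst (asm) ennreal_le_iff) (auto intro: power2_le_imp_le)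
      then show ?thesis using \<open>e > 0\<close> by simp
    qed
    then show "\<exists>N. \<forall>m\<ge>N. norm (l2_norm \<Omega> (\<lambda>x. f m x - g x) - 0) < e" by blast
  qed
  ultimately show ?thesis by blast
qed

section \<open>Smooth cutoff functions\<close>

lemma partial_deriv_eq:
  "(f has_derivative D) (at x) \<Longrightarrow> partial_deriv j f x = D (axis j 1)"
  unfolding partial_deriv_def using frechet_derivative_at by metis

lemma C_k_Suc_imp: "C_k (Suc k) f \<Longrightarrow> C_k k f"
  by (induction k arbitrary: f) (auto intro: differentiable_imp_continuous_on)

lemma C_k_const: "C_k k (\<lambda>x. c)"
proof (induction k arbitrary: c)
  case (Suc k)
  have "partial_deriv j (\<lambda>x. c) = (\<lambda>x. 0)" for j :: 'a
    by (rule ext, subst partial_deriv_eq[OF has_derivative_const]) simp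
  then show ?case using Suc by (simp add: differentiable_on_def)
qed simp

lemma partial_deriv_add:
  assumes "f differentiable_on UNIV" "g differentiable_on UNIV"
  shows "partial_deriv j (\<lambda>x. f x + g x) = (\<lambda>x. partial_deriv j f x + partial_deriv j g x)"
proof
  fix x
  have "(f has_derivative frechet_derivative f (at x)) (at x)"
    "(g has_derivative frechet_derivative g (at x)) (at x)"
    using assms by (auto simp: differentiable_on_def frechet_derivative_works)
  from partial_deriv_eq[OF has_derivative_add[OF this]]
  show "partial_deriv j (\<lambda>x. f x + g x) x = partial_deriv j f x + partial_deriv j g x"
    by (simp add: partial_deriv_def)
qed

lemma partial_deriv_mult:
  assumes "f differentiable_on UNIV" "g differentiable_on UNIV"
  shows "partial_deriv j (\<lambda>x. f x * g x) =
           (\<lambda>x. f x * partial_deriv j g x + partial_deriv j f x * g x)"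
proof
  fix x
  have "(f has_derivative frechet_derivative f (at x)) (at x)"
    "(g has_derivative frechet_derivative g (at x)) (at x)"
    using assms by (auto simp: differentiable_on_def frechet_derivative_works)
  from partial_deriv_eq[OF has_derivative_mult[OF this]]
  show "partial_deriv j (\<lambda>x. f x * g x) x = f x * partial_deriv j g x + partial_deriv j f x * g x"
    by (simp add: partial_deriv_def)
qed

lemma C_k_add: "C_k k f \<Longrightarrow> C_k k g \<Longrightarrow> C_k k (\<lambda>x. f x + g x)"
proof (induction k arbitrary: f g)
  case (Suc k)
  then show ?case
    by (auto simp: partial_deriv_add intro: differentiable_on_add)
qed (auto intro: continuous_intros)

lemma C_k_mult: "C_k k f \<Longrightarrow> C_k k g \<Longrightarrow> C_k k (\<lambda>x. f x * g x)"
proof (induction k arbitrary: f g)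
  case (Suc k)
  then have "C_k k f" "C_k k g" using C_k_Suc_imp by blast+
  with Suc show ?case
    by (auto simp: partial_deriv_mult intro!: differentiable_on_mult C_k_add)
qed (auto intro: continuous_intros)

lemma smooth_const [simp]: "smooth (\<lambda>x. c)"
  by (simp add: smooth_def C_k_const)

lemma smooth_add: "smooth f \<Longrightarrow> smooth g \<Longrightarrow> smooth (\<lambda>x. f x + g x)"
  by (simp add: smooth_def C_k_add)

lemma smooth_mult: "smooth f \<Longrightarrow> smooth g \<Longrightarrow> smooth (\<lambda>x. f x * g x)"
  by (simp add: smooth_def C_k_mult)

lemma smooth_diff:
  assumes "smooth f" "smooth g"
  shows "smooth (\<lambda>x. f x - g x)"
  using smooth_add[OF assms(1) smooth_mult[OF smooth_const[of "-1"] assms(2)]] by simp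

lemma smooth_prod:
  "(\<And>i. i \<in> I \<Longrightarrow> smooth (f i)) \<Longrightarrow> smooth (\<lambda>x. \<Prod>i\<in>I. f i x)"
  by (induction I rule: infinite_finite_induct) (auto intro: smooth_mult)

lemma smooth_differentiable: "smooth f \<Longrightarrow> f differentiable_on UNIV"
  unfolding smooth_def using C_k.simps(2)[of 0 f] by blast

lemma smooth_has_derivative:
  assumes "smooth f"
  shows "(f has_derivative (\<lambda>z. \<Sum>j\<in>UNIV. partial_deriv j f x * z $ j)) (at x)"
proof -
  have d: "(f has_derivative frechet_derivative f (at x)) (at x)"
    using smooth_differentiable[OF assms] by (auto simp: differentiable_on_def frechet_derivative_works)
  then interpret bounded_linear "frechet_derivative f (at x)" by (rule has_derivative_bounded_linear)
  have "frechet_derivative f (at x) z = (\<Sum>j\<in>UNIV. partial_deriv j f x * z $ j)" for z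
  proof -
    have "frechet_derivative f (at x) z = frechet_derivative f (at x) (\<Sum>j\<in>UNIV. z $ j *\<^sub>R axis j 1)"
      by (simp add: basis_expansion flip: scalar_mult_eq_scaleR)
    also have "\<dots> = (\<Sum>j\<in>UNIV. partial_deriv j f x * z $ j)"
      by (simp add: sum scaleR partial_deriv_def mult.commute)
    finally show ?thesis .
  qed
  then have "frechet_derivative f (at x) = (\<lambda>z. \<Sum>j\<in>UNIV. partial_deriv j f x * z $ j)" by blast
  with d show ?thesis by simp
qed

lemma smooth_continuous: "smooth f \<Longrightarrow> continuous_on UNIV f"
  unfolding smooth_def using C_k.simps(1) by blast

lemma smooth_partial_deriv: "smooth f \<Longrightarrow> smooth (partial_deriv j f)"
  unfolding smooth_def using C_k.simps(2) by blast

text \<open>Indexing a whole tower of successive derivatives lets the induction on the order close: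
  differentiation along a coordinate yields a constant times the next member of the tower.\<close>

lemma smooth_coordinate_compose:
  fixes h :: "nat \<Rightarrow> real \<Rightarrow> real" and i :: "'d::finite"
  assumes h: "\<And>n t. (h n has_real_derivative h (Suc n) t) (at t)"
  shows "smooth (\<lambda>x::real^'d. h n (x $ i))"
proof -
  have d: "((\<lambda>x::real^'d. h n (x $ i)) has_derivative (\<lambda>z. z $ i * h (Suc n) (x $ i))) (at x)" for n x
  proof -
    have "(h n has_derivative (\<lambda>t. t * h (Suc n) (x $ i))) (at (x $ i))"
      using h[of n "x $ i"] by (simp add: has_field_derivative_def mult_commute_abs)
    from has_derivative_compose[OF bounded_linear_imp_has_derivative[OF bounded_linear_vec_nth[of i]] this]
    show ?thesis .
  qed
  have pd: "partial_deriv j (\<lambda>x::real^'d. h n (x $ i)) =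
      (\<lambda>x. (if i = j then 1 else 0) * h (Suc n) (x $ i))" for j n
    by (rule ext, subst partial_deriv_eq[OF d]) (simp add: axis_def)
  have "C_k k (\<lambda>x::real^'d. h n (x $ i))" for k
  proof (induction k arbitrary: n)
    case 0
    have "continuous_on UNIV (\<lambda>x::real^'d. h n (x $ i))"
      using d by (intro differentiable_imp_continuous_on) (auto simp: differentiable_on_def differentiable_def)
    then show ?case by simp
  next
    case (Suc k)
    have "(\<lambda>x::real^'d. h n (x $ i)) differentiable_on UNIV"
      using d by (auto simp: differentiable_on_def differentiable_def)
    then show ?case using Suc by (auto simp: pd intro!: C_k_mult C_k_const)
  qed
  then show ?thesis by (simp add: smooth_def)
qed

section \<open>Flat functions and box cutoffs\<close>

text \<open>The classical flat functions \<open>p(1/t) exp(-1/t)\<close>, continued by zero. Unlike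
  the single function with \<open>p = 1\<close>, the family is closed under differentiation.\<close>

definition flat_fun :: "real poly \<Rightarrow> real \<Rightarrow> real" where
  "flat_fun p t = (if t > 0 then poly p (1 / t) * exp (- (1 / t)) else 0)"

text \<open>With \<open>s = 1/t\<close> the chain rule gives the derivative
  \<open>- s^2 (p' - p) exp(-s)\<close>; the factor \<open>[:0, 0, 1:]\<close> is
  \<open>s^2\<close>.\<close>

definition flat_step :: "real poly \<Rightarrow> real poly" where
  "flat_step p = [:0, 0, 1:] * (p - pderiv p)"

lemma poly_times_exp_minus_tendsto_0: "((\<lambda>s. poly p s * exp (- s)) \<longlongrightarrow> (0::real)) at_top"
proof -
  have "((\<lambda>s. \<Sum>i\<le>degree p. coeff p i * (s ^ i / exp s)) \<longlongrightarrow> (\<Sum>i\<le>degree p. coeff p i * 0)) at_top"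
    by (intro tendsto_intros tendsto_power_div_exp_0)
  then show ?thesis
    by (simp add: poly_altdef sum_distrib_right exp_minus divide_inverse mult.assoc)
qed

lemma flat_fun_derivative:
  "(flat_fun p has_real_derivative flat_fun (flat_step p) t) (at t)"
proof -
  consider "t > 0" | "t < 0" | "t = 0" by linarith
  then show ?thesis
  proof cases
    case 1
    have "((\<lambda>t. poly p (1 / t) * exp (- (1 / t))) has_real_derivative flat_fun (flat_step p) t) (at t)"
      using 1 by (auto intro!: derivative_eq_intros poly_DERIV[THEN DERIV_chain2]
          simp: flat_fun_def flat_step_def field_simps power2_eq_square)
    then show ?thesis
      by (rule has_field_derivative_transform_within_open[of _ _ _ "{0<..}"])
        (use 1 in \<open>auto simp: flat_fun_def\<close>)
  next
    case 2
    have "((\<lambda>t. 0) has_real_derivative flat_fun (flat_step p) t) (at t)"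
      using 2 by (simp add: flat_fun_def)
    then show ?thesis
      by (rule has_field_derivative_transform_within_open[of _ _ _ "{..<0}"])
        (use 2 in \<open>auto simp: flat_fun_def\<close>)
  next
    case 3
    have "((\<lambda>y. flat_fun p y / y) \<longlongrightarrow> 0) (at 0)"
    proof (rule filterlim_split_at)
      show "((\<lambda>y. flat_fun p y / y) \<longlongrightarrow> 0) (at_left 0)"
        by (rule tendsto_eventually) (auto simp: flat_fun_def eventually_at_filter)
      \<comment> \<open>The factor \<open>1 / y\<close> of the difference quotient is absorbed into
        the polynomial: \<open>pCons 0 p\<close> is \<open>s p(s)\<close> at
        \<open>s = 1 / y\<close>.\<close>
      have "((\<lambda>y. poly (pCons 0 p) (inverse y) * exp (- inverse y)) \<longlongrightarrow> 0) (at_right 0)"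
        by (rule filterlim_compose[OF poly_times_exp_minus_tendsto_0 filterlim_inverse_at_top_right])
      then show "((\<lambda>y. flat_fun p y / y) \<longlongrightarrow> 0) (at_right 0)"
        by (rule Lim_transform_eventually)
          (auto simp: flat_fun_def eventually_at_filter field_simps)
    qed
    then show ?thesis
      unfolding has_field_derivative_iff using 3 by (simp add: flat_fun_def)
  qed
qed

definition cutoff :: "real \<Rightarrow> real" where
  "cutoff = flat_fun 1"

lemma cutoff_eq: "cutoff t = (if t > 0 then exp (- (1 / t)) else 0)"
  by (simp add: cutoff_def flat_fun_def)

lemma smooth_cutoff:
  fixes i :: "'d::finite"
  shows "smooth (\<lambda>x::real^'d. cutoff (a * x $ i + b))"
proof -
  define h where "h n t = a ^ n * flat_fun ((flat_step ^^ n) 1) (a * t + b)" for n t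
  have "(h n has_real_derivative h (Suc n) t) (at t)" for n t
    unfolding h_def
    by (auto intro!: derivative_eq_intros flat_fun_derivative[THEN DERIV_chain2])
  from smooth_coordinate_compose[of h 0, OF this] show ?thesis
    by (simp add: h_def cutoff_def)
qed

text \<open>The factor \<open>k\<close> steepens the profile while all supports stay in the same
  closed box: for \<open>t > 0\<close> the value \<open>exp (- 1 / (k t))\<close> tends to 1, so the
  indicator of the open box is approached without leaving the domain.\<close>

definition box_cutoff :: "nat \<Rightarrow> real^'d::finite \<Rightarrow> real^'d \<Rightarrow> real^'d \<Rightarrow> real" where
  "box_cutoff k a b x =
     (\<Prod>i\<in>UNIV. cutoff (real k * (x $ i - a $ i)) * cutoff (real k * (b $ i - x $ i)))"

lemma smooth_box_cutoff: "smooth (box_cutoff k a b)"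
proof -
  have "smooth (\<lambda>x::real^'d. cutoff (real k * x $ i + (- real k * a $ i)) *
          cutoff (- real k * x $ i + real k * b $ i))" for a b :: "real^'d" and i
    by (intro smooth_mult smooth_cutoff)
  from smooth_prod[of UNIV, OF this] show ?thesis
    unfolding box_cutoff_def[abs_def] by (simp add: algebra_simps)
qed

lemma cutoff_bounds: "0 \<le> cutoff t" "cutoff t \<le> 1"
  by (auto simp: cutoff_eq)

lemma box_cutoff_bounds: "0 \<le> box_cutoff k a b x" "box_cutoff k a b x \<le> 1"
  unfolding box_cutoff_def
  by (auto intro!: prod_nonneg prod_le_1 mult_le_one simp: cutoff_bounds)

lemma box_cutoff_zero: "x \<notin> box a b \<Longrightarrow> box_cutoff k a b x = 0"
proof -
  assume "x \<notin> box a b"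
  then obtain i where "x $ i \<le> a $ i \<or> b $ i \<le> x $ i"
    by (auto simp: mem_box_cart not_less)
  then have "cutoff (real k * (x $ i - a $ i)) * cutoff (real k * (b $ i - x $ i)) = 0"
    by (auto simp: cutoff_eq not_less zero_less_mult_iff)
  then show ?thesis
    unfolding box_cutoff_def by (intro prod_zero) auto
qed

lemma cutoff_tendsto_1:
  assumes "t > 0"
  shows "(\<lambda>k. cutoff (real k * t)) \<longlonglongrightarrow> 1"
proof -
  have "(\<lambda>k. exp (- (1 / t * (1 / real k)))) \<longlonglongrightarrow> exp (- (1 / t * 0))"
    by (intro tendsto_intros lim_1_over_n)
  then have "(\<lambda>k. exp (- (1 / (real k * t)))) \<longlonglongrightarrow> 1" by (simp add: mult.commute)
  then show ?thesis
  proof (rule Lim_transform_eventually)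
    show "\<forall>\<^sub>F k in sequentially. exp (- (1 / (real k * t))) = cutoff (real k * t)"
      using eventually_gt_at_top[of "0::nat"] by eventually_elim (simp add: cutoff_eq assms)
  qed
qed

lemma box_cutoff_tendsto: "(\<lambda>k. box_cutoff k a b x) \<longlonglongrightarrow> indicator (box a b) x"
proof (cases "x \<in> box a b")
  case True
  then have "(\<lambda>k. box_cutoff k a b x) \<longlonglongrightarrow> (\<Prod>i\<in>(UNIV::'a set). 1 * 1)"
    unfolding box_cutoff_def
    by (intro tendsto_prod tendsto_mult cutoff_tendsto_1) (auto simp: mem_box_cart)
  then show ?thesis using True by simp
qed (simp add: box_cutoff_zero)

lemma test_function_box_cutoff:
  assumes "cbox a b \<subseteq> \<Omega>"
  shows "test_function \<Omega> (box_cutoff k a b)"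
proof -
  have "{x. box_cutoff k a b x \<noteq> 0} \<subseteq> cbox a b"
    using box_cutoff_zero box_subset_cbox by blast
  then have "closure {x. box_cutoff k a b x \<noteq> 0} \<subseteq> cbox a b"
    by (rule closure_minimal) (rule closed_cbox)
  moreover from this have "compact (closure {x. box_cutoff k a b x \<noteq> 0})"
    using compact_cbox bounded_subset by (metis bounded_cbox compact_eq_bounded_closed closed_closure)
  ultimately show ?thesis using assms by (auto simp: test_function_def smooth_box_cutoff)
qed

section \<open>The fundamental lemma of the calculus of variations\<close>

lemma integral_lebesgue_on_indicator:
  fixes f :: "'a::euclidean_space \<Rightarrow> real"
  assumes "\<Omega> \<in> sets lebesgue"
  shows "integral\<^sup>L (lebesgue_on \<Omega>) f = integral\<^sup>L lebesgue (\<lambda>x. indicator \<Omega> x * f x)"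
  using integral_restrict_space[of \<Omega> lebesgue f] assms by simp

text \<open>Open boxes form an intersection-stable generator of the Borel sets, so vanishing
  integrals spread to all Borel sets by a Dynkin argument, and set integrals determine a function
  almost everywhere.\<close>

lemma AE_zero_if_integral_boxes_zero:
  fixes g :: "'a::euclidean_space \<Rightarrow> real"
  assumes g: "integrable lborel g"
    and box: "\<And>a b. integral\<^sup>L lborel (\<lambda>x. indicator (box a b) x * g x) = 0"
  shows "AE x in lborel. g x = 0"
proof -
  \<comment> \<open>The complement step of the induction needs the integral over the whole space,
    obtained as a limit over growing boxes.\<close>
  have UN: "integral\<^sup>L lborel g = 0"
  proof -
    define A where "A n = box (- (real n *\<^sub>R One)) (real n *\<^sub>R One :: 'a)" for n
    have "(\<lambda>n. integral\<^sup>L lborel (\<lambda>x. indicator (A n) x * g x)) \<longlonglongrightarrow> integral\<^sup>L lborel g"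
    proof (rule integral_dominated_convergence[where w="\<lambda>x. norm (g x)"])
      show "AE x in lborel. (\<lambda>n. indicator (A n) x * g x) \<longlonglongrightarrow> g x"
      proof (rule AE_I2)
        fix x :: 'a
        obtain n0 where n0: "norm x < real n0" using reals_Archimedean2 by blast
        have "x \<in> A n" if "n \<ge> n0" for n
        proof -
          have "\<bar>x \<bullet> i\<bar> < real n" if "i \<in> Basis" for i
            using Basis_le_norm[OF that, of x] n0 \<open>n \<ge> n0\<close> by linarith
          then show ?thesis by (force simp: A_def mem_box abs_less_iff)
        qed
        then have "\<forall>\<^sub>F n in sequentially. indicator (A n) x * g x = g x"
          by (intro eventually_mono[OF eventually_ge_at_top[of n0]]) simp
        then show "(\<lambda>n. indicator (A n) x * g x) \<longlonglongrightarrow> g x" by (rule tendsto_eventually)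
      qed
    qed (use g in \<open>auto simp: A_def indicator_def\<close>)
    moreover have "integral\<^sup>L lborel (\<lambda>x. indicator (A n) x * g x) = 0" for n
      unfolding A_def by (rule box)
    ultimately show ?thesis by (simp add: LIMSEQ_unique)
  qed
  have si: "set_integrable lborel A g" if "A \<in> sets borel" for A
    using g that unfolding set_integrable_def
    by (intro integrable_mult_indicator) auto
  have all: "(LINT x:A|lborel. g x) = 0" if "A \<in> sets borel" for A
  proof -
    let ?G = "range (\<lambda>(a, b). box a b :: 'a set)"
    have sb: "sigma_sets UNIV ?G = sets borel"
      by (subst borel_eq_box) simp
    have "Int_stable ?G"
      by (auto simp: Int_stable_def box_Int_box)
    moreover have "?G \<subseteq> Pow UNIV" by simp
    moreover have "A \<in> sigma_sets UNIV ?G" using that sb by simp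
    ultimately show ?thesis
    proof (induction rule: sigma_sets_induct_disjoint)
      case (basic A)
      then show ?case using box by (auto simp: set_lebesgue_integral_def)
    next
      case (compl A)
      then have A: "A \<in> sets borel" by (simp add: sb)
      then have "(LINT x:A \<union> (UNIV - A)|lborel. g x) =
          (LINT x:A|lborel. g x) + (LINT x:UNIV - A|lborel. g x)"
        by (intro set_integral_Un si) auto
      moreover have "(LINT x:A \<union> (UNIV - A)|lborel. g x) = 0"
        using UN by (simp add: set_lebesgue_integral_def)
      ultimately show ?case using compl by simp
    next
      case (union A)
      then have A: "A i \<in> sets borel" for i by (auto simp: sb)
      have "(LINT x:(\<Union>i. A i)|lborel. g x) = (\<Sum>i. (LINT x:A i|lborel. g x))"
        using A union(1) by (intro lebesgue_integral_countable_add si)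
          (auto simp: disjoint_family_on_def)
      then show ?case using union by simp
    qed (simp_all add: set_lebesgue_integral_def)
  qed
  show ?thesis
  proof (rule density_unique_real)
    show "(LINT x:A|lborel. g x) = (LINT x:A|lborel. 0)" if "A \<in> sets lborel" for A
      using all[of A] that by (simp add: set_lebesgue_integral_def)
  qed (use g in auto)
qed

lemma bounded_if_compact_support:
  fixes \<phi> :: "'a::metric_space \<Rightarrow> real"
  assumes c: "continuous_on UNIV \<phi>" and K: "compact (closure {x. \<phi> x \<noteq> 0})"
  obtains B where "B > 0" "\<And>x. \<bar>\<phi> x\<bar> \<le> B"
proof -
  let ?S = "closure {x. \<phi> x \<noteq> 0}"
  have "bounded (\<phi> ` ?S)"
    using c K by (meson compact_continuous_image compact_imp_bounded continuous_on_subset subset_UNIV)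
  then obtain B where B: "\<And>x. x \<in> ?S \<Longrightarrow> \<bar>\<phi> x\<bar> \<le> B"
    by (auto simp: bounded_iff)
  have "\<bar>\<phi> x\<bar> \<le> \<bar>B\<bar> + 1" for x
  proof (cases "\<phi> x = 0")
    case False
    then have "x \<in> ?S" using closure_subset[of "{x. \<phi> x \<noteq> 0}"] by auto
    then show ?thesis using B[of x] by linarith
  qed auto
  then show ?thesis by (intro that[of "\<bar>B\<bar> + 1"]) auto
qed

text \<open>Dominated convergence along box cutoffs turns the hypothesis into vanishing integrals
  over boxes. This reaches only boxes with closed hull inside \<open>\<Omega>\<close>, so the
  conclusion is first local and then patched over countably many closed boxes.\<close>

lemma fundamental_lemma_variations:
  fixes f :: "real^'d::finite \<Rightarrow> real"
  assumes "open \<Omega>" and f: "integrable (lebesgue_on \<Omega>) f"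
    and test: "\<And>\<phi>. test_function \<Omega> \<phi> \<Longrightarrow> integral\<^sup>L (lebesgue_on \<Omega>) (\<lambda>x. f x * \<phi> x) = 0"
  shows "AE x in lebesgue_on \<Omega>. f x = 0"
proof -
  have \<Omega>: "\<Omega> \<in> sets lebesgue" using assms(1) by simp
  have box0: "integral\<^sup>L lebesgue (\<lambda>x. indicator (box a b) x * (indicator \<Omega> x * f x)) = 0"
    if ab: "box a b \<subseteq> cbox c d" "cbox c d \<subseteq> \<Omega>" for a b c d
  proof (cases "box a b = {}")
    \<comment> \<open>Only for a nonempty box is \<open>cbox a b\<close> the closure, and therefore
      contained in \<open>\<Omega>\<close>.\<close>
    case False
    then have "cbox a b \<subseteq> \<Omega>"
      using closure_minimal[OF ab(1) closed_cbox] ab(2) by (simp add: closure_box)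
    then have tf: "test_function \<Omega> (box_cutoff k a b)" for k by (rule test_function_box_cutoff)
    have "(\<lambda>k. integral\<^sup>L (lebesgue_on \<Omega>) (\<lambda>x. f x * box_cutoff k a b x))
            \<longlonglongrightarrow> integral\<^sup>L (lebesgue_on \<Omega>) (\<lambda>x. f x * indicator (box a b) x)"
    proof (rule integral_dominated_convergence[where w="\<lambda>x. norm (f x)"])
      show "AE x in lebesgue_on \<Omega>. (\<lambda>k. f x * box_cutoff k a b x) \<longlonglongrightarrow> f x * indicator (box a b) x"
        by (intro AE_I2 tendsto_mult tendsto_const box_cutoff_tendsto)
      have [measurable]: "box_cutoff k a b \<in> borel_measurable (lebesgue_on \<Omega>)" for k
        by (intro continuous_imp_measurable_on_sets_lebesgue \<Omega>
            continuous_on_subset[OF smooth_continuous[OF smooth_box_cutoff]]) simp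
      have [measurable]: "f \<in> borel_measurable (lebesgue_on \<Omega>)" using f by auto
      show "(\<lambda>x. f x * box_cutoff k a b x) \<in> borel_measurable (lebesgue_on \<Omega>)" for k
        by measurable
      have "box a b \<in> sets (lebesgue_on \<Omega>)"
        using \<open>cbox a b \<subseteq> \<Omega>\<close> box_subset_cbox[of a b] \<Omega> by (auto simp: sets_restrict_space_iff)
      then show "(\<lambda>x. f x * indicator (box a b) x) \<in> borel_measurable (lebesgue_on \<Omega>)"
        by measurable
      show "AE x in lebesgue_on \<Omega>. norm (f x * box_cutoff k a b x) \<le> norm (f x)" for k
        by (intro AE_I2) (simp add: abs_mult mult_left_le box_cutoff_bounds)
    qed (use f in auto)
    then have "integral\<^sup>L (lebesgue_on \<Omega>) (\<lambda>x. f x * indicator (box a b) x) = 0"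
      using test[OF tf] by (simp add: LIMSEQ_const_iff)
    then show ?thesis by (simp add: integral_lebesgue_on_indicator[OF \<Omega>] mult_ac)
  qed simp
  have f\<Omega>: "integrable lebesgue (\<lambda>x. indicator \<Omega> x * f x)"
    using f integrable_restrict_space[of \<Omega> lebesgue f] \<Omega> by simp
  \<comment> \<open>\<open>f\<close> is merely Lebesgue measurable, while the box argument runs on
    \<open>lborel\<close>; a Borel representative replaces it.\<close>
  then obtain g where g: "g \<in> borel_measurable lborel" "AE x in lborel. indicator \<Omega> x * f x = g x"
    using completion_ex_borel_measurable_real[of "\<lambda>x. indicator \<Omega> x * f x" lborel] by auto
  then have [measurable]: "g \<in> borel_measurable borel" by simp
  have ae: "AE x in lebesgue. indicator \<Omega> x * f x = g x" using g(2) by (rule AE_completion)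
  have gm: "g \<in> borel_measurable lebesgue" using g(1) by (rule measurable_completion)
  have "integrable lebesgue g"
    using f\<Omega> ae gm integrable_cong_AE[of "\<lambda>x. indicator \<Omega> x * f x" lebesgue g] by auto
  then have gi: "integrable lborel g" using integrable_completion[OF g(1)] by simp
  \<comment> \<open>After restriction to a closed box inside \<open>\<Omega>\<close>, an arbitrary
    box may be tested: its intersection with the open box is again a box, and it lies in that closed
    box.\<close>
  have local: "AE x in lborel. indicator (box c d) x * g x = 0" if cd: "cbox c d \<subseteq> \<Omega>" for c d
  proof (rule AE_zero_if_integral_boxes_zero)
    show "integrable lborel (\<lambda>x. indicator (box c d) x * g x)"
      using integrable_mult_indicator[OF _ gi, of "box c d"] by simp
    fix a b
    obtain p q where pq: "box a b \<inter> box c d = box p q" using box_Int_box by blast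
    then have sub: "box p q \<subseteq> cbox c d" using box_subset_cbox by fastforce
    have "integral\<^sup>L lborel (\<lambda>x. indicator (box a b) x * (indicator (box c d) x * g x)) =
          integral\<^sup>L lborel (\<lambda>x. indicator (box p q) x * g x)"
      by (simp flip: pq add: indicator_inter_arith mult.assoc)
    also have "\<dots> = integral\<^sup>L lebesgue (\<lambda>x. indicator (box p q) x * g x)"
      by (intro integral_completion[symmetric]) measurable
    also have "\<dots> = integral\<^sup>L lebesgue (\<lambda>x. indicator (box p q) x * (indicator \<Omega> x * f x))"
    proof (rule integral_cong_AE)
      have [measurable]: "(\<lambda>x. indicator \<Omega> x * f x) \<in> borel_measurable lebesgue"
        "box p q \<in> sets lebesgue"
        using f\<Omega> by auto
      show "(\<lambda>x. indicator (box p q) x * g x) \<in> borel_measurable lebesgue"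
        using gm by measurable
      show "(\<lambda>x. indicator (box p q) x * (indicator \<Omega> x * f x)) \<in> borel_measurable lebesgue"
        by measurable
    qed (use ae in \<open>auto elim!: eventually_mono\<close>)
    also have "\<dots> = 0" by (rule box0[OF sub cd])
    finally show "integral\<^sup>L lborel (\<lambda>x. indicator (box a b) x * (indicator (box c d) x * g x)) = 0" .
  qed
  obtain \<D> where D: "countable \<D>" "\<D> \<subseteq> Pow \<Omega>" "\<And>X. X \<in> \<D> \<Longrightarrow> \<exists>a b. X = cbox a b" "\<Union>\<D> = \<Omega>"
    using open_countable_Union_open_cbox[OF assms(1)] by blast
  have "AE x in lebesgue. \<forall>X\<in>\<D>. x \<in> X \<longrightarrow> g x = 0"
  proof (subst AE_ball_countable[OF D(1)], intro ballI)
    fix X assume "X \<in> \<D>"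
    then obtain c d where X: "X = cbox c d" "cbox c d \<subseteq> \<Omega>" using D by blast
    \<comment> \<open>\<open>\<D>\<close> consists of closed boxes while \<open>local\<close> speaks
      of open ones; the faces are null.\<close>
    have "cbox c d - box c d \<in> null_sets lebesgue"
      using negligible_frontier_interval by (simp add: negligible_iff_null_sets)
    then have "AE x in lebesgue. x \<notin> cbox c d - box c d" by (rule AE_not_in)
    with AE_completion[OF local[OF X(2)]] show "AE x in lebesgue. x \<in> X \<longrightarrow> g x = 0"
      by eventually_elim (auto simp: X(1) indicator_def split: if_splits)
  qed
  with ae have "AE x in lebesgue. x \<in> \<Omega> \<longrightarrow> f x = 0"
    by eventually_elim (use D(4) in \<open>fastforce simp: indicator_def\<close>)
  then show ?thesis using \<Omega> by (simp add: AE_restrict_space_iff)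
qed

section \<open>Weak derivatives\<close>

lemma continuous_measurable_lebesgue_on:
  fixes f :: "'a::euclidean_space \<Rightarrow> 'b::euclidean_space"
  assumes "continuous_on UNIV f"
  shows "f \<in> borel_measurable (lebesgue_on \<Omega>)"
proof -
  have "f \<in> borel_measurable lebesgue"
    by (rule measurable_completion) (simp add: borel_measurable_continuous_onI[OF assms])
  then show ?thesis by (rule measurable_restrict_space1)
qed

lemma finite_measure_lebesgue_on:
  assumes "open \<Omega>" "bounded \<Omega>"
  shows "finite_measure (lebesgue_on \<Omega>)"
proof
  have "emeasure lebesgue \<Omega> < \<infinity>"
    using emeasure_bounded_finite[OF assms(2)] assms(1) by simp
  then show "emeasure (lebesgue_on \<Omega>) (space (lebesgue_on \<Omega>)) \<noteq> \<infinity>"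
    using assms(1) by (simp add: emeasure_restrict_space space_restrict_space)
qed

lemma L2_integrable_real:
  fixes f :: "'a::euclidean_space \<Rightarrow> real"
  assumes "open \<Omega>" "bounded \<Omega>" "L2 \<Omega> f"
  shows "integrable (lebesgue_on \<Omega>) f"
proof -
  interpret finite_measure "lebesgue_on \<Omega>" by (rule finite_measure_lebesgue_on[OF assms(1,2)])
  have "f \<in> borel_measurable (lebesgue_on \<Omega>)" "integrable (lebesgue_on \<Omega>) (\<lambda>x. (f x)\<^sup>2)"
    using assms(3) by (simp_all add: L2_def)
  then show ?thesis by (rule square_integrable_imp_integrable)
qed

lemma bounded_L2:
  fixes f :: "'a::euclidean_space \<Rightarrow> 'b::euclidean_space"
  assumes "open \<Omega>" "bounded \<Omega>" "f \<in> borel_measurable (lebesgue_on \<Omega>)"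
    and B: "\<And>x. x \<in> \<Omega> \<Longrightarrow> norm (f x) \<le> B"
  shows "L2 \<Omega> f"
  unfolding L2_def
proof
  interpret finite_measure "lebesgue_on \<Omega>" by (rule finite_measure_lebesgue_on[OF assms(1,2)])
  show "integrable (lebesgue_on \<Omega>) (\<lambda>x. (norm (f x))\<^sup>2)"
  proof (rule integrable_const_bound[where B="B\<^sup>2"])
    show "AE x in lebesgue_on \<Omega>. norm ((norm (f x))\<^sup>2) \<le> B\<^sup>2"
      using B by (intro AE_I2) (auto simp: space_restrict_space intro!: power_mono)
  qed (use assms(3) in measurable)
qed (fact assms(3))

lemma continuous_bounded_on_bounded:
  fixes f :: "'a::euclidean_space \<Rightarrow> 'b::euclidean_space"
  assumes "bounded \<Omega>" "continuous_on UNIV f"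
  obtains B where "\<And>x. x \<in> \<Omega> \<Longrightarrow> norm (f x) \<le> B"
proof -
  have "compact (f ` closure \<Omega>)"
    using assms by (intro compact_continuous_image) (auto intro: continuous_on_subset)
  then have "bounded (f ` closure \<Omega>)" by (rule compact_imp_bounded)
  then obtain B where "\<And>x. x \<in> closure \<Omega> \<Longrightarrow> norm (f x) \<le> B"
    by (auto simp: bounded_iff)
  then show ?thesis using closure_subset[of \<Omega>] that by blast
qed

lemma continuous_L2:
  fixes f :: "'a::euclidean_space \<Rightarrow> 'b::euclidean_space"
  assumes "open \<Omega>" "bounded \<Omega>" "continuous_on UNIV f"
  shows "L2 \<Omega> f"
proof -
  obtain B where "\<And>x. x \<in> \<Omega> \<Longrightarrow> norm (f x) \<le> B"
    using continuous_bounded_on_bounded[OF assms(2,3)] by blast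
  then show ?thesis
    by (rule bounded_L2[OF assms(1,2) continuous_measurable_lebesgue_on[OF assms(3)]])
qed

lemma test_function_smooth: "test_function \<Omega> \<phi> \<Longrightarrow> smooth \<phi>"
  by (simp add: test_function_def)

lemma smooth_L2: "open \<Omega> \<Longrightarrow> bounded \<Omega> \<Longrightarrow> smooth \<phi> \<Longrightarrow> L2 \<Omega> \<phi>"
  by (intro continuous_L2 smooth_continuous)

lemma L2_mult_integrable:
  fixes f g :: "'a::euclidean_space \<Rightarrow> real"
  shows "L2 \<Omega> f \<Longrightarrow> L2 \<Omega> g \<Longrightarrow> integrable (lebesgue_on \<Omega>) (\<lambda>x. f x * g x)"
  using L2_inner_integrable[of \<Omega> f g] by simp

lemma AE_eq_if_test_integrals_eq:
  fixes f g :: "real^'d::finite \<Rightarrow> real"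
  assumes "open \<Omega>" "bounded \<Omega>" "L2 \<Omega> f" "L2 \<Omega> g"
    and eq: "\<And>\<phi>. test_function \<Omega> \<phi> \<Longrightarrow>
      integral\<^sup>L (lebesgue_on \<Omega>) (\<lambda>x. f x * \<phi> x) = integral\<^sup>L (lebesgue_on \<Omega>) (\<lambda>x. g x * \<phi> x)"
  shows "AE x in lebesgue_on \<Omega>. f x = g x"
proof -
  have "AE x in lebesgue_on \<Omega>. f x - g x = 0"
  proof (rule fundamental_lemma_variations[OF assms(1)])
    show "integrable (lebesgue_on \<Omega>) (\<lambda>x. f x - g x)"
      using assms by (intro L2_integrable_real L2_diff)
    fix \<phi> assume t: "test_function \<Omega> \<phi>"
    then have "L2 \<Omega> \<phi>" using assms by (intro smooth_L2 test_function_smooth)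
    then show "integral\<^sup>L (lebesgue_on \<Omega>) (\<lambda>x. (f x - g x) * \<phi> x) = 0"
      using eq[OF t] assms by (simp add: left_diff_distrib L2_mult_integrable)
  qed
  then show ?thesis by simp
qed

section \<open>Uniqueness and linearity of weak derivatives\<close>

lemma weak_grad_unique:
  fixes G G' :: "real^'d::finite \<Rightarrow> real^'d^'d"
  assumes "open \<Omega>" "bounded \<Omega>" "L2 \<Omega> G" "L2 \<Omega> G'" "is_weak_grad \<Omega> v G" "is_weak_grad \<Omega> v G'"
  shows "AE x in lebesgue_on \<Omega>. G x = G' x"
proof -
  have "AE x in lebesgue_on \<Omega>. G x $ i $ j = G' x $ i $ j" for i j
  proof (rule AE_eq_if_test_integrals_eq[OF assms(1,2)])
    fix \<phi> assume "test_function \<Omega> \<phi>"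
    then show "integral\<^sup>L (lebesgue_on \<Omega>) (\<lambda>x. G x $ i $ j * \<phi> x) = integral\<^sup>L (lebesgue_on \<Omega>) (\<lambda>x. G' x $ i $ j * \<phi> x)"
      using assms(5,6)[unfolded is_weak_grad_def, rule_format, of \<phi> i j] by linarith
  qed (intro L2_component assms)+
  then have "AE x in lebesgue_on \<Omega>. \<forall>i j. G x $ i $ j = G' x $ i $ j"
    by (simp add: AE_all_countable)
  then show ?thesis by eventually_elim (simp add: vec_eq_iff)
qed

lemma weak_div_unique:
  fixes w w' :: "real^'d::finite \<Rightarrow> real^'d"
  assumes "open \<Omega>" "bounded \<Omega>" "L2 \<Omega> w" "L2 \<Omega> w'" "is_weak_div \<Omega> \<tau> w" "is_weak_div \<Omega> \<tau> w'"
  shows "AE x in lebesgue_on \<Omega>. w x = w' x"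
proof -
  have "AE x in lebesgue_on \<Omega>. w x $ i = w' x $ i" for i
  proof (rule AE_eq_if_test_integrals_eq[OF assms(1,2)])
    fix \<phi> assume "test_function \<Omega> \<phi>"
    then show "integral\<^sup>L (lebesgue_on \<Omega>) (\<lambda>x. w x $ i * \<phi> x) = integral\<^sup>L (lebesgue_on \<Omega>) (\<lambda>x. w' x $ i * \<phi> x)"
      using assms(5,6)[unfolded is_weak_div_def, rule_format, of \<phi> i] by linarith
  qed (intro L2_component assms)+
  then have "AE x in lebesgue_on \<Omega>. \<forall>i. w x $ i = w' x $ i"
    by (simp add: AE_all_countable)
  then show ?thesis by eventually_elim (simp add: vec_eq_iff)
qed

lemma weak_grad_add_scaleR:
  fixes v w :: "real^'d::finite \<Rightarrow> real^'d"
  assumes "open \<Omega>" "bounded \<Omega>" "L2 \<Omega> v" "L2 \<Omega> w" "L2 \<Omega> G" "L2 \<Omega> H"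
    "is_weak_grad \<Omega> v G" "is_weak_grad \<Omega> w H"
  shows "is_weak_grad \<Omega> (\<lambda>x. v x + c *\<^sub>R w x) (\<lambda>x. G x + c *\<^sub>R H x)"
  unfolding is_weak_grad_def
proof (intro allI impI)
  fix \<phi> :: "real^'d \<Rightarrow> real" and i j assume t: "test_function \<Omega> \<phi>"
  then have \<phi>: "L2 \<Omega> \<phi>" "L2 \<Omega> (partial_deriv j \<phi>)"
    using smooth_L2[OF assms(1,2)] smooth_partial_deriv test_function_smooth by blast+
  show "integral\<^sup>L (lebesgue_on \<Omega>) (\<lambda>x. (v x + c *\<^sub>R w x) $ i * partial_deriv j \<phi> x) =
        - integral\<^sup>L (lebesgue_on \<Omega>) (\<lambda>x. (G x + c *\<^sub>R H x) $ i $ j * \<phi> x)"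
    using assms t \<phi> unfolding is_weak_grad_def
    by (simp add: distrib_right mult.assoc L2_mult_integrable L2_component)
qed

lemma weak_div_add_scaleR:
  fixes \<tau> \<sigma> :: "real^'d::finite \<Rightarrow> real^'d^'d"
  assumes "open \<Omega>" "bounded \<Omega>" "L2 \<Omega> \<tau>" "L2 \<Omega> \<sigma>" "L2 \<Omega> w" "L2 \<Omega> z"
    "is_weak_div \<Omega> \<tau> w" "is_weak_div \<Omega> \<sigma> z"
  shows "is_weak_div \<Omega> (\<lambda>x. \<tau> x + c *\<^sub>R \<sigma> x) (\<lambda>x. w x + c *\<^sub>R z x)"
  unfolding is_weak_div_def
proof (intro allI impI)
  fix \<phi> :: "real^'d \<Rightarrow> real" and i assume t: "test_function \<Omega> \<phi>"
  then have \<phi>: "L2 \<Omega> \<phi>" "\<And>j. L2 \<Omega> (partial_deriv j \<phi>)"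
    using smooth_L2[OF assms(1,2)] smooth_partial_deriv test_function_smooth by blast+
  have int: "integrable (lebesgue_on \<Omega>) (\<lambda>x. \<Sum>j\<in>UNIV. \<tau> x $ i $ j * partial_deriv j \<phi> x)"
    if "L2 \<Omega> \<tau>" for \<tau> :: "real^'d \<Rightarrow> real^'d^'d"
    using that \<phi> by (intro Bochner_Integration.integrable_sum L2_mult_integrable L2_component)
  have "(\<Sum>j\<in>UNIV. (\<tau> x + c *\<^sub>R \<sigma> x) $ i $ j * partial_deriv j \<phi> x) =
      (\<Sum>j\<in>UNIV. \<tau> x $ i $ j * partial_deriv j \<phi> x) + c * (\<Sum>j\<in>UNIV. \<sigma> x $ i $ j * partial_deriv j \<phi> x)" for x
    by (simp add: distrib_right sum.distrib sum_distrib_left mult.assoc)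
  then show "integral\<^sup>L (lebesgue_on \<Omega>) (\<lambda>x. \<Sum>j\<in>UNIV. (\<tau> x + c *\<^sub>R \<sigma> x) $ i $ j * partial_deriv j \<phi> x) =
        - integral\<^sup>L (lebesgue_on \<Omega>) (\<lambda>x. (w x + c *\<^sub>R z x) $ i * \<phi> x)"
    using int[OF assms(3)] int[OF assms(4)] assms(5,6) \<phi> assms(7,8)[unfolded is_weak_div_def, rule_format, OF t, of i]
    by (simp add: distrib_right mult.assoc L2_mult_integrable L2_component del: Bochner_Integration.integral_sum)
qed

lemma grad_props:
  assumes "H1 \<Omega> v"
  shows "L2 \<Omega> (grad \<Omega> v)" "is_weak_grad \<Omega> v (grad \<Omega> v)"
  using someI_ex[of "\<lambda>G. L2 \<Omega> G \<and> is_weak_grad \<Omega> v G"] assms by (auto simp: grad_def H1_def)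

lemma mat_div_props:
  assumes "Hdiv \<Omega> \<tau>"
  shows "L2 \<Omega> (mat_div \<Omega> \<tau>)" "is_weak_div \<Omega> \<tau> (mat_div \<Omega> \<tau>)"
  using someI_ex[of "\<lambda>w. L2 \<Omega> w \<and> is_weak_div \<Omega> \<tau> w"] assms by (auto simp: mat_div_def Hdiv_def)

text \<open>The link between the representative chosen by \<open>grad\<close> and a gradient
  computed by hand; equality almost everywhere is all that the choice allows.\<close>

lemma grad_eq_AE:
  assumes "open \<Omega>" "bounded \<Omega>" "L2 \<Omega> v" "L2 \<Omega> G" "is_weak_grad \<Omega> v G"
  shows "AE x in lebesgue_on \<Omega>. grad \<Omega> v x = G x"
proof -
  have "H1 \<Omega> v" using assms by (auto simp: H1_def)
  then show ?thesis using assms grad_props by (intro weak_grad_unique)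
qed

lemma mat_div_eq_AE:
  assumes "open \<Omega>" "bounded \<Omega>" "L2 \<Omega> \<tau>" "L2 \<Omega> w" "is_weak_div \<Omega> \<tau> w"
  shows "AE x in lebesgue_on \<Omega>. mat_div \<Omega> \<tau> x = w x"
proof -
  have "Hdiv \<Omega> \<tau>" using assms by (auto simp: Hdiv_def)
  then show ?thesis using assms mat_div_props by (intro weak_div_unique)
qed

lemma H1_L2: "H1 \<Omega> v \<Longrightarrow> L2 \<Omega> v"
  by (simp add: H1_def)

lemma H1_add_scaleR:
  assumes "open \<Omega>" "bounded \<Omega>" "H1 \<Omega> v" "H1 \<Omega> w"
  shows "H1 \<Omega> (\<lambda>x. v x + c *\<^sub>R w x)"
    and "AE x in lebesgue_on \<Omega>. grad \<Omega> (\<lambda>x. v x + c *\<^sub>R w x) x = grad \<Omega> v x + c *\<^sub>R grad \<Omega> w x"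
proof -
  have *: "is_weak_grad \<Omega> (\<lambda>x. v x + c *\<^sub>R w x) (\<lambda>x. grad \<Omega> v x + c *\<^sub>R grad \<Omega> w x)"
    using assms by (intro weak_grad_add_scaleR grad_props H1_L2)
  have L: "L2 \<Omega> (\<lambda>x. grad \<Omega> v x + c *\<^sub>R grad \<Omega> w x)" "L2 \<Omega> (\<lambda>x. v x + c *\<^sub>R w x)"
    by (rule L2_add[OF grad_props(1)[OF assms(3)] L2_scaleR[OF grad_props(1)[OF assms(4)]]],
        rule L2_add[OF H1_L2[OF assms(3)] L2_scaleR[OF H1_L2[OF assms(4)]]])
  show "H1 \<Omega> (\<lambda>x. v x + c *\<^sub>R w x)" using * L by (auto simp: H1_def)
  show "AE x in lebesgue_on \<Omega>. grad \<Omega> (\<lambda>x. v x + c *\<^sub>R w x) x = grad \<Omega> v x + c *\<^sub>R grad \<Omega> w x"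
    by (rule grad_eq_AE[OF assms(1,2) L(2,1) *])
qed

section \<open>Integration by parts for smooth fields\<close>

lemma test_function_mult:
  assumes "smooth \<psi>" "test_function \<Omega> \<phi>"
  shows "test_function \<Omega> (\<lambda>x. \<psi> x * \<phi> x)"
proof -
  have sub: "closure {x. \<psi> x * \<phi> x \<noteq> 0} \<subseteq> closure {x. \<phi> x \<noteq> 0}"
    by (rule closure_mono) auto
  then have "compact (closure {x. \<psi> x * \<phi> x \<noteq> 0})"
    using assms(2) compact_Int_closed[of "closure {x. \<phi> x \<noteq> 0}" "closure {x. \<psi> x * \<phi> x \<noteq> 0}"]
    by (simp add: test_function_def inf.absorb2)
  then show ?thesis
    using assms sub by (auto simp: test_function_def intro: smooth_mult)
qed

lemma partial_deriv_zero_outside_support: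
  assumes "x \<notin> closure {x. \<phi> x \<noteq> 0}"
  shows "partial_deriv j \<phi> x = 0"
proof -
  have "((\<lambda>x. 0) has_derivative (\<lambda>z. 0)) (at x)" by simp
  then have "(\<phi> has_derivative (\<lambda>z. 0)) (at x)"
  proof (rule has_derivative_transform_within_open)
    show "open (- closure {x. \<phi> x \<noteq> 0})" by (rule open_Compl) simp
    show "x \<in> - closure {x. \<phi> x \<noteq> 0}" using assms by simp
    show "\<And>y. y \<in> - closure {x. \<phi> x \<noteq> 0} \<Longrightarrow> 0 = \<phi> y"
      using closure_subset[of "{x. \<phi> x \<noteq> 0}"] by auto
  qed
  then show ?thesis by (rule partial_deriv_eq)
qed

lemma smooth_directional_derivative:
  assumes "smooth \<phi>"
  shows "((\<lambda>s. \<phi> (x + s *\<^sub>R axis j 1)) has_real_derivative partial_deriv j \<phi> (x + s *\<^sub>R axis j 1)) (at s)"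
proof -
  have "((\<lambda>s. x + s *\<^sub>R axis j 1) has_derivative (\<lambda>s. s *\<^sub>R axis j 1)) (at s)"
    by (auto intro!: derivative_eq_intros)
  from has_derivative_compose[OF this smooth_has_derivative[OF assms]]
  show ?thesis
    by (simp add: has_field_derivative_def axis_def if_distrib mult_commute_abs cong: if_cong)
qed

lemma integral_translation_lborel:
  fixes f :: "'a::euclidean_space \<Rightarrow> real"
  assumes "f \<in> borel_measurable borel"
  shows "integral\<^sup>L lborel (\<lambda>x. f (x + a)) = integral\<^sup>L lborel f"
proof -
  have "integral\<^sup>L lborel f = integral\<^sup>L (distr lborel borel ((+) a)) f"
    by (simp add: lborel_distr_plus)
  also have "\<dots> = integral\<^sup>L lborel (\<lambda>x. f (a + x))"
    using assms by (intro integral_distr) auto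
  finally show ?thesis by (simp add: add.commute)
qed

lemma compact_support_integrable:
  fixes h :: "'a::euclidean_space \<Rightarrow> real"
  assumes "continuous_on UNIV h" "compact K" "\<And>x. x \<notin> K \<Longrightarrow> h x = 0"
  shows "integrable lborel h"
proof -
  have "integrable lborel (\<lambda>x. indicator K x *\<^sub>R h x)"
    using assms by (intro borel_integrable_compact) (auto intro: continuous_on_subset)
  moreover have "(\<lambda>x. indicator K x *\<^sub>R h x) = h"
    using assms(3) by (auto simp: indicator_def fun_eq_iff)
  ultimately show ?thesis by simp
qed

text \<open>Difference quotients integrate to zero because Lebesgue measure is translation
  invariant, and dominated convergence passes to the derivative; iterated integrals are
  avoided.\<close>

lemma integral_partial_deriv_zero:
  fixes h :: "real^'d::finite \<Rightarrow> real"
  assumes h: "test_function \<Omega> h"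
  shows "integral\<^sup>L lborel (partial_deriv j h) = 0"
proof -
  let ?S = "closure {x. h x \<noteq> 0}" and ?e = "axis j 1 :: real^'d"
  have sm: "smooth h" and K: "compact ?S" using h by (auto simp: test_function_def)
  have ch: "continuous_on UNIV h" and cp: "continuous_on UNIV (partial_deriv j h)"
    by (intro smooth_continuous smooth_partial_deriv sm)+
  have h0: "h x = 0" if "x \<notin> ?S" for x using that closure_subset[of "{x. h x \<noteq> 0}"] by auto
  have p0: "partial_deriv j h x = 0" if "x \<notin> ?S" for x
    using that by (rule partial_deriv_zero_outside_support)
  have "compact (closure {x. partial_deriv j h x \<noteq> 0})"
  proof -
    have "closure {x. partial_deriv j h x \<noteq> 0} \<subseteq> ?S"
      by (rule closure_minimal) (use p0 in auto)
    then show ?thesis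
      using compact_Int_closed[OF K, of "closure {x. partial_deriv j h x \<noteq> 0}"]
      by (simp add: inf.absorb2)
  qed
  then obtain B where B: "\<And>x. \<bar>partial_deriv j h x\<bar> \<le> B"
    using bounded_if_compact_support[OF cp] by metis
  obtain R where R: "?S \<subseteq> cball 0 R"
    using compact_imp_bounded[OF K] by (auto simp: bounded_iff subset_iff)
  define q where "q n x = real (Suc n) * (h (x + (1 / real (Suc n)) *\<^sub>R ?e) - h x)" for n x
  \<comment> \<open>One mean value point serves twice: it gives the pointwise limit, as
    \<open>s\<close> shrinks with \<open>n\<close>, and it bounds the quotient by
    \<open>B\<close>.\<close>
  have mvt: "\<exists>s. 0 < s \<and> s < 1 / real (Suc n) \<and> q n x = partial_deriv j h (x + s *\<^sub>R ?e)" for n x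
  proof -
    have "\<exists>z>0. z < 1 / real (Suc n) \<and>
        h (x + (1 / real (Suc n)) *\<^sub>R ?e) - h (x + 0 *\<^sub>R ?e) =
        (1 / real (Suc n) - 0) * partial_deriv j h (x + z *\<^sub>R ?e)"
      by (rule MVT2) (use smooth_directional_derivative[OF sm] in auto)
    then show ?thesis by (auto simp: q_def field_simps)
  qed
  have hi: "integrable lborel h" by (rule compact_support_integrable[OF ch K h0])
  have hb: "h \<in> borel_measurable borel" using ch by (rule borel_measurable_continuous_onI)
  have hbt: "(\<lambda>x. h (x + a)) \<in> borel_measurable borel" for a
    using hb by measurable
  have hit: "integrable lborel (\<lambda>x. h (x + a))" for a
  proof (rule compact_support_integrable)
    show "continuous_on UNIV (\<lambda>x. h (x + a))"
      by (intro continuous_on_compose2[OF ch] continuous_intros) auto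
    show "compact ((\<lambda>x. - a + x) ` ?S)" using K by (rule compact_translation)
    show "h (x + a) = 0" if "x \<notin> (\<lambda>x. - a + x) ` ?S" for x
      using that by (intro h0) (force simp: image_iff)
  qed
  have q0: "integral\<^sup>L lborel (q n) = 0" for n
    unfolding q_def using hi hit by (simp add: integral_translation_lborel[OF hb])
  have "(\<lambda>n. integral\<^sup>L lborel (q n)) \<longlonglongrightarrow> integral\<^sup>L lborel (partial_deriv j h)"
  proof (rule integral_dominated_convergence[where w="\<lambda>x. B * indicator (cball 0 (R + 1)) x"])
    show "partial_deriv j h \<in> borel_measurable lborel"
      using borel_measurable_continuous_onI[OF cp] by simp
    show "q n \<in> borel_measurable lborel" for n
      unfolding q_def[abs_def] using hb by measurable
    show "integrable lborel (\<lambda>x. B * indicator (cball 0 (R + 1)) x :: real)"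
      using emeasure_lborel_cball_finite[of 0 "R+1"]
      by (intro integrable_mult_right integrable_real_indicator) auto
    show "AE x in lborel. (\<lambda>n. q n x) \<longlonglongrightarrow> partial_deriv j h x"
    proof (rule AE_I2)
      fix x
      obtain s where s: "\<And>n. 0 < s n" "\<And>n. s n < 1 / real (Suc n)"
        "\<And>n. q n x = partial_deriv j h (x + s n *\<^sub>R ?e)"
        using mvt[of _ x] by metis
      have "s \<longlonglongrightarrow> 0"
        by (rule tendsto_sandwich[OF _ _ tendsto_const LIMSEQ_inverse_real_of_nat])
          (use s in \<open>auto intro!: always_eventually less_imp_le simp: inverse_eq_divide\<close>)
      then have "(\<lambda>n. x + s n *\<^sub>R ?e) \<longlonglongrightarrow> x + 0 *\<^sub>R ?e" by (intro tendsto_intros)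
      then have "(\<lambda>n. partial_deriv j h (x + s n *\<^sub>R ?e)) \<longlonglongrightarrow> partial_deriv j h x"
        using cp by (intro continuous_on_tendsto_compose[OF cp]) auto
      then show "(\<lambda>n. q n x) \<longlonglongrightarrow> partial_deriv j h x" by (simp add: s(3))
    qed
    \<comment> \<open>Steps have length at most 1, so the quotient vanishes outside the support
      enlarged by 1.\<close>
    show "AE x in lborel. norm (q n x) \<le> B * indicator (cball 0 (R + 1)) x" for n
    proof (rule AE_I2)
      fix x
      obtain s where s: "0 < s" "s < 1 / real (Suc n)" "q n x = partial_deriv j h (x + s *\<^sub>R ?e)"
        using mvt by blast
      show "norm (q n x) \<le> B * indicator (cball 0 (R + 1)) x"
      proof (cases "x \<in> cball 0 (R + 1)")
        case True
        then show ?thesis using B s(3) by simp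
      next
        case False
        have "1 / real (Suc n) \<le> 1" by simp
        then have "s \<le> 1" using s(2) by linarith
        moreover have "norm x \<le> norm (x + s *\<^sub>R ?e) + norm (s *\<^sub>R ?e)"
          using norm_triangle_ineq4[of "x + s *\<^sub>R ?e" "s *\<^sub>R ?e"] by simp
        ultimately have "x + s *\<^sub>R ?e \<notin> ?S" using R s(1) False by (auto simp: subset_iff)
        then show ?thesis using p0 s(3) False by simp
      qed
    qed
  qed
  then show ?thesis using q0 by (simp add: LIMSEQ_const_iff)
qed

lemma integral_lebesgue_on_supported:
  fixes f :: "'a::euclidean_space \<Rightarrow> real"
  assumes "open \<Omega>" "f \<in> borel_measurable borel" "\<And>x. x \<notin> \<Omega> \<Longrightarrow> f x = 0"
  shows "integral\<^sup>L (lebesgue_on \<Omega>) f = integral\<^sup>L lborel f"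
proof -
  have "(\<lambda>x. indicator \<Omega> x * f x) = f"
    using assms(3) by (auto simp: indicator_def fun_eq_iff)
  then show ?thesis
    using assms by (simp add: integral_lebesgue_on_indicator integral_completion)
qed

text \<open>The product with a test function is again a test function, so its derivative integrates
  to zero; the product rule does the rest.\<close>

lemma smooth_integration_by_parts:
  fixes \<psi> \<phi> :: "real^'d::finite \<Rightarrow> real"
  assumes "open \<Omega>" "bounded \<Omega>" "smooth \<psi>" "test_function \<Omega> \<phi>"
  shows "integral\<^sup>L (lebesgue_on \<Omega>) (\<lambda>x. \<psi> x * partial_deriv j \<phi> x) =
    - integral\<^sup>L (lebesgue_on \<Omega>) (\<lambda>x. partial_deriv j \<psi> x * \<phi> x)"
proof -
  let ?h = "\<lambda>x. \<psi> x * \<phi> x"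
  have t: "test_function \<Omega> ?h" using assms by (intro test_function_mult)
  have sm: "smooth \<phi>" using assms by (auto dest: test_function_smooth)
  have pd: "partial_deriv j ?h = (\<lambda>x. \<psi> x * partial_deriv j \<phi> x + partial_deriv j \<psi> x * \<phi> x)"
    using assms(3) sm by (intro partial_deriv_mult smooth_differentiable)
  have "integral\<^sup>L (lebesgue_on \<Omega>) (partial_deriv j ?h) = integral\<^sup>L lborel (partial_deriv j ?h)"
  proof (rule integral_lebesgue_on_supported[OF assms(1)])
    show "partial_deriv j ?h \<in> borel_measurable borel"
      by (intro borel_measurable_continuous_onI smooth_continuous smooth_partial_deriv
          test_function_smooth[OF t])
    show "partial_deriv j ?h x = 0" if "x \<notin> \<Omega>" for x
      using that t by (intro partial_deriv_zero_outside_support) (auto simp: test_function_def)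
  qed
  also have "\<dots> = 0" by (rule integral_partial_deriv_zero[OF t])
  finally show ?thesis
    using assms(1,2,3) sm unfolding pd
    by (simp add: L2_mult_integrable smooth_L2 smooth_partial_deriv)
qed

definition smooth_field :: "(real^'d::finite \<Rightarrow> real^'d) \<Rightarrow> bool" where
  "smooth_field \<phi> \<longleftrightarrow> (\<forall>i. smooth (\<lambda>x. \<phi> x $ i))"

definition jacobian_matrix :: "(real^'d::finite \<Rightarrow> real^'d) \<Rightarrow> real^'d \<Rightarrow> real^'d^'d" where
  "jacobian_matrix \<phi> x = (\<chi> i j. partial_deriv j (\<lambda>x. \<phi> x $ i) x)"

lemma smooth_field_continuous: "smooth_field \<phi> \<Longrightarrow> continuous_on UNIV \<phi>"
  using continuous_on_vec_lambda[of UNIV "\<lambda>i x. \<phi> x $ i"]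
  by (simp add: smooth_field_def smooth_continuous)

lemma jacobian_matrix_continuous: "smooth_field \<phi> \<Longrightarrow> continuous_on UNIV (jacobian_matrix \<phi>)"
  unfolding jacobian_matrix_def[abs_def] smooth_field_def
  by (intro continuous_on_vec_lambda smooth_continuous smooth_partial_deriv) auto

lemma smooth_field_weak_grad:
  assumes "open \<Omega>" "bounded \<Omega>" "smooth_field \<phi>"
  shows "is_weak_grad \<Omega> \<phi> (jacobian_matrix \<phi>)"
  using assms unfolding is_weak_grad_def smooth_field_def jacobian_matrix_def
  by (simp add: smooth_integration_by_parts)

lemma smooth_field_H1:
  assumes "open \<Omega>" "bounded \<Omega>" "smooth_field \<phi>"
  shows "H1 \<Omega> \<phi>" and "L2 \<Omega> \<phi>" and "L2 \<Omega> (jacobian_matrix \<phi>)"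
    and "AE x in lebesgue_on \<Omega>. grad \<Omega> \<phi> x = jacobian_matrix \<phi> x"
proof -
  show L: "L2 \<Omega> \<phi>" "L2 \<Omega> (jacobian_matrix \<phi>)"
    using assms by (auto intro!: continuous_L2 smooth_field_continuous jacobian_matrix_continuous)
  show "H1 \<Omega> \<phi>" using smooth_field_weak_grad[OF assms] L by (auto simp: H1_def)
  show "AE x in lebesgue_on \<Omega>. grad \<Omega> \<phi> x = jacobian_matrix \<phi> x"
    by (rule grad_eq_AE[OF assms(1,2) L smooth_field_weak_grad[OF assms]])
qed

section \<open>The Poincare inequality\<close>

text \<open>All that the Poincare estimate uses of a field: \<open>K\<close> is any continuous
  pointwise bound for the operator norm of the derivative. It will be the Frobenius norm of the
  Jacobian.\<close>

definition C1_bound :: "('a::euclidean_space \<Rightarrow> 'b::euclidean_space) \<Rightarrow> ('a \<Rightarrow> real) \<Rightarrow> bool" where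
  "C1_bound f K \<longleftrightarrow> continuous_on UNIV K \<and>
     (\<forall>x. \<exists>D. (f has_derivative D) (at x) \<and> (\<forall>z. norm (D z) \<le> K x * norm z))"

lemma C1_bound_nonneg:
  fixes f :: "'a::euclidean_space \<Rightarrow> 'b::euclidean_space"
  assumes "C1_bound f K"
  shows "0 \<le> K x"
proof -
  obtain D where D: "\<And>z. norm (D z :: 'b) \<le> K x * norm (z :: 'a)"
    using assms unfolding C1_bound_def by meson
  obtain b :: 'a where "b \<in> Basis" by (meson ex_in_conv nonempty_Basis)
  then show ?thesis using order_trans[OF norm_ge_zero D[of b]] by simp
qed

lemma C1_bound_continuous: "C1_bound f K \<Longrightarrow> continuous_on UNIV f"
  unfolding C1_bound_def
  by (meson continuous_at_imp_continuous_on has_derivative_continuous)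

lemma C1_bound_measurable:
  assumes "C1_bound f K"
  shows "f \<in> borel_measurable borel" "K \<in> borel_measurable borel"
  using assms C1_bound_continuous[OF assms]
  by (auto simp: C1_bound_def intro: borel_measurable_continuous_onI)

text \<open>Fundamental theorem of calculus along the segment, then Cauchy-Schwarz in
  \<open>t\<close>; the resulting length factor is at most 1 and is dropped.\<close>

lemma C1_bound_segment:
  fixes f :: "'a::euclidean_space \<Rightarrow> 'b::euclidean_space"
  assumes fK: "C1_bound f K" and l: "0 \<le> l" "l \<le> 1"
  shows "ennreal ((norm (f (a + l *\<^sub>R z) - f a))\<^sup>2) \<le>
    ennreal ((norm z)\<^sup>2) * (\<integral>\<^sup>+t. ennreal ((K (a + t *\<^sub>R z))\<^sup>2) * indicator {0..l} t \<partial>lborel)"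
proof -
  obtain D where D: "\<And>x. (f has_derivative D x) (at x)" and DK: "\<And>x w. norm (D x w) \<le> K x * norm w"
    using fK unfolding C1_bound_def by metis
  have cK: "continuous_on UNIV K" using fK by (simp add: C1_bound_def)
  let ?k = "\<lambda>t. K (a + t *\<^sub>R z)"
  have ck: "continuous_on UNIV ?k"
    by (intro continuous_on_compose2[OF cK] continuous_intros) auto
  have [measurable]: "?k \<in> borel_measurable borel" using ck by (rule borel_measurable_continuous_onI)
  have k0: "0 \<le> ?k t" for t by (rule C1_bound_nonneg[OF fK])
  have dv: "((\<lambda>t. f (a + t *\<^sub>R z)) has_vector_derivative D (a + t *\<^sub>R z) z) (at t within {0..l})" for t
  proof -
    have "((\<lambda>t. a + t *\<^sub>R z) has_derivative (\<lambda>t. t *\<^sub>R z)) (at t)"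
      by (auto intro!: derivative_eq_intros)
    from has_derivative_compose[OF this D]
    have "((\<lambda>t. f (a + t *\<^sub>R z)) has_derivative (\<lambda>s. D (a + t *\<^sub>R z) (s *\<^sub>R z))) (at t)" .
    moreover have "D (a + t *\<^sub>R z) (s *\<^sub>R z) = s *\<^sub>R D (a + t *\<^sub>R z) z" for s
      using D has_derivative_linear linear_scale by blast
    ultimately show ?thesis
      by (simp add: has_vector_derivative_def has_derivative_at_withinI)
  qed
  have ftc: "((\<lambda>t. D (a + t *\<^sub>R z) z) has_integral f (a + l *\<^sub>R z) - f a) {0..l}"
    using fundamental_theorem_of_calculus[OF l(1) dv] by simp
  have ki: "(\<lambda>t. ?k t * norm z) integrable_on {0..l}"
    by (intro integrable_continuous_real continuous_intros continuous_on_subset[OF ck]) auto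
  have ki': "?k integrable_on {0..l}"
    by (intro integrable_continuous_real continuous_on_subset[OF ck]) auto
  define I where "I = integral {0..l} ?k"
  have I0: "0 \<le> I" unfolding I_def using k0 by (intro integral_nonneg ki') auto
  have "norm (f (a + l *\<^sub>R z) - f a) \<le> integral {0..l} (\<lambda>t. ?k t * norm z)"
    using Henstock_Kurzweil_Integration.integral_norm_bound_integral[OF has_integral_integrable[OF ftc] ki] DK
    by (simp add: integral_unique[OF ftc])
  then have le: "norm (f (a + l *\<^sub>R z) - f a) \<le> norm z * I"
    by (simp add: I_def mult.commute)
  have nI: "(\<integral>\<^sup>+t. ennreal (?k t) * indicator {0..l} t \<partial>lborel) = ennreal I"
  proof -
    have "((\<lambda>t. if t \<in> {0..l} then ?k t else 0) has_integral I) UNIV"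
      using ki' unfolding I_def by (subst has_integral_restrict_UNIV) (rule integrable_integral)
    then have "((\<lambda>t. ?k t * indicator {0..l} t) has_integral I) UNIV"
      by (rule has_integral_eq[rotated]) (auto simp: indicator_def)
    then have "(\<integral>\<^sup>+t. ennreal (?k t * indicator {0..l} t) \<partial>lborel) = ennreal I"
      by (intro nn_integral_has_integral_lborel) (auto simp: k0)
    then show ?thesis by (simp add: ennreal_mult' ennreal_indicator k0)
  qed
  \<comment> \<open>The doubled indicator supplies the second Cauchy-Schwarz factor; the integral of
    its square is \<open>l\<close>.\<close>
  have "(\<integral>\<^sup>+t. (ennreal (?k t) * indicator {0..l} t) * indicator {0..l} t \<partial>lborel) = ennreal I"
    unfolding nI[symmetric] by (intro nn_integral_cong) (simp add: indicator_def)
  then have "ennreal (I\<^sup>2) = (\<integral>\<^sup>+t. (ennreal (?k t) * indicator {0..l} t) * indicator {0..l} t \<partial>lborel)\<^sup>2"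
    using I0 by (simp add: ennreal_power)
  also have "\<dots> \<le> (\<integral>\<^sup>+t. (ennreal (?k t) * indicator {0..l} t)\<^sup>2 \<partial>lborel) *
                (\<integral>\<^sup>+t. (indicator {0..l} t)\<^sup>2 \<partial>lborel)"
    by (rule Cauchy_Schwarz_nn_integral) measurable
  also have "(\<integral>\<^sup>+t. (indicator {0..l} t)\<^sup>2 \<partial>lborel) = (\<integral>\<^sup>+t. indicator {0..l} t \<partial>lborel)"
    by (intro nn_integral_cong) (auto simp: indicator_def)
  also have "\<dots> = ennreal l" using l by simp
  also have "(\<integral>\<^sup>+t. (ennreal (?k t) * indicator {0..l} t)\<^sup>2 \<partial>lborel) =
      (\<integral>\<^sup>+t. ennreal ((?k t)\<^sup>2) * indicator {0..l} t \<partial>lborel)"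
    by (intro nn_integral_cong) (auto simp: indicator_def ennreal_power k0)
  also have "\<dots> * ennreal l \<le> \<dots> * 1"
    using l by (intro mult_left_mono) (auto simp: ennreal_le_1)
  finally have I2: "ennreal (I\<^sup>2) \<le> (\<integral>\<^sup>+t. ennreal ((?k t)\<^sup>2) * indicator {0..l} t \<partial>lborel)" by simp
  have "ennreal ((norm (f (a + l *\<^sub>R z) - f a))\<^sup>2) \<le> ennreal ((norm z)\<^sup>2 * I\<^sup>2)"
    using power_mono[OF le norm_ge_zero, of 2] by (intro ennreal_leI) (simp add: power_mult_distrib)
  also have "\<dots> = ennreal ((norm z)\<^sup>2) * ennreal (I\<^sup>2)" by (simp add: ennreal_mult)
  also have "\<dots> \<le> ennreal ((norm z)\<^sup>2) * (\<integral>\<^sup>+t. ennreal ((?k t)\<^sup>2) * indicator {0..l} t \<partial>lborel)"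
    by (intro mult_left_mono I2) simp
  finally show ?thesis .
qed

lemma nn_integral_lborel_translation:
  fixes g :: "'a::euclidean_space \<Rightarrow> ennreal"
  assumes "g \<in> borel_measurable borel"
  shows "(\<integral>\<^sup>+x. g (x + a) \<partial>lborel) = (\<integral>\<^sup>+x. g x \<partial>lborel)"
proof -
  have "(\<integral>\<^sup>+x. g x \<partial>lborel) = (\<integral>\<^sup>+x. g x \<partial>distr lborel borel ((+) a))"
    by (simp add: lborel_distr_plus)
  also have "\<dots> = (\<integral>\<^sup>+x. g (a + x) \<partial>lborel)"
    using assms by (intro nn_integral_distr) auto
  finally show ?thesis by (simp add: add.commute)
qed

abbreviation energy_on :: "'a::euclidean_space set \<Rightarrow> ('a \<Rightarrow> real) \<Rightarrow> ennreal" where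
  "energy_on S K \<equiv> (\<integral>\<^sup>+x. ennreal ((K x)\<^sup>2) * indicator S x \<partial>lborel)"

text \<open>For fixed \<open>t\<close> the shifted energy density has the same integral as the
  unshifted one, so integrating the segment estimate over \<open>a\<close> and exchanging the
  integrals costs only the factor \<open>(norm z)\<^sup>2\<close>. The length \<open>l a\<close> may
  vary with \<open>a\<close>, as it must when the segments end on the boundary.\<close>

lemma translation_estimate:
  fixes f :: "'a::euclidean_space \<Rightarrow> 'b::euclidean_space"
  assumes fK: "C1_bound f K" and S: "S \<in> sets borel"
    and l: "\<And>a. a \<in> A \<Longrightarrow> 0 \<le> l a \<and> l a \<le> 1"
    and seg: "\<And>a t. a \<in> A \<Longrightarrow> 0 < t \<Longrightarrow> t < l a \<Longrightarrow> a + t *\<^sub>R z \<in> S"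
  shows "(\<integral>\<^sup>+a. ennreal ((norm (f (a + l a *\<^sub>R z) - f a))\<^sup>2) * indicator A a \<partial>lborel)
           \<le> ennreal ((norm z)\<^sup>2) * energy_on S K"
proof -
  have [measurable]: "K \<in> borel_measurable borel" "S \<in> sets borel"
    using C1_bound_measurable[OF fK] S by auto
  let ?g = "\<lambda>x. ennreal ((K x)\<^sup>2) * indicator S x"
  have g: "?g \<in> borel_measurable borel" by measurable
  have "ennreal ((norm (f (a + l a *\<^sub>R z) - f a))\<^sup>2) * indicator A a \<le>
      (\<integral>\<^sup>+t. ennreal ((norm z)\<^sup>2) * (?g (a + t *\<^sub>R z) * indicator {0..1} t) \<partial>lborel)" for a
  proof (cases "a \<in> A")
    case True
    have "ennreal ((norm (f (a + l a *\<^sub>R z) - f a))\<^sup>2) \<le>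
        ennreal ((norm z)\<^sup>2) * (\<integral>\<^sup>+t. ennreal ((K (a + t *\<^sub>R z))\<^sup>2) * indicator {0..l a} t \<partial>lborel)"
      using l[OF True] by (intro C1_bound_segment[OF fK]) auto
    also have "(\<integral>\<^sup>+t. ennreal ((K (a + t *\<^sub>R z))\<^sup>2) * indicator {0..l a} t \<partial>lborel) \<le>
        (\<integral>\<^sup>+t. ?g (a + t *\<^sub>R z) * indicator {0..1} t \<partial>lborel)"
    proof (rule nn_integral_mono_AE)
      \<comment> \<open>\<open>seg\<close> covers open segments only, since the far end may lie on
        the boundary; the two endpoints are null.\<close>
      have "AE t in lborel. t \<noteq> 0 \<and> t \<noteq> l a"
        using AE_lborel_singleton[of 0] AE_lborel_singleton[of "l a"] by eventually_elim auto
      then show "AE t in lborel. ennreal ((K (a + t *\<^sub>R z))\<^sup>2) * indicator {0..l a} t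
              \<le> ?g (a + t *\<^sub>R z) * indicator {0..1} t"
      proof eventually_elim
        case (elim t)
        show ?case
        proof (cases "t \<in> {0..l a}")
          case t: True
          then have "a + t *\<^sub>R z \<in> S" using elim by (intro seg[OF True]) auto
          moreover have "t \<in> {0..1}" using t l[OF True] by auto
          ultimately show ?thesis using t by simp
        qed simp
      qed
    qed
    finally show ?thesis
      using True by (simp add: nn_integral_cmult mult_left_mono)
  qed simp
  then have "(\<integral>\<^sup>+a. ennreal ((norm (f (a + l a *\<^sub>R z) - f a))\<^sup>2) * indicator A a \<partial>lborel) \<le>
      (\<integral>\<^sup>+a. \<integral>\<^sup>+t. ennreal ((norm z)\<^sup>2) * (?g (a + t *\<^sub>R z) * indicator {0..1} t) \<partial>lborel \<partial>lborel)"
    by (intro nn_integral_mono)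
  also have "\<dots> = (\<integral>\<^sup>+t. \<integral>\<^sup>+a. ennreal ((norm z)\<^sup>2) * (?g (a + t *\<^sub>R z) * indicator {0..1} t) \<partial>lborel \<partial>lborel)"
    by (rule lborel_pair.Fubini') measurable
  also have "\<dots> = (\<integral>\<^sup>+t. ennreal ((norm z)\<^sup>2) * energy_on S K * indicator {0..1::real} t \<partial>lborel)"
  proof (intro nn_integral_cong)
    fix t :: real
    have "(\<integral>\<^sup>+a. ennreal ((norm z)\<^sup>2) * (?g (a + t *\<^sub>R z) * indicator {0..1} t) \<partial>lborel) =
        ennreal ((norm z)\<^sup>2) * ((\<integral>\<^sup>+a. ?g (a + t *\<^sub>R z) \<partial>lborel) * indicator {0..1} t)"
      by (simp add: nn_integral_cmult nn_integral_multc)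
    then show "(\<integral>\<^sup>+a. ennreal ((norm z)\<^sup>2) * (?g (a + t *\<^sub>R z) * indicator {0..1} t) \<partial>lborel) =
        ennreal ((norm z)\<^sup>2) * energy_on S K * indicator {0..1} t"
      using nn_integral_lborel_translation[OF g] by (simp add: mult.assoc)
  qed
  also have "\<dots> = ennreal ((norm z)\<^sup>2) * energy_on S K"
    by (simp add: nn_integral_cmult_indicator)
  finally show ?thesis .
qed

section \<open>Double integrals of differences and their chaining\<close>

text \<open>Iterated \<open>ennreal\<close> integrals, so that no integrability has to be tracked
  while sets are chained.\<close>

definition osc2 :: "('a::euclidean_space \<Rightarrow> 'b::euclidean_space) \<Rightarrow> 'a set \<Rightarrow> 'a set \<Rightarrow> ennreal" where
  "osc2 f V W = (\<integral>\<^sup>+x. (\<integral>\<^sup>+y. ennreal ((norm (f x - f y))\<^sup>2) * indicator W y \<partial>lborel) * indicator V x \<partial>lborel)"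

lemma osc2_mono:
  assumes "V' \<subseteq> V" "W' \<subseteq> W"
  shows "osc2 f V' W' \<le> osc2 f V W"
  unfolding osc2_def
  using assms by (intro nn_integral_mono mult_mono) (auto simp: indicator_def)

lemma osc2_sym:
  assumes [measurable]: "f \<in> borel_measurable borel" "V \<in> sets borel" "W \<in> sets borel"
  shows "osc2 f V W = osc2 f W V"
proof -
  have "osc2 f V W = (\<integral>\<^sup>+x. \<integral>\<^sup>+y. ennreal ((norm (f x - f y))\<^sup>2) * indicator W y * indicator V x \<partial>lborel \<partial>lborel)"
    unfolding osc2_def by (intro nn_integral_cong nn_integral_multc[symmetric]) measurable
  also have "\<dots> = (\<integral>\<^sup>+y. \<integral>\<^sup>+x. ennreal ((norm (f x - f y))\<^sup>2) * indicator W y * indicator V x \<partial>lborel \<partial>lborel)"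
    by (rule lborel_pair.Fubini') measurable
  also have "\<dots> = (\<integral>\<^sup>+y. \<integral>\<^sup>+x. ennreal ((norm (f y - f x))\<^sup>2) * indicator V x * indicator W y \<partial>lborel \<partial>lborel)"
    by (intro nn_integral_cong) (simp add: norm_minus_commute mult_ac)
  also have "\<dots> = osc2 f W V"
    unfolding osc2_def by (intro nn_integral_cong nn_integral_multc) measurable
  finally show ?thesis .
qed

lemma norm_diff_sq_le: "(norm (a - c))\<^sup>2 \<le> 2 * (norm (a - b))\<^sup>2 + 2 * (norm (b - c))\<^sup>2"
  for a b c :: "'a::real_normed_vector"
proof -
  have "norm (a - c) \<le> norm (a - b) + norm (b - c)"
    using norm_triangle_ineq[of "a - b" "b - c"] by simp
  then have "(norm (a - c))\<^sup>2 \<le> (norm (a - b) + norm (b - c))\<^sup>2" by (rule power_mono) simp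
  also have "\<dots> \<le> 2 * (norm (a - b))\<^sup>2 + 2 * (norm (b - c))\<^sup>2"
    using sum_squares_bound[of "norm (a - b)" "norm (b - c)"] by (simp add: power2_sum)
  finally show ?thesis .
qed

lemma ennreal_norm_diff_sq_le:
  "ennreal ((norm (a - c))\<^sup>2) \<le> 2 * ennreal ((norm (a - b))\<^sup>2) + 2 * ennreal ((norm (b - c))\<^sup>2)"
  for a b c :: "'a::real_normed_vector"
  using ennreal_leI[OF norm_diff_sq_le[of a c b]]
  by (simp add: ennreal_plus ennreal_mult)

text \<open>Every pair \<open>x\<close>, \<open>y\<close> is joined through all \<open>z\<close> in
  \<open>M\<close> by the quadratic triangle inequality; the mean over \<open>M\<close> is left
  multiplied out.\<close>

lemma osc2_chain:
  assumes [measurable]: "f \<in> borel_measurable borel" "V \<in> sets borel" "M \<in> sets borel" "W \<in> sets borel"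
  shows "emeasure lborel M * osc2 f V W \<le>
    2 * emeasure lborel W * osc2 f V M + 2 * emeasure lborel V * osc2 f M W"
proof -
  let ?d = "\<lambda>x y. ennreal ((norm (f x - f y))\<^sup>2)"
  let ?I = "\<lambda>x M. \<integral>\<^sup>+z. ?d x z * indicator M z \<partial>lborel"
  have [measurable]: "(\<lambda>x. ?I x N) \<in> borel_measurable borel" if "N \<in> sets borel" for N
    using that by measurable
  have pt: "emeasure lborel M * ?d x y \<le> 2 * ?I x M + 2 * ?I y M" for x y
  proof -
    have "emeasure lborel M * ?d x y = (\<integral>\<^sup>+z. ?d x y * indicator M z \<partial>lborel)"
      by (subst nn_integral_cmult_indicator) (auto simp: mult.commute)
    also have "\<dots> \<le> (\<integral>\<^sup>+z. 2 * (?d x z * indicator M z) + 2 * (?d y z * indicator M z) \<partial>lborel)"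
      using ennreal_norm_diff_sq_le[of "f x" "f y" "f z" for z]
      by (intro nn_integral_mono) (auto simp: indicator_def norm_minus_commute)
    also have "\<dots> = 2 * ?I x M + 2 * ?I y M"
      by (simp add: nn_integral_add nn_integral_cmult)
    finally show ?thesis .
  qed
  have row: "emeasure lborel M * ?I x W \<le> 2 * emeasure lborel W * ?I x M + 2 * osc2 f M W" for x
  proof -
    have "emeasure lborel M * ?I x W = (\<integral>\<^sup>+y. emeasure lborel M * ?d x y * indicator W y \<partial>lborel)"
      by (subst nn_integral_cmult[symmetric]) (auto simp: mult.assoc)
    also have "\<dots> \<le> (\<integral>\<^sup>+y. 2 * ?I x M * indicator W y + 2 * (?I y M * indicator W y) \<partial>lborel)"
      using pt by (intro nn_integral_mono) (auto simp: indicator_def)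
    also have "\<dots> = 2 * ?I x M * emeasure lborel W + 2 * osc2 f W M"
      by (simp add: nn_integral_add nn_integral_cmult osc2_def nn_integral_cmult_indicator)
    finally show ?thesis by (simp add: osc2_sym[of f W M] mult_ac)
  qed
  have "emeasure lborel M * osc2 f V W =
      (\<integral>\<^sup>+x. emeasure lborel M * ?I x W * indicator V x \<partial>lborel)"
    unfolding osc2_def by (subst nn_integral_cmult[symmetric]) (auto simp: mult.assoc)
  also have "\<dots> \<le> (\<integral>\<^sup>+x. 2 * emeasure lborel W * (?I x M * indicator V x) + 2 * osc2 f M W * indicator V x \<partial>lborel)"
    using row by (intro nn_integral_mono) (auto simp: indicator_def)
  also have "\<dots> = 2 * emeasure lborel W * osc2 f V M + 2 * osc2 f M W * emeasure lborel V"
    by (simp add: nn_integral_add nn_integral_cmult osc2_def nn_integral_cmult_indicator)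
  finally show ?thesis by (simp add: mult_ac)
qed

lemma emeasure_lborel_open_pos:
  fixes U :: "'a::euclidean_space set"
  assumes "open U" "U \<noteq> {}"
  shows "emeasure lborel U > 0"
proof (rule ccontr)
  assume "\<not> emeasure lborel U > 0"
  then have "U \<in> null_sets lborel" using assms(1) by (auto simp: null_sets_def)
  then have "negligible U" by (simp add: negligible_iff_null_sets null_sets_completionI)
  then show False using open_not_negligible assms by blast
qed

lemma emeasure_lborel_bounded: "bounded V \<Longrightarrow> emeasure lborel V < \<infinity>"
  using emeasure_bounded_finite by simp

text \<open>
  A Poincare inequality in terms of double integrals of differences. Unlike one with mean values it
  can be chained along overlapping sets.
\<close>

definition osc_controlled :: "'a::euclidean_space set \<Rightarrow> 'a set \<Rightarrow> 'a set \<Rightarrow> bool" where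
  "osc_controlled S V W \<longleftrightarrow>
     (\<exists>C::real. \<forall>(f :: 'a \<Rightarrow> 'a) K. C1_bound f K \<longrightarrow> osc2 f V W \<le> ennreal C * energy_on S K)"

lemma osc_controlled_mono:
  "osc_controlled S V W \<Longrightarrow> V' \<subseteq> V \<Longrightarrow> W' \<subseteq> W \<Longrightarrow> osc_controlled S V' W'"
  unfolding osc_controlled_def using osc2_mono order_trans by meson

lemma osc_controlled_sym:
  assumes "V \<in> sets borel" "W \<in> sets borel" "osc_controlled S V W"
  shows "osc_controlled S W V"
  using assms(3) osc2_sym[OF C1_bound_measurable(1) assms(1,2)] unfolding osc_controlled_def by metis

text \<open>Division of \<open>osc2_chain\<close> by the measure of the link \<open>M\<close>, which
  therefore has to be positive.\<close>

lemma osc_controlled_trans: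
  assumes V: "V \<in> sets borel" "M \<in> sets borel" "W \<in> sets borel"
    and fin: "emeasure lborel V < \<infinity>" "emeasure lborel M < \<infinity>" "emeasure lborel W < \<infinity>"
    and pos: "emeasure lborel M > 0"
    and "osc_controlled S V M" "osc_controlled S M W"
  shows "osc_controlled S V W"
proof -
  obtain C1 :: real where
    C1: "\<And>(f :: 'a \<Rightarrow> 'a) K. C1_bound f K \<Longrightarrow> osc2 f V M \<le> ennreal C1 * energy_on S K"
    using assms(8) unfolding osc_controlled_def by blast
  obtain C2 :: real where
    C2: "\<And>(f :: 'a \<Rightarrow> 'a) K. C1_bound f K \<Longrightarrow> osc2 f M W \<le> ennreal C2 * energy_on S K"
    using assms(9) unfolding osc_controlled_def by blast
  define v m w where "v = measure lborel V" "m = measure lborel M" "w = measure lborel W"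
  have e: "emeasure lborel V = ennreal v" "emeasure lborel M = ennreal m" "emeasure lborel W = ennreal w"
    using fin by (auto simp: v_m_w_def emeasure_eq_ennreal_measure)
  have m: "m > 0" using pos e by simp
  have vw: "v \<ge> 0" "w \<ge> 0" by (auto simp: v_m_w_def)
  \<comment> \<open>\<open>ennreal\<close> sends negative reals to 0, so \<open>max C1 0\<close> and
    \<open>max C2 0\<close> replace constants of unknown sign without weakening the bounds.\<close>
  define C where "C = (2 * w * max C1 0 + 2 * v * max C2 0) / m"
  have C0: "0 \<le> C" using m vw by (simp add: C_def)
  have "osc2 f V W \<le> ennreal C * energy_on S K" if fK: "C1_bound f K" for f :: "'a \<Rightarrow> 'a" and K
  proof -
    let ?E = "energy_on S K"
    have c1: "ennreal C1 \<le> ennreal (max C1 0)" "ennreal C2 \<le> ennreal (max C2 0)"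
      by (auto intro: ennreal_leI)
    have "ennreal m * osc2 f V W \<le> 2 * ennreal w * osc2 f V M + 2 * ennreal v * osc2 f M W"
      using osc2_chain[OF C1_bound_measurable(1)[OF fK] V(1,2,3)] by (simp add: e)
    also have "\<dots> \<le> 2 * ennreal w * (ennreal (max C1 0) * ?E) + 2 * ennreal v * (ennreal (max C2 0) * ?E)"
      by (intro add_mono mult_left_mono order_trans[OF C1[OF fK] mult_right_mono[OF c1(1)]]
          order_trans[OF C2[OF fK] mult_right_mono[OF c1(2)]]) simp_all
    also have "\<dots> = ennreal (2 * w * max C1 0 + 2 * v * max C2 0) * ?E"
      using vw by (simp add: ennreal_plus ennreal_mult distrib_right mult.assoc)
    also have "2 * w * max C1 0 + 2 * v * max C2 0 = m * C" using m by (simp add: C_def)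
    also have "ennreal (m * C) * ?E = ennreal m * (ennreal C * ?E)"
      using m C0 by (simp add: ennreal_mult mult.assoc)
    finally show ?thesis
      using m by (subst (asm) ennreal_mult_le_mult_iff) auto
  qed
  then show ?thesis unfolding osc_controlled_def by blast
qed

lemma osc_controlled_Un:
  assumes "V1 \<in> sets borel" "V2 \<in> sets borel" "W \<in> sets borel"
    and "osc_controlled S V1 W" "osc_controlled S V2 W"
  shows "osc_controlled S (V1 \<union> V2) W"
proof -
  obtain C1 :: real where
    C1: "\<And>(f :: 'a \<Rightarrow> 'a) K. C1_bound f K \<Longrightarrow> osc2 f V1 W \<le> ennreal C1 * energy_on S K"
    using assms(4) unfolding osc_controlled_def by blast
  obtain C2 :: real where
    C2: "\<And>(f :: 'a \<Rightarrow> 'a) K. C1_bound f K \<Longrightarrow> osc2 f V2 W \<le> ennreal C2 * energy_on S K"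
    using assms(5) unfolding osc_controlled_def by blast
  have "osc2 f (V1 \<union> V2) W \<le> ennreal (max C1 0 + max C2 0) * energy_on S K"
    if fK: "C1_bound f K" for f :: "'a \<Rightarrow> 'a" and K
  proof -
    have [measurable]: "f \<in> borel_measurable borel" "V1 \<in> sets borel" "V2 \<in> sets borel" "W \<in> sets borel"
      using C1_bound_measurable[OF fK] assms by auto
    let ?I = "\<lambda>x. \<integral>\<^sup>+y. ennreal ((norm (f x - f y))\<^sup>2) * indicator W y \<partial>lborel"
    have "osc2 f (V1 \<union> V2) W \<le> (\<integral>\<^sup>+x. ?I x * indicator V1 x + ?I x * indicator V2 x \<partial>lborel)"
      unfolding osc2_def by (intro nn_integral_mono) (auto simp: indicator_def)
    also have "\<dots> = osc2 f V1 W + osc2 f V2 W"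
      unfolding osc2_def by (intro nn_integral_add) measurable
    also have "\<dots> \<le> ennreal C1 * energy_on S K + ennreal C2 * energy_on S K"
      by (intro add_mono C1 C2 fK)
    also have "\<dots> \<le> ennreal (max C1 0) * energy_on S K + ennreal (max C2 0) * energy_on S K"
      by (intro add_mono mult_right_mono ennreal_leI) auto
    also have "\<dots> = ennreal (max C1 0 + max C2 0) * energy_on S K"
      by (simp add: ennreal_plus distrib_right)
    finally show ?thesis .
  qed
  then show ?thesis unfolding osc_controlled_def by blast
qed

text \<open>After the substitution \<open>y = x + z\<close>, convexity keeps each segment inside
  \<open>V\<close>, so the translation estimate applies for every fixed \<open>z\<close>.
  Differences of points of \<open>V\<close> have norm at most \<open>2 * R\<close>, so
  \<open>z\<close> ranges over a ball of finite measure.\<close>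

lemma osc_controlled_convex:
  assumes V: "convex V" "bounded V" "V \<in> sets borel" and S: "V \<subseteq> S" "S \<in> sets borel"
  shows "osc_controlled S V V"
proof -
  obtain R where R: "R > 0" "\<And>x. x \<in> V \<Longrightarrow> norm x \<le> R"
    using V(2) by (auto simp: bounded_pos)
  define B where "B = measure lborel (cball (0::'a) (2 * R))"
  have B: "emeasure lborel (cball (0::'a) (2 * R)) = ennreal B"
    unfolding B_def using emeasure_lborel_cball_finite[of "0::'a" "2 * R"]
    by (intro emeasure_eq_ennreal_measure) auto
  have "osc2 f V V \<le> ennreal ((2 * R)\<^sup>2 * B) * energy_on S K"
    if fK: "C1_bound f K" for f :: "'a \<Rightarrow> 'a" and K
  proof -
    have [measurable]: "f \<in> borel_measurable borel" "V \<in> sets borel"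
      using C1_bound_measurable[OF fK] V by auto
    let ?h = "\<lambda>x z. ennreal ((norm (f (x + z) - f x))\<^sup>2) * indicator V (x + z) * indicator V x"
    have "osc2 f V V = (\<integral>\<^sup>+x. \<integral>\<^sup>+z. ?h x z \<partial>lborel \<partial>lborel)"
      unfolding osc2_def
    proof (intro nn_integral_cong)
      fix x
      have "(\<integral>\<^sup>+y. ennreal ((norm (f x - f y))\<^sup>2) * indicator V y \<partial>lborel) =
          (\<integral>\<^sup>+z. ennreal ((norm (f x - f (z + x)))\<^sup>2) * indicator V (z + x) \<partial>lborel)"
        by (subst nn_integral_lborel_translation[where a=x]) measurable
      then show "(\<integral>\<^sup>+y. ennreal ((norm (f x - f y))\<^sup>2) * indicator V y \<partial>lborel) * indicator V x =
          (\<integral>\<^sup>+z. ?h x z \<partial>lborel)"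
        by (simp add: nn_integral_multc norm_minus_commute add.commute)
    qed
    also have "\<dots> = (\<integral>\<^sup>+z. \<integral>\<^sup>+x. ?h x z \<partial>lborel \<partial>lborel)"
      by (rule lborel_pair.Fubini') measurable
    also have "\<dots> \<le> (\<integral>\<^sup>+z. ennreal ((2 * R)\<^sup>2) * energy_on S K * indicator (cball (0::'a) (2 * R)) z \<partial>lborel)"
    proof (rule nn_integral_mono)
      fix z :: 'a
      show "(\<integral>\<^sup>+x. ?h x z \<partial>lborel) \<le> ennreal ((2 * R)\<^sup>2) * energy_on S K * indicator (cball 0 (2 * R)) z"
      proof (cases "z \<in> cball 0 (2 * R)")
        case True
        let ?A = "{x \<in> V. x + z \<in> V}"
        have "(\<integral>\<^sup>+x. ?h x z \<partial>lborel) =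
            (\<integral>\<^sup>+x. ennreal ((norm (f (x + 1 *\<^sub>R z) - f x))\<^sup>2) * indicator ?A x \<partial>lborel)"
          by (intro nn_integral_cong) (auto simp: indicator_def)
        also have "\<dots> \<le> ennreal ((norm z)\<^sup>2) * energy_on S K"
        proof (rule translation_estimate[OF fK S(2)])
          fix a t :: real and x assume "x \<in> ?A" "0 < t" "t < 1"
          then have "(1 - t) *\<^sub>R x + t *\<^sub>R (x + z) \<in> V"
            using V(1) by (intro convexD_alt) auto
          then show "x + t *\<^sub>R z \<in> S" using S by (auto simp: algebra_simps)
        qed simp
        also have "\<dots> \<le> ennreal ((2 * R)\<^sup>2) * energy_on S K"
          using True by (intro mult_right_mono ennreal_leI power_mono) auto
        finally show ?thesis using True by simp
      next
        case False
        have "?h x z = 0" for x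
        proof (rule ccontr)
          assume "?h x z \<noteq> 0"
          then have "x \<in> V" "x + z \<in> V" by (auto simp: indicator_def split: if_splits)
          then have "norm z \<le> 2 * R"
            using R(2)[of x] R(2)[of "x + z"] norm_triangle_ineq4[of "x + z" x] by simp
          then show False using False by simp
        qed
        then have "(\<integral>\<^sup>+x. ?h x z \<partial>lborel) = (\<integral>\<^sup>+x. 0 \<partial>(lborel :: 'a measure))"
          by (intro nn_integral_cong)
        then show ?thesis by (simp only: nn_integral_const mult_zero_left zero_le)
      qed
    qed
    also have "\<dots> = ennreal ((2 * R)\<^sup>2) * energy_on S K * ennreal B"
      by (simp add: nn_integral_cmult_indicator B)
    also have "\<dots> = ennreal ((2 * R)\<^sup>2 * B) * energy_on S K"
      by (simp add: ennreal_mult B_def mult_ac)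
    finally show ?thesis .
  qed
  then show ?thesis unfolding osc_controlled_def by blast
qed

text \<open>Carries an estimate from an interior set \<open>V'\<close> to a patch \<open>V\<close>
  that may touch the boundary: \<open>f x\<close> is compared with \<open>f (x + z)\<close> by the
  translation estimate, and \<open>f (x + z)\<close> with the values on \<open>W\<close> by the
  assumption on \<open>V'\<close>.\<close>

lemma osc_controlled_translate:
  assumes V: "V \<in> sets borel" "W \<in> sets borel" "V' \<in> sets borel" "S \<in> sets borel"
    and fin: "emeasure lborel V < \<infinity>" "emeasure lborel W < \<infinity>"
    and seg: "\<And>x t. x \<in> V \<Longrightarrow> 0 < t \<Longrightarrow> t < 1 \<Longrightarrow> x + t *\<^sub>R z \<in> S"
    and sub: "\<And>x. x \<in> V \<Longrightarrow> x + z \<in> V'"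
    and "osc_controlled S V' W"
  shows "osc_controlled S V W"
proof -
  obtain C :: real where
    C: "\<And>(f :: 'a \<Rightarrow> 'a) K. C1_bound f K \<Longrightarrow> osc2 f V' W \<le> ennreal C * energy_on S K"
    using assms(9) unfolding osc_controlled_def by blast
  define w where "w = measure lborel W"
  have w: "emeasure lborel W = ennreal w" "w \<ge> 0"
    using fin by (auto simp: w_def emeasure_eq_ennreal_measure)
  have "osc2 f V W \<le> ennreal (2 * w * (norm z)\<^sup>2 + 2 * max C 0) * energy_on S K"
    if fK: "C1_bound f K" for f :: "'a \<Rightarrow> 'a" and K
  proof -
    have [measurable]: "f \<in> borel_measurable borel" "V \<in> sets borel" "W \<in> sets borel" "V' \<in> sets borel"
      using C1_bound_measurable[OF fK] V by auto
    let ?I = "\<lambda>x. \<integral>\<^sup>+y. ennreal ((norm (f x - f y))\<^sup>2) * indicator W y \<partial>lborel"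
    let ?s = "\<lambda>x. ennreal ((norm (f (x + 1 *\<^sub>R z) - f x))\<^sup>2)"
    have row: "?I x \<le> 2 * ?s x * ennreal w + 2 * ?I (x + z)" for x
    proof -
      have "?I x \<le> (\<integral>\<^sup>+y. 2 * ?s x * indicator W y +
          2 * (ennreal ((norm (f (x + z) - f y))\<^sup>2) * indicator W y) \<partial>lborel)"
        using ennreal_norm_diff_sq_le[of "f x" "f y" "f (x + z)" for y]
        by (intro nn_integral_mono) (auto simp: indicator_def norm_minus_commute)
      also have "\<dots> = 2 * ?s x * ennreal w + 2 * ?I (x + z)"
        by (simp add: nn_integral_add nn_integral_cmult nn_integral_cmult_indicator w)
      finally show ?thesis .
    qed
    have "osc2 f V W \<le> (\<integral>\<^sup>+x. 2 * ennreal w * (?s x * indicator V x) +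
          2 * (?I (x + z) * indicator V' (x + z)) \<partial>lborel)"
      unfolding osc2_def
      using row sub by (intro nn_integral_mono) (auto simp: indicator_def mult_ac)
    also have "\<dots> = 2 * ennreal w * (\<integral>\<^sup>+x. ?s x * indicator V x \<partial>lborel) +
          2 * (\<integral>\<^sup>+x. ?I (x + z) * indicator V' (x + z) \<partial>lborel)"
      by (simp add: nn_integral_add nn_integral_cmult)
    also have "(\<integral>\<^sup>+x. ?I (x + z) * indicator V' (x + z) \<partial>lborel) = osc2 f V' W"
      unfolding osc2_def by (rule nn_integral_lborel_translation) measurable
    also have "2 * ennreal w * (\<integral>\<^sup>+x. ?s x * indicator V x \<partial>lborel) + 2 * osc2 f V' W \<le>
        2 * ennreal w * (ennreal ((norm z)\<^sup>2) * energy_on S K) + 2 * (ennreal (max C 0) * energy_on S K)"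
    proof (intro add_mono mult_left_mono)
      show "(\<integral>\<^sup>+x. ?s x * indicator V x \<partial>lborel) \<le> ennreal ((norm z)\<^sup>2) * energy_on S K"
        by (rule translation_estimate[OF fK V(4)]) (use seg in auto)
      show "osc2 f V' W \<le> ennreal (max C 0) * energy_on S K"
        using C[OF fK] by (rule order_trans) (auto intro: mult_right_mono ennreal_leI)
    qed auto
    also have "\<dots> = ennreal (2 * w * (norm z)\<^sup>2 + 2 * max C 0) * energy_on S K"
      using w by (simp add: ennreal_plus ennreal_mult distrib_right mult.assoc)
    finally show ?thesis .
  qed
  then show ?thesis unfolding osc_controlled_def by blast
qed

section \<open>Boundary charts and the estimate on the whole domain\<close>

text \<open>The chart function is extended to the whole space as constant along \<open>e\<close>,
  which turns moves along \<open>e\<close> into pure changes of height. A boundary point lies on the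
  graph: strictly above, it would belong to the open \<open>\<Omega>\<close>; strictly below, a
  neighbourhood would miss \<open>\<Omega>\<close>.\<close>

lemma lipschitz_boundary_chart:
  fixes \<Omega> :: "'a::euclidean_space set"
  assumes "open \<Omega>" "lipschitz_boundary \<Omega>" "x \<in> frontier \<Omega>"
  obtains r e q where "r > 0" "norm e = 1" "continuous_on UNIV q" "\<And>y s. q (y + s *\<^sub>R e) = q y"
    "\<And>y. y \<in> ball x r \<Longrightarrow> y \<in> \<Omega> \<longleftrightarrow> q y < y \<bullet> e" "q x = x \<bullet> e"
proof -
  obtain r e L g where r: "r > 0" and e: "norm e = 1" and g: "L-lipschitz_on {z. z \<bullet> e = 0} g"
    and ch: "\<And>y. y \<in> ball x r \<Longrightarrow> y \<in> \<Omega> \<longleftrightarrow> (g (y - (y \<bullet> e) *\<^sub>R e) :: real) < y \<bullet> e"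
    using assms(2,3) unfolding lipschitz_boundary_def by blast
  have ee: "e \<bullet> e = 1" using e by (simp add: norm_eq_1)
  define q where "q y = g (y - (y \<bullet> e) *\<^sub>R e)" for y
  have cq: "continuous_on UNIV q"
    unfolding q_def
    by (intro continuous_on_compose2[OF lipschitz_on_continuous_on[OF g]] continuous_intros)
      (auto simp: inner_diff_left ee)
  have qs: "q (y + s *\<^sub>R e) = q y" for y s
    unfolding q_def by (simp add: inner_add_left ee algebra_simps)
  have ch': "\<And>y. y \<in> ball x r \<Longrightarrow> y \<in> \<Omega> \<longleftrightarrow> q y < y \<bullet> e" using ch by (simp add: q_def)
  have "x \<notin> \<Omega>" using assms(1,3) by (auto simp: frontier_def interior_open)
  then have "q x \<ge> x \<bullet> e" using ch'[of x] r by auto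
  moreover have "q x \<le> x \<bullet> e"
  proof (rule ccontr)
    assume "\<not> q x \<le> x \<bullet> e"
    have "open {y. y \<bullet> e < q y}"
      by (intro open_Collect_less continuous_intros cq)
    then have "open ({y. y \<bullet> e < q y} \<inter> ball x r)" by auto
    moreover have "x \<in> {y. y \<bullet> e < q y} \<inter> ball x r" using \<open>\<not> q x \<le> x \<bullet> e\<close> r by auto
    moreover have "x \<in> closure \<Omega>" using assms(3) by (simp add: frontier_def)
    ultimately have "\<Omega> \<inter> ({y. y \<bullet> e < q y} \<inter> ball x r) \<noteq> {}"
      using open_Int_closure_eq_empty[of "{y. y \<bullet> e < q y} \<inter> ball x r" \<Omega>] by blast
    then show False using ch' by fastforce
  qed
  ultimately show ?thesis using that[OF r e cq qs ch'] by simp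
qed

text \<open>Moving up by \<open>r / 2\<close> along the chart direction stays above the graph and
  takes \<open>x\<close> to an interior point, around which the estimate is already known.\<close>

lemma osc_controlled_boundary:
  fixes \<Omega> :: "'a::euclidean_space set"
  assumes \<Omega>: "open \<Omega>" "bounded \<Omega>" "lipschitz_boundary \<Omega>"
    and x: "x \<in> frontier \<Omega>" and W: "W \<in> sets borel" "emeasure lborel W < \<infinity>"
    and near: "\<And>y. y \<in> \<Omega> \<Longrightarrow> \<exists>r>0. osc_controlled \<Omega> (ball y r) W"
  shows "\<exists>r>0. osc_controlled \<Omega> (ball x r \<inter> \<Omega>) W"
proof -
  obtain r e q where r: "r > 0" and e: "norm e = 1" and cq: "continuous_on UNIV q"
    and qs: "\<And>y s. q (y + s *\<^sub>R e) = q y"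
    and ch: "\<And>y. y \<in> ball x r \<Longrightarrow> y \<in> \<Omega> \<longleftrightarrow> q y < y \<bullet> e" and qx: "q x = x \<bullet> e"
    by (rule lipschitz_boundary_chart[OF \<Omega>(1,3) x]) blast
  have ee: "e \<bullet> e = 1" using e by (simp add: norm_eq_1)
  let ?z = "(r / 2) *\<^sub>R e"
  have "x + ?z \<in> ball x r" using r e by (simp add: dist_norm)
  then have "x + ?z \<in> \<Omega>" using ch r by (simp add: qs qx inner_add_left ee)
  then obtain \<rho> where \<rho>: "\<rho> > 0" "osc_controlled \<Omega> (ball (x + ?z) \<rho>) W" using near by blast
  \<comment> \<open>\<open>s \<le> \<rho>\<close> makes the translate fit into the known ball;
    \<open>s \<le> r / 2\<close> keeps the whole path of length \<open>r / 2\<close> inside the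
    chart.\<close>
  define s where "s = min \<rho> (r / 2)"
  have "osc_controlled \<Omega> (ball x s \<inter> \<Omega>) W"
  proof (rule osc_controlled_translate)
    show "osc_controlled \<Omega> (ball (x + ?z) \<rho>) W" by (rule \<rho>)
    show "y + ?z \<in> ball (x + ?z) \<rho>" if "y \<in> ball x s \<inter> \<Omega>" for y
      using that by (auto simp: s_def dist_norm algebra_simps)
    have "emeasure lborel (ball x s \<inter> \<Omega>) \<le> emeasure lborel (ball x s)"
      by (intro emeasure_mono) auto
    then show "emeasure lborel (ball x s \<inter> \<Omega>) < \<infinity>"
      using emeasure_lborel_ball_finite[of x s] by (metis infinity_ennreal_def order_le_less_trans)
    fix y t assume y: "y \<in> ball x s \<inter> \<Omega>" and t: "0 < t" "t < (1::real)"
    have "norm (t *\<^sub>R ?z) \<le> r / 2" using t r e by simp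
    then have "norm (y + t *\<^sub>R ?z - x) < r"
      using y norm_triangle_ineq[of "y - x" "t *\<^sub>R ?z"] by (auto simp: s_def dist_norm norm_minus_commute algebra_simps)
    then have b: "y + t *\<^sub>R ?z \<in> ball x r" by (simp add: dist_norm norm_minus_commute)
    have "y \<in> ball x r" using y r by (auto simp: s_def)
    then have "q y < y \<bullet> e" using ch y by blast
    then have "q (y + t *\<^sub>R ?z) < (y + t *\<^sub>R ?z) \<bullet> e"
      using t r qs[of y "t * (r / 2)"] by (simp add: inner_add_left ee add_strict_increasing2 less_le_trans[of _ "y \<bullet> e"])
    then show "y + t *\<^sub>R ?z \<in> \<Omega>" using ch[OF b] by blast
  qed (use \<Omega> W in auto)
  moreover have "s > 0" using \<rho> r by (simp add: s_def)
  ultimately show ?thesis by blast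
qed

text \<open>One ball inside \<open>\<Omega>\<close> is the hub: neighbourhoods of all points of the
  closure are compared with it, compactness leaves finitely many of them, and symmetry allows a last
  link through the hub.\<close>

theorem osc_controlled_domain:
  fixes \<Omega> :: "'a::euclidean_space set"
  assumes \<Omega>: "open \<Omega>" "bounded \<Omega>" "connected \<Omega>" "\<Omega> \<noteq> {}" "lipschitz_boundary \<Omega>"
  shows "osc_controlled \<Omega> \<Omega> \<Omega>"
proof -
  obtain b0 r0 where b0: "b0 \<in> \<Omega>" "r0 > 0" "ball b0 r0 \<subseteq> \<Omega>"
    using \<Omega> by (meson ex_in_conv open_contains_ball)
  let ?B = "ball b0 r0"
  have \<Omega>b: "\<Omega> \<in> sets borel" using \<Omega>(1) by simp
  have self: "osc_controlled \<Omega> (ball a r) (ball a r)" if "ball a r \<subseteq> \<Omega>" for a r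
    using that \<Omega>b by (intro osc_controlled_convex) auto
  \<comment> \<open>Being comparable with the hub is a locally constant property, hence it spreads
    over the connected \<open>\<Omega>\<close>.\<close>
  have B: "\<exists>r>0. osc_controlled \<Omega> (ball y r) ?B" if "y \<in> \<Omega>" for y
  proof (rule connected_induction_simple[OF \<Omega>(3) b0(1) that,
        where P = "\<lambda>y. \<exists>r>0. osc_controlled \<Omega> (ball y r) ?B"])
    show "\<exists>r>0. osc_controlled \<Omega> (ball b0 r) ?B" using self b0 by blast
    fix a assume "a \<in> \<Omega>"
    then obtain \<rho> where \<rho>: "\<rho> > 0" "ball a \<rho> \<subseteq> \<Omega>" using \<Omega>(1) open_contains_ball by blast
    have "\<exists>r>0. osc_controlled \<Omega> (ball y r) ?B"
      if xy: "x \<in> ball a \<rho>" "y \<in> ball a \<rho>" and P: "\<exists>r>0. osc_controlled \<Omega> (ball x r) ?B" for x y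
    proof -
      obtain r where r: "r > 0" "osc_controlled \<Omega> (ball x r) ?B" using P by blast
      \<comment> \<open>The overlap contains \<open>x\<close>, so it is open and nonempty, a link of
        positive measure.\<close>
      let ?M = "ball a \<rho> \<inter> ball x r"
      have M: "open ?M" "?M \<noteq> {}" using xy r by auto
      have "osc_controlled \<Omega> (ball a \<rho>) ?B"
      proof (rule osc_controlled_trans)
        show "osc_controlled \<Omega> (ball a \<rho>) ?M"
          by (rule osc_controlled_mono[OF self[OF \<rho>(2)]]) auto
        show "osc_controlled \<Omega> ?M ?B" by (rule osc_controlled_mono[OF r(2)]) auto
        show "emeasure lborel ?M > 0" by (rule emeasure_lborel_open_pos[OF M])
      qed (auto intro!: emeasure_lborel_bounded[simplified] bounded_Int)
      moreover obtain s where "s > 0" "ball y s \<subseteq> ball a \<rho>"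
        using openE[OF open_ball xy(2)] by blast
      ultimately show ?thesis using osc_controlled_mono by blast
    qed
    moreover have "openin (top_of_set \<Omega>) (ball a \<rho>)"
      using \<rho>(2) by (simp add: open_subset)
    ultimately show "\<exists>T. openin (top_of_set \<Omega>) T \<and> a \<in> T \<and>
        (\<forall>x\<in>T. \<forall>y\<in>T. (\<exists>r>0. osc_controlled \<Omega> (ball x r) ?B) \<longrightarrow> (\<exists>r>0. osc_controlled \<Omega> (ball y r) ?B))"
      using \<rho>(1) by (intro exI[of _ "ball a \<rho>"] conjI ballI impI) (assumption | simp)+
  qed
  have "\<exists>r>0. osc_controlled \<Omega> (ball y r \<inter> \<Omega>) ?B" if "y \<in> closure \<Omega>" for y
  proof (cases "y \<in> \<Omega>")
    case True
    then obtain r where r: "r > 0" "osc_controlled \<Omega> (ball y r) ?B" using B by blast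
    show ?thesis
      using r(1) osc_controlled_mono[OF r(2) Int_lower1 order_refl] by (intro exI[of _ r] conjI)
  next
    case False
    then have "y \<in> frontier \<Omega>" using that \<Omega>(1) by (simp add: frontier_def interior_open)
    show ?thesis
      by (rule osc_controlled_boundary[OF \<Omega>(1,2,5) \<open>y \<in> frontier \<Omega>\<close> _ emeasure_lborel_bounded B])
        simp_all
  qed
  then have "\<exists>\<rho>. \<forall>y\<in>closure \<Omega>. \<rho> y > 0 \<and> osc_controlled \<Omega> (ball y (\<rho> y) \<inter> \<Omega>) ?B"
    by (intro bchoice) blast
  then obtain \<rho> where \<rho>: "\<And>y. y \<in> closure \<Omega> \<Longrightarrow> \<rho> y > 0 \<and> osc_controlled \<Omega> (ball y (\<rho> y) \<inter> \<Omega>) ?B"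
    by blast
  have "compact (closure \<Omega>)" using \<Omega>(2) by simp
  then obtain F where F: "F \<subseteq> closure \<Omega>" "finite F" "closure \<Omega> \<subseteq> (\<Union>y\<in>F. ball y (\<rho> y))"
    by (rule compactE_image[of _ "closure \<Omega>" "\<lambda>y. ball y (\<rho> y)"]) (use \<rho> in force)+
  have "osc_controlled \<Omega> (\<Union>y\<in>F. ball y (\<rho> y) \<inter> \<Omega>) ?B"
    using F(2,1)
  proof (induction F)
    case empty
    have "osc2 f {} ?B = 0" for f :: "'a \<Rightarrow> 'a" by (simp add: osc2_def)
    then show ?case by (auto simp: osc_controlled_def)
  next
    case (insert y F)
    have "osc_controlled \<Omega> ((ball y (\<rho> y) \<inter> \<Omega>) \<union> (\<Union>y\<in>F. ball y (\<rho> y) \<inter> \<Omega>)) ?B"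
      using insert \<rho> \<Omega>(1) by (intro osc_controlled_Un borel_open) auto
    then show ?case by simp
  qed
  moreover have "\<Omega> \<subseteq> (\<Union>y\<in>F. ball y (\<rho> y) \<inter> \<Omega>)"
    using F(3) closure_subset[of \<Omega>] by blast
  ultimately have \<Omega>B: "osc_controlled \<Omega> \<Omega> ?B"
    by (rule osc_controlled_mono[OF _ _ order_refl])
  have B\<Omega>: "osc_controlled \<Omega> ?B \<Omega>"
    by (rule osc_controlled_sym[OF \<Omega>b _ \<Omega>B]) simp
  have Bpos: "emeasure lborel ?B > 0"
    using b0(2) by (intro emeasure_lborel_open_pos) auto
  show ?thesis
    by (rule osc_controlled_trans[OF \<Omega>b _ \<Omega>b emeasure_lborel_bounded[OF \<Omega>(2)]
          emeasure_lborel_bounded[OF bounded_ball] emeasure_lborel_bounded[OF \<Omega>(2)] Bpos \<Omega>B B\<Omega>]) simp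
qed

section \<open>From double integrals to mean values\<close>

lemma norm_matrix_vector_mult_le: "norm (A *v z) \<le> norm A * norm z" for A :: "real^'n^'m"
proof -
  have "norm (A *v z) = L2_set (\<lambda>i. \<bar>A $ i \<bullet> z\<bar>) UNIV"
    by (simp add: norm_vec_def matrix_vector_mul_component)
  also have "\<dots> \<le> L2_set (\<lambda>i. norm (A $ i) * norm z) UNIV"
    by (intro L2_set_mono Cauchy_Schwarz_ineq2) auto
  also have "\<dots> = norm A * norm z"
    by (simp add: norm_vec_def L2_set_left_distrib)
  finally show ?thesis .
qed

lemma smooth_field_C1_bound:
  assumes "smooth_field \<phi>"
  shows "C1_bound \<phi> (\<lambda>x. norm (jacobian_matrix \<phi> x))"
proof -
  have "(\<phi> has_derivative (\<lambda>z. jacobian_matrix \<phi> x *v z)) (at x)" for x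
  proof -
    have "((\<lambda>x. \<phi> x $ i) has_derivative (\<lambda>z. (jacobian_matrix \<phi> x *v z) $ i)) (at x)" for i
      using smooth_has_derivative[of "\<lambda>x. \<phi> x $ i" x] assms
      by (simp add: smooth_field_def matrix_vector_mult_def jacobian_matrix_def)
    then show ?thesis
      by (subst has_derivative_componentwise_within)
        (auto simp: Basis_vec_def inner_axis)
  qed
  moreover have "continuous_on UNIV (\<lambda>x. norm (jacobian_matrix \<phi> x))"
    by (intro continuous_on_norm jacobian_matrix_continuous assms)
  ultimately show ?thesis
    using norm_matrix_vector_mult_le unfolding C1_bound_def by blast
qed

lemma L2_integrable:
  fixes f :: "'a::euclidean_space \<Rightarrow> 'b::euclidean_space"
  assumes "open \<Omega>" "bounded \<Omega>" "L2 \<Omega> f"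
  shows "integrable (lebesgue_on \<Omega>) f"
proof -
  have "L2 \<Omega> (\<lambda>x. norm (f x))" using assms(3) by (auto simp: L2_def)
  then have "integrable (lebesgue_on \<Omega>) (\<lambda>x. norm (f x))" by (rule L2_integrable_real[OF assms(1,2)])
  then show ?thesis using assms(3) by (simp add: integrable_norm_iff L2_def)
qed

lemma nn_integral_lebesgue_on_borel:
  fixes F :: "'a::euclidean_space \<Rightarrow> ennreal"
  assumes "open \<Omega>"
  shows "(\<integral>\<^sup>+x. F x \<partial>lebesgue_on \<Omega>) = (\<integral>\<^sup>+x. F x * indicator \<Omega> x \<partial>lborel)"
  using assms by (subst nn_integral_restrict_space) (auto simp: nn_integral_completion)

lemma energy_on_eq_l2_norm:
  assumes "open \<Omega>" "L2 \<Omega> f"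
  shows "energy_on \<Omega> (\<lambda>x. norm (f x)) = ennreal ((l2_norm \<Omega> f)\<^sup>2)"
  using nn_integral_norm_sq[OF assms(2)] nn_integral_lebesgue_on_borel[OF assms(1)] by simp

definition mean_value :: "'a::euclidean_space set \<Rightarrow> ('a \<Rightarrow> 'b::euclidean_space) \<Rightarrow> 'b" where
  "mean_value \<Omega> f = (1 / measure lebesgue \<Omega>) *\<^sub>R integral\<^sup>L (lebesgue_on \<Omega>) f"

lemma mean_value_diff:
  assumes "open \<Omega>" "bounded \<Omega>" "L2 \<Omega> f" "L2 \<Omega> g"
  shows "mean_value \<Omega> (\<lambda>x. f x - g x) = mean_value \<Omega> f - mean_value \<Omega> g"
  using assms by (simp add: mean_value_def L2_integrable scaleR_diff_right)

lemma L2_const: "open \<Omega> \<Longrightarrow> bounded \<Omega> \<Longrightarrow> L2 \<Omega> (\<lambda>x. c)"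
  by (rule continuous_L2) auto

lemma measure_open_bounded_pos:
  fixes \<Omega> :: "'a::euclidean_space set"
  assumes \<Omega>: "open \<Omega>" "bounded \<Omega>" "\<Omega> \<noteq> {}"
  shows "measure lebesgue \<Omega> > 0"
proof -
  have "emeasure lborel \<Omega> > 0" by (rule emeasure_lborel_open_pos[OF \<Omega>(1,3)])
  then have "emeasure lebesgue \<Omega> > 0" using \<Omega>(1) by simp
  moreover have "emeasure lebesgue \<Omega> < \<infinity>" using emeasure_lborel_bounded[OF \<Omega>(2)] \<Omega>(1) by simp
  ultimately show ?thesis by (auto simp: emeasure_eq_ennreal_measure)
qed

text \<open>Let \<open>g\<close> be \<open>f\<close> minus its mean. For fixed \<open>x\<close> the
  cross term of \<open>g x\<close> with \<open>g\<close> integrates to zero, so the inner integral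
  of \<open>osc2\<close> is the measure of \<open>\<Omega>\<close> times
  \<open>(norm (g x))\<^sup>2\<close> plus a nonnegative rest.\<close>

lemma osc2_ge_mean_value:
  fixes f :: "'a::euclidean_space \<Rightarrow> 'b::euclidean_space"
  assumes \<Omega>: "open \<Omega>" "bounded \<Omega>" "\<Omega> \<noteq> {}" and f: "L2 \<Omega> f"
  shows "ennreal (measure lebesgue \<Omega> * (l2_norm \<Omega> (\<lambda>x. f x - mean_value \<Omega> f))\<^sup>2) \<le> osc2 f \<Omega> \<Omega>"
proof -
  let ?M = "lebesgue_on \<Omega>" and ?m = "measure lebesgue \<Omega>"
  define c where "c = mean_value \<Omega> f"
  define g where "g x = f x - c" for x
  have g: "L2 \<Omega> g" unfolding g_def using f \<Omega> by (intro L2_diff L2_const)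
  have m: "?m > 0" by (rule measure_open_bounded_pos[OF \<Omega>])
  interpret finite_measure ?M by (rule finite_measure_lebesgue_on[OF \<Omega>(1,2)])
  have mM: "measure ?M (space ?M) = ?m"
    using \<Omega>(1) by (simp add: measure_restrict_space space_restrict_space)
  have g0: "integral\<^sup>L ?M g = 0"
  proof -
    have "integral\<^sup>L ?M g = integral\<^sup>L ?M f - ?m *\<^sub>R c"
      unfolding g_def using L2_integrable[OF \<Omega>(1,2) f] mM by simp
    then show ?thesis using m by (simp add: c_def mean_value_def)
  qed
  have row: "ennreal (?m * (norm (g x))\<^sup>2) \<le> (\<integral>\<^sup>+y. ennreal ((norm (f x - f y))\<^sup>2) * indicator \<Omega> y \<partial>lborel)" for x
  proof -
    have hc: "L2 \<Omega> (\<lambda>y. g x)" by (rule L2_const[OF \<Omega>(1,2)])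
    have "l2_inner \<Omega> (\<lambda>y. g x + (-1) *\<^sub>R g y) (\<lambda>y. g x + (-1) *\<^sub>R g y) =
        l2_inner \<Omega> (\<lambda>y. g x) (\<lambda>y. g x) + 2 * (-1) * l2_inner \<Omega> (\<lambda>y. g x) g + (-1)\<^sup>2 * l2_inner \<Omega> g g"
      by (rule l2_inner_expand[OF hc g])
    moreover have "l2_inner \<Omega> (\<lambda>y. g x) g = 0"
      using g0 L2_integrable[OF \<Omega>(1,2) g] by (simp add: l2_inner_def)
    moreover have "l2_inner \<Omega> (\<lambda>y. g x) (\<lambda>y. g x) = ?m * (norm (g x))\<^sup>2"
      using mM by (simp add: l2_inner_def power2_norm_eq_inner)
    moreover have "(\<lambda>y. g x + (-1) *\<^sub>R g y) = (\<lambda>y. f x - f y)" by (simp add: g_def)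
    ultimately have "?m * (norm (g x))\<^sup>2 \<le> (l2_norm \<Omega> (\<lambda>y. f x - f y))\<^sup>2"
      using l2_inner_self_nonneg[of \<Omega> g] by (simp add: l2_norm_sq)
    then have "ennreal (?m * (norm (g x))\<^sup>2) \<le> ennreal ((l2_norm \<Omega> (\<lambda>y. f x - f y))\<^sup>2)"
      by (rule ennreal_leI)
    also have "\<dots> = (\<integral>\<^sup>+y. ennreal ((norm (f x - f y))\<^sup>2) \<partial>?M)"
      using f \<Omega> by (intro nn_integral_norm_sq[symmetric] L2_diff L2_const)
    finally show ?thesis using nn_integral_lebesgue_on_borel[OF \<Omega>(1)] by simp
  qed
  have "ennreal (?m * (l2_norm \<Omega> g)\<^sup>2) = (\<integral>\<^sup>+x. ennreal (?m * (norm (g x))\<^sup>2) \<partial>?M)"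
    using nn_integral_norm_sq[OF g] L2_measurable[OF g] m
    by (simp add: ennreal_mult nn_integral_cmult)
  also have "\<dots> \<le> (\<integral>\<^sup>+x. (\<integral>\<^sup>+y. ennreal ((norm (f x - f y))\<^sup>2) * indicator \<Omega> y \<partial>lborel) \<partial>?M)"
    by (intro nn_integral_mono row)
  also have "\<dots> = osc2 f \<Omega> \<Omega>"
    unfolding osc2_def by (rule nn_integral_lebesgue_on_borel[OF \<Omega>(1)])
  finally show ?thesis unfolding g_def[abs_def] c_def .
qed

text \<open>Smooth fields are enough, because the approximants in \<open>has_boundary_trace\<close>
  are smooth on the whole space.\<close>

theorem poincare_smooth_field:
  fixes \<Omega> :: "(real^'d::finite) set"
  assumes \<Omega>: "open \<Omega>" "bounded \<Omega>" "connected \<Omega>" "\<Omega> \<noteq> {}" "lipschitz_boundary \<Omega>"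
  obtains C where "C \<ge> 0"
    "\<And>\<phi>. smooth_field \<phi> \<Longrightarrow> l2_norm \<Omega> (\<lambda>x. \<phi> x - mean_value \<Omega> \<phi>) \<le> C * l2_norm \<Omega> (jacobian_matrix \<phi>)"
proof -
  obtain C where C: "\<And>(f :: real^'d \<Rightarrow> real^'d) K. C1_bound f K \<Longrightarrow> osc2 f \<Omega> \<Omega> \<le> ennreal C * energy_on \<Omega> K"
    using osc_controlled_domain[OF \<Omega>] unfolding osc_controlled_def by blast
  let ?m = "measure lebesgue \<Omega>"
  have m: "?m > 0" by (rule measure_open_bounded_pos[OF \<Omega>(1,2,4)])
  define C' where "C' = sqrt (max C 0 / ?m)"
  have "l2_norm \<Omega> (\<lambda>x. \<phi> x - mean_value \<Omega> \<phi>) \<le> C' * l2_norm \<Omega> (jacobian_matrix \<phi>)"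
    if \<phi>: "smooth_field \<phi>" for \<phi>
  proof (rule power2_le_imp_le)
    let ?a = "(l2_norm \<Omega> (\<lambda>x. \<phi> x - mean_value \<Omega> \<phi>))\<^sup>2" and ?b = "(l2_norm \<Omega> (jacobian_matrix \<phi>))\<^sup>2"
    have "ennreal (?m * ?a) \<le> osc2 \<phi> \<Omega> \<Omega>"
      by (rule osc2_ge_mean_value[OF \<Omega>(1,2,4) smooth_field_H1(2)[OF \<Omega>(1,2) \<phi>]])
    also have "\<dots> \<le> ennreal C * energy_on \<Omega> (\<lambda>x. norm (jacobian_matrix \<phi> x))"
      by (rule C[OF smooth_field_C1_bound[OF \<phi>]])
    also have "\<dots> = ennreal C * ennreal ?b"
      by (simp only: energy_on_eq_l2_norm[OF \<Omega>(1) smooth_field_H1(3)[OF \<Omega>(1,2) \<phi>]])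
    also have "\<dots> \<le> ennreal (max C 0) * ennreal ?b"
      by (intro mult_right_mono ennreal_leI) auto
    also have "\<dots> = ennreal (max C 0 * ?b)" by (simp add: ennreal_mult)
    finally have "?m * ?a \<le> max C 0 * ?b" by (subst (asm) ennreal_le_iff) auto
    then show "?a \<le> (C' * l2_norm \<Omega> (jacobian_matrix \<phi>))\<^sup>2"
      using m by (simp add: C'_def power_mult_distrib field_simps)
  qed (simp add: C'_def m less_imp_le)
  moreover have "C' \<ge> 0" by (simp add: C'_def m less_imp_le)
  ultimately show ?thesis using that by blast
qed

section \<open>Traces on the Dirichlet boundary\<close>

text \<open>Provides an open set of interior points from which a piece of \<open>\<Gamma>\<close> is
  visible along one fixed direction, so that boundary values can be compared with interior values by
  line integrals.\<close>

lemma boundary_probe: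
  fixes \<Omega> :: "'a::euclidean_space set"
  assumes \<Omega>: "open \<Omega>" "lipschitz_boundary \<Omega>"
    and \<Gamma>: "openin (top_of_set (frontier \<Omega>)) \<Gamma>" "\<Gamma> \<noteq> {}"
  obtains U p z l where "open U" "U \<noteq> {}" "U \<subseteq> \<Omega>" "continuous_on UNIV p"
    "\<And>y. y \<in> U \<Longrightarrow> p y \<in> \<Gamma>" "\<And>y. y \<in> U \<Longrightarrow> 0 \<le> l y \<and> l y \<le> (1::real)"
    "\<And>y. y \<in> U \<Longrightarrow> p y = y + l y *\<^sub>R z"
    "\<And>y t. y \<in> U \<Longrightarrow> 0 < t \<Longrightarrow> t < l y \<Longrightarrow> y + t *\<^sub>R z \<in> \<Omega>"
proof -
  obtain x0 where x0: "x0 \<in> \<Gamma>" using \<Gamma>(2) by blast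
  then have xf: "x0 \<in> frontier \<Omega>" using \<Gamma>(1) openin_imp_subset by blast
  obtain r e q where r: "r > 0" and e: "norm e = 1" and cq: "continuous_on UNIV q"
    and qs: "\<And>y s. q (y + s *\<^sub>R e) = q y"
    and ch: "\<And>y. y \<in> ball x0 r \<Longrightarrow> y \<in> \<Omega> \<longleftrightarrow> q y < y \<bullet> e" and qx: "q x0 = x0 \<bullet> e"
    by (rule lipschitz_boundary_chart[OF \<Omega> xf]) blast
  have ee: "e \<bullet> e = 1" using e by (simp add: norm_eq_1)
  obtain T where T: "open T" "\<Gamma> = frontier \<Omega> \<inter> T" using \<Gamma>(1) by (auto simp: openin_open)
  then obtain \<epsilon>0 where \<epsilon>0: "\<epsilon>0 > 0" "ball x0 \<epsilon>0 \<subseteq> T" using x0 open_contains_ball by blast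
  define \<epsilon> where "\<epsilon> = min \<epsilon>0 r"
  have \<epsilon>: "\<epsilon> > 0" "ball x0 \<epsilon> \<subseteq> T" "ball x0 \<epsilon> \<subseteq> ball x0 r" using \<epsilon>0 r by (auto simp: \<epsilon>_def)
  \<comment> \<open>Projection along \<open>e\<close> onto the graph of the chart. It fixes
    \<open>x0\<close>, so by continuity it maps a small ball into \<open>ball x0 \<epsilon>\<close>,
    where all boundary points belong to \<open>\<Gamma>\<close>.\<close>
  define p where "p y = y + (q y - y \<bullet> e) *\<^sub>R e" for y
  have cp: "continuous_on UNIV p" unfolding p_def by (intro continuous_intros cq)
  have px: "p x0 = x0" by (simp add: p_def qx)
  have "open (p -` ball x0 \<epsilon>)" using cp by (intro open_vimage) auto
  moreover have "x0 \<in> p -` ball x0 \<epsilon>" using px \<epsilon> by simp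
  ultimately obtain \<delta>0 where \<delta>0: "\<delta>0 > 0" "ball x0 \<delta>0 \<subseteq> p -` ball x0 \<epsilon>" by (metis openE)
  define \<delta> where "\<delta> = min \<delta>0 \<epsilon>"
  have \<delta>: "\<delta> > 0" "ball x0 \<delta> \<subseteq> ball x0 \<epsilon>" using \<delta>0 \<epsilon> by (auto simp: \<delta>_def)
  have p\<delta>: "p y \<in> ball x0 \<epsilon>" if "y \<in> ball x0 \<delta>" for y
    using \<delta>0(2) that by (auto simp: \<delta>_def)
  define U where "U = ball x0 \<delta> \<inter> \<Omega>"
  \<comment> \<open>Both \<open>y\<close> and \<open>p y\<close> lie in the ball of radius
    \<open>\<epsilon>\<close>, so a vector of length \<open>2 * \<epsilon>\<close> pointing down to
    the graph keeps the travel time \<open>l y\<close> at most 1.\<close>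
  define z where "z = (- (2 * \<epsilon>)) *\<^sub>R e"
  define l where "l y = (y \<bullet> e - q y) / (2 * \<epsilon>)" for y
  have pl: "p y = y + l y *\<^sub>R z" for y
  proof -
    have "l y * (2 * \<epsilon>) = y \<bullet> e - q y" using \<epsilon>(1) by (simp add: l_def)
    then have "- (l y * (2 * \<epsilon>)) = q y - y \<bullet> e" by linarith
    moreover have "l y *\<^sub>R z = (- (l y * (2 * \<epsilon>))) *\<^sub>R e" by (simp add: z_def)
    ultimately show ?thesis by (simp only: p_def)
  qed
  have Uq: "q y < y \<bullet> e" if "y \<in> U" for y
  proof -
    have "y \<in> ball x0 r" "y \<in> \<Omega>" using that \<delta>(2) \<epsilon>(3) by (auto simp: U_def subset_iff)
    then show ?thesis using ch by blast
  qed
  have l1: "0 < l y \<and> l y \<le> 1" if y: "y \<in> U" for y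
  proof -
    have "dist y (p y) \<le> dist y x0 + dist x0 (p y)" by (rule dist_triangle)
    also have "\<dots> \<le> 2 * \<epsilon>" using y p\<delta>[of y] \<delta>(2) by (auto simp: U_def dist_commute)
    finally have "\<bar>q y - y \<bullet> e\<bar> \<le> 2 * \<epsilon>" using e by (simp add: p_def dist_norm)
    then show ?thesis using Uq[OF y] \<epsilon>(1) by (auto simp: l_def)
  qed
  have seg: "y + t *\<^sub>R z \<in> \<Omega>" if y: "y \<in> U" and t: "0 < t" "t < l y" for y t
  proof -
    have "y \<in> ball x0 \<epsilon>" "p y \<in> ball x0 \<epsilon>" using y \<delta>(2) p\<delta> by (auto simp: U_def)
    then have "(1 - t / l y) *\<^sub>R y + (t / l y) *\<^sub>R p y \<in> ball x0 \<epsilon>"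
      using t by (intro convexD_alt convex_ball) auto
    moreover have "(1 - t / l y) *\<^sub>R y + (t / l y) *\<^sub>R p y = y + t *\<^sub>R z"
      using t by (simp add: pl algebra_simps)
    ultimately have b: "y + t *\<^sub>R z \<in> ball x0 r" using \<epsilon>(3) by auto
    have "2 * \<epsilon> * t < y \<bullet> e - q y" using t(2) \<epsilon>(1) by (simp add: l_def field_simps)
    moreover have "q (y + t *\<^sub>R z) = q y"
      using qs[of y "t * - (2 * \<epsilon>)"] by (simp add: z_def)
    ultimately have "q (y + t *\<^sub>R z) < (y + t *\<^sub>R z) \<bullet> e"
      by (simp add: z_def inner_add_left inner_diff_left ee algebra_simps)
    then show ?thesis using ch[OF b] by blast
  qed
  have p\<Gamma>: "p y \<in> \<Gamma>" if y: "y \<in> U" for y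
  proof -
    have b: "p y \<in> ball x0 \<epsilon>" using y p\<delta> by (simp add: U_def)
    have "p y \<bullet> e = q y" by (simp add: p_def inner_add_left ee)
    moreover have "q (p y) = q y" by (simp add: p_def qs)
    ultimately have "p y \<notin> \<Omega>" using ch[of "p y"] b \<epsilon>(3) by auto
    \<comment> \<open>The foot point is the limit of an open segment inside \<open>\<Omega>\<close>;
      lying outside \<open>\<Omega>\<close> itself, it is a boundary point.\<close>
    moreover have "p y \<in> closure \<Omega>"
    proof (rule Lim_in_closed_set)
      show "closed (closure \<Omega>)" by simp
      have lim: "((\<lambda>t. y + t *\<^sub>R z) \<longlongrightarrow> y + l y *\<^sub>R z) (at_left (l y))"
        by (intro tendsto_intros)
      then show "((\<lambda>t. y + t *\<^sub>R z) \<longlongrightarrow> p y) (at_left (l y))" by (simp add: pl)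
      have "\<forall>\<^sub>F t in at_left (l y). t \<in> {0<..<l y}"
        using l1[OF y] by (intro eventually_at_left_real) auto
      then show "\<forall>\<^sub>F t in at_left (l y). y + t *\<^sub>R z \<in> closure \<Omega>"
        by eventually_elim (use seg[OF y] closure_subset in fastforce)
    qed simp
    ultimately have "p y \<in> frontier \<Omega>" using \<Omega>(1) by (simp add: frontier_def interior_open)
    then show ?thesis using T(2) b \<epsilon>(2) by auto
  qed
  have "x0 \<in> ball x0 \<delta> \<inter> closure \<Omega>" using xf \<delta>(1) by (simp add: frontier_def)
  then have "U \<noteq> {}"
    using open_Int_closure_eq_empty[of "ball x0 \<delta>" \<Omega>] unfolding U_def by blast
  then show ?thesis
    using \<Omega>(1) cp p\<Gamma> l1 pl seg by (intro that[of U p l z]) (auto simp: U_def less_imp_le)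
qed

section \<open>Surface null sets swept along a direction\<close>

text \<open>The swept set is a tube of length \<open>norm z\<close> and thickness of order
  \<open>r\<close>: about \<open>norm z / r\<close> balls of radius \<open>2 * r\<close> cover it,
  and their total volume is of order \<open>r ^ (DIM('a) - 1)\<close>, the size of \<open>C\<close>
  in the surface measure.\<close>

lemma swept_set_cover:
  fixes C :: "'a::euclidean_space set"
  assumes C: "bounded C" "diameter C \<le> r" and r: "0 < r" "r \<le> 1"
  shows "\<exists>T\<in>sets borel. {y. \<exists>s\<in>{0..1}. y + s *\<^sub>R z \<in> C} \<subseteq> T \<and>
    emeasure lborel T \<le> ennreal ((norm z + 3) * unit_ball_vol (DIM('a)) * 2 ^ DIM('a) * r ^ (DIM('a) - 1))"
proof (cases "C = {}")
  case True
  then show ?thesis by (intro bexI[of _ "{}"]) auto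
next
  case False
  then obtain c where c: "c \<in> C" by blast
  \<comment> \<open>At least \<open>norm z / r\<close> steps, so neighbouring centres are at most
    \<open>r\<close> apart; the added 1 keeps \<open>n\<close> positive when
    \<open>z = 0\<close>.\<close>
  define n where "n = nat \<lceil>norm z / r\<rceil> + 1"
  have n: "norm z / r \<le> real n" "real n \<le> norm z / r + 2" "n > 0"
  proof -
    have "0 \<le> norm z / r" using r by simp
    then have "real n = of_int \<lceil>norm z / r\<rceil> + 1" by (simp add: n_def)
    then show "norm z / r \<le> real n" "real n \<le> norm z / r + 2"
      using ceiling_correct[of "norm z / r"] by linarith+
  qed (simp add: n_def)
  \<comment> \<open>Radius \<open>2 * r\<close>: one \<open>r\<close> for the diameter of
    \<open>C\<close>, one for rounding \<open>s\<close> down to a grid point.\<close>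
  define T where "T = (\<Union>k\<le>n. cball (c - (real k / real n) *\<^sub>R z) (2 * r))"
  have "y \<in> T" if s: "s \<in> {0..1}" "y + s *\<^sub>R z \<in> C" for y s
  proof -
    define k where "k = nat \<lfloor>s * real n\<rfloor>"
    have k: "real k \<le> s * real n" "s * real n \<le> real k + 1" 
    proof -
      have "0 \<le> s * real n" using s by simp
      then have "real k = of_int \<lfloor>s * real n\<rfloor>" by (simp add: k_def)
      then show "real k \<le> s * real n" "s * real n \<le> real k + 1"
        using floor_correct[of "s * real n"] by linarith+
    qed
    have "s * real n \<le> 1 * real n" using s by (intro mult_right_mono) auto
    then have "k \<le> n" using k by linarith
    have "norm ((real k / real n - s) *\<^sub>R z) \<le> 1 / real n * norm z"
    proof -
      have "real k / real n - s = (real k - s * real n) / real n" using n(3) by (simp add: field_simps)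
      moreover have "\<bar>real k - s * real n\<bar> \<le> 1" using k by linarith
      ultimately have "\<bar>real k / real n - s\<bar> \<le> 1 / real n"
        by (simp add: abs_divide divide_right_mono)
      from mult_right_mono[OF this norm_ge_zero[of z]] show ?thesis by simp
    qed
    also have "\<dots> \<le> r" using n r by (simp add: field_simps)
    finally have d1: "norm ((real k / real n - s) *\<^sub>R z) \<le> r" .
    have d2: "norm (c - (y + s *\<^sub>R z)) \<le> r"
      using diameter_bounded_bound[OF C(1) c s(2)] C(2) by (simp add: dist_norm)
    have eq: "(c - (real k / real n) *\<^sub>R z) - y = (c - (y + s *\<^sub>R z)) - (real k / real n - s) *\<^sub>R z"
      by (simp add: algebra_simps)
    have "norm ((c - (real k / real n) *\<^sub>R z) - y) \<le> 2 * r"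
      using norm_triangle_ineq4[of "c - (y + s *\<^sub>R z)" "(real k / real n - s) *\<^sub>R z"] d1 d2
      unfolding eq by linarith
    then show ?thesis using \<open>k \<le> n\<close> unfolding T_def by (auto simp: dist_norm intro!: bexI[of _ k])
  qed
  moreover have "emeasure lborel T \<le> ennreal ((norm z + 3) * unit_ball_vol (DIM('a)) * 2 ^ DIM('a) * r ^ (DIM('a) - 1))"
  proof -
    have "emeasure lborel T \<le> (\<Sum>k\<le>n. emeasure lborel (cball (c - (real k / real n) *\<^sub>R z) (2 * r)))"
      unfolding T_def by (intro emeasure_subadditive_finite) auto
    also have "\<dots> = ennreal (real (n + 1) * (unit_ball_vol (DIM('a)) * (2 * r) ^ DIM('a)))"
      using r by (simp add: emeasure_cball ennreal_mult' ennreal_of_nat_eq_real_of_nat)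
    also have "\<dots> \<le> ennreal ((norm z + 3) * unit_ball_vol (DIM('a)) * 2 ^ DIM('a) * r ^ (DIM('a) - 1))"
    proof (rule ennreal_leI)
      \<comment> \<open>One factor of \<open>r ^ DIM('a)\<close> pays for the number of balls, and
        \<open>r \<le> 1\<close> bounds \<open>3 * r\<close>; hence the constant
        \<open>norm z + 3\<close>.\<close>
      have "real (n + 1) * r \<le> norm z + 3 * r" using n(2) r by (simp add: field_simps)
      then have nr: "real (n + 1) * r \<le> norm z + 3" using r by linarith
      have "r ^ DIM('a) = r * r ^ (DIM('a) - 1)" by (simp flip: power_Suc)
      then have "real (n + 1) * (unit_ball_vol (DIM('a)) * (2 * r) ^ DIM('a)) =
          (real (n + 1) * r) * (unit_ball_vol (DIM('a)) * 2 ^ DIM('a) * r ^ (DIM('a) - 1))"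
        by (simp add: power_mult_distrib)
      also have "\<dots> \<le> (norm z + 3) * (unit_ball_vol (DIM('a)) * 2 ^ DIM('a) * r ^ (DIM('a) - 1))"
        using r by (intro mult_right_mono nr) auto
      finally show "real (n + 1) * (unit_ball_vol (DIM('a)) * (2 * r) ^ DIM('a)) \<le>
          (norm z + 3) * unit_ball_vol (DIM('a)) * 2 ^ DIM('a) * r ^ (DIM('a) - 1)"
        by (simp add: mult.assoc)
    qed
    finally show ?thesis .
  qed
  moreover have "T \<in> sets borel" unfolding T_def by auto
  ultimately show ?thesis by (intro bexI[of _ T]) auto
qed

text \<open>Covering sets may have diameter zero, but the covering by balls needs a positive radius;
  \<open>a\<close> is the price of the enlargement.\<close>

lemma diameter_enlarge:
  fixes t :: real
  assumes "0 \<le> t" "t \<le> 1" "0 < a" "a \<le> 1" "n \<ge> 1"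
  shows "\<exists>r. 0 < r \<and> r \<le> 1 \<and> t \<le> r \<and> r ^ n \<le> t ^ n + a"
proof (cases "t = 0")
  case True
  have "a ^ n \<le> a ^ 1" using assms by (intro power_decreasing) auto
  then show ?thesis using True assms by (intro exI[of _ a]) (auto simp: power_0_left)
next
  case False
  then show ?thesis using assms by (intro exI[of _ t]) auto
qed

text \<open>Takes the place of a change of variables in the boundary chart: coverings of
  \<open>N\<close> of small surface size turn into coverings of the swept set of small
  volume.\<close>

lemma negligible_swept_set:
  fixes N :: "'a::euclidean_space set"
  assumes dim: "DIM('a) \<ge> 2" and N: "surface_outer_measure N = 0"
  shows "negligible {y. \<exists>s\<in>{0..1}. y + s *\<^sub>R z \<in> N}"
proof -
  let ?d = "DIM('a) - 1" and ?w = "unit_ball_vol (real (DIM('a) - 1))"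
  let ?Z = "\<lambda>C. {y. \<exists>s\<in>{0..1::real}. y + s *\<^sub>R z \<in> C}"
  define A where "A = (norm z + 3) * unit_ball_vol (DIM('a)) * 2 ^ DIM('a)"
  \<comment> \<open>\<open>B\<close> undoes the normalisation in
    \<open>surface_outer_measure\<close>: the power \<open>diameter (C i) ^ ?d\<close> is
    \<open>B\<close> times the summand there.\<close>
  define B where "B = 2 ^ ?d / ?w"
  have AB: "A > 0" "B > 0" by (auto simp: A_def B_def add_nonneg_pos)
  have w: "?w \<noteq> 0" using unit_ball_vol_pos[of "real (DIM('a) - 1)"] by linarith
  have cover: "\<exists>T\<in>sets borel. ?Z N \<subseteq> T \<and> emeasure lborel T \<le> ennreal (A * B * \<epsilon> + 2 * A * \<epsilon>)"
    if \<epsilon>: "0 < \<epsilon>" "\<epsilon> \<le> 1" for \<epsilon>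
  proof -
    \<comment> \<open>The supremum over \<open>\<delta>\<close> vanishes, so its member for
      \<open>\<delta> = 1\<close> does; diameters at most 1 are what the enlargement and the
      covering by balls ask for.\<close>
    let ?\<C> = "{C :: nat \<Rightarrow> 'a set. N \<subseteq> (\<Union>i. C i) \<and> (\<forall>i. bounded (C i) \<and> diameter (C i) \<le> (1::real))}"
    have "(INF C\<in>?\<C>. \<Sum>i. ennreal (?w * (diameter (C i) / 2) ^ ?d)) \<le> surface_outer_measure N"
      unfolding surface_outer_measure_def by (rule SUP_upper) simp
    then have "(INF C\<in>?\<C>. \<Sum>i. ennreal (?w * (diameter (C i) / 2) ^ ?d)) < ennreal \<epsilon>"
      using N \<epsilon> by simp
    then obtain C where C: "C \<in> ?\<C>" and sum: "(\<Sum>i. ennreal (?w * (diameter (C i) / 2) ^ ?d)) < ennreal \<epsilon>"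
      unfolding INF_less_iff by blast
    \<comment> \<open>The enlargement of the \<open>i\<close>-th set is allotted
      \<open>\<epsilon> / 2 ^ i\<close>; the allowances sum to \<open>2 * \<epsilon>\<close>, the
      origin of the term \<open>2 * A * \<epsilon>\<close>.\<close>
    have "\<exists>r. 0 < r \<and> r \<le> 1 \<and> diameter (C i) \<le> r \<and> r ^ ?d \<le> diameter (C i) ^ ?d + \<epsilon> * (1/2) ^ i" for i
    proof (rule diameter_enlarge)
      show "0 \<le> diameter (C i)" "diameter (C i) \<le> 1" using C by (auto intro: diameter_ge_0)
      show "\<epsilon> * (1/2) ^ i \<le> 1" using \<epsilon> by (intro mult_le_one power_le_one) auto
    qed (use \<epsilon> dim in auto)
    then have "\<forall>i. \<exists>r. 0 < r \<and> r \<le> 1 \<and> diameter (C i) \<le> r \<and> r ^ ?d \<le> diameter (C i) ^ ?d + \<epsilon> * (1/2) ^ i"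
      by blast
    from choice[OF this] obtain r where r: "\<And>i. 0 < r i" "\<And>i. r i \<le> 1" "\<And>i. diameter (C i) \<le> r i"
      "\<And>i. r i ^ ?d \<le> diameter (C i) ^ ?d + \<epsilon> * (1/2) ^ i" by blast
    have "\<forall>i. \<exists>T. T \<in> sets borel \<and> ?Z (C i) \<subseteq> T \<and> emeasure lborel T \<le> ennreal (A * r i ^ ?d)"
    proof
      fix i
      have "bounded (C i)" using C by blast
      from swept_set_cover[OF this r(3,1,2), of z]
      show "\<exists>T. T \<in> sets borel \<and> ?Z (C i) \<subseteq> T \<and> emeasure lborel T \<le> ennreal (A * r i ^ ?d)"
        unfolding A_def by blast
    qed
    from choice[OF this] obtain T where T: "\<And>i. T i \<in> sets borel" "\<And>i. ?Z (C i) \<subseteq> T i"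
      "\<And>i. emeasure lborel (T i) \<le> ennreal (A * r i ^ ?d)" by blast
    have "emeasure lborel (\<Union>i. T i) \<le> (\<Sum>i. emeasure lborel (T i))"
      using T(1) by (intro emeasure_subadditive_countably) auto
    also have "\<dots> \<le> (\<Sum>i. ennreal (A * B) * ennreal (?w * (diameter (C i) / 2) ^ ?d) + ennreal (A * \<epsilon>) * ennreal ((1/2) ^ i))"
    proof (rule suminf_le)
      fix i
      have d0: "0 \<le> diameter (C i)" using C by (intro diameter_ge_0) auto
      have "A * r i ^ ?d \<le> A * (diameter (C i) ^ ?d + \<epsilon> * (1/2) ^ i)"
        using r(4) AB by (intro mult_left_mono) auto
      also have "diameter (C i) ^ ?d = B * (?w * (diameter (C i) / 2) ^ ?d)"
        using w by (simp only: B_def power_divide) (simp add: field_simps)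
      also have "A * (B * (?w * (diameter (C i) / 2) ^ ?d) + \<epsilon> * (1/2) ^ i) =
          A * B * (?w * (diameter (C i) / 2) ^ ?d) + A * \<epsilon> * (1/2) ^ i"
        by (simp add: algebra_simps)
      finally have "ennreal (A * r i ^ ?d) \<le> ennreal (A * B * (?w * (diameter (C i) / 2) ^ ?d) + A * \<epsilon> * (1/2) ^ i)"
        by (rule ennreal_leI)
      also have "\<dots> = ennreal (A * B) * ennreal (?w * (diameter (C i) / 2) ^ ?d) + ennreal (A * \<epsilon>) * ennreal ((1/2) ^ i)"
        using AB \<epsilon> d0 by (simp add: ennreal_plus ennreal_mult)
      finally show "emeasure lborel (T i) \<le> ennreal (A * B) * ennreal (?w * (diameter (C i) / 2) ^ ?d) + ennreal (A * \<epsilon>) * ennreal ((1/2) ^ i)"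
        using T(3)[of i] by (rule order_trans[rotated])
    qed auto
    also have "\<dots> = ennreal (A * B) * (\<Sum>i. ennreal (?w * (diameter (C i) / 2) ^ ?d)) + ennreal (A * \<epsilon>) * (\<Sum>i. ennreal ((1/2) ^ i))"
      by (simp add: suminf_add[symmetric] del: ennreal_power)
    also have "\<dots> \<le> ennreal (A * B) * ennreal \<epsilon> + ennreal (A * \<epsilon>) * ennreal 2"
    proof (intro add_mono mult_left_mono)
      have "(\<Sum>i. ennreal ((1/2) ^ i)) = ennreal (\<Sum>i. (1/2) ^ i)"
        by (rule suminf_ennreal2) (auto intro: summable_geometric)
      then show "(\<Sum>i. ennreal ((1/2) ^ i)) \<le> ennreal 2"
        by (simp add: suminf_geometric)
    qed (use sum in auto)
    also have "\<dots> = ennreal (A * B * \<epsilon> + 2 * A * \<epsilon>)"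
      using AB \<epsilon> by (simp add: ennreal_plus ennreal_mult mult_ac)
    finally have "emeasure lborel (\<Union>i. T i) \<le> ennreal (A * B * \<epsilon> + 2 * A * \<epsilon>)" .
    moreover have "?Z N \<subseteq> (\<Union>i. T i)" using C T(2) by fastforce
    ultimately show ?thesis using T(1) by (intro bexI[of _ "\<Union>i. T i"]) auto
  qed
  show ?thesis
    unfolding negligible_outer_le
  proof (intro allI impI)
    fix e :: real assume "e > 0"
    define \<epsilon> where "\<epsilon> = min 1 (e / (A * B + 2 * A))"
    have pos: "A * B + 2 * A > 0" using AB by (simp add: add_pos_pos)
    then have \<epsilon>: "0 < \<epsilon>" "\<epsilon> \<le> 1" using \<open>e > 0\<close> by (auto simp: \<epsilon>_def)
    have "\<epsilon> \<le> e / (A * B + 2 * A)" by (simp add: \<epsilon>_def)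
    then have "\<epsilon> * (A * B + 2 * A) \<le> e" using pos by (simp only: pos_le_divide_eq)
    then have le: "A * B * \<epsilon> + 2 * A * \<epsilon> \<le> e" by (simp add: algebra_simps)
    obtain T where T: "T \<in> sets borel" "?Z N \<subseteq> T" "emeasure lborel T \<le> ennreal (A * B * \<epsilon> + 2 * A * \<epsilon>)"
      using cover[OF \<epsilon>] by blast
    then have em: "emeasure lebesgue T \<le> ennreal e"
      using ennreal_leI[OF le] by (auto intro: order_trans)
    then have "T \<in> lmeasurable" using T(1) by (auto simp: fmeasurable_def intro: le_less_trans)
    moreover from this have "measure lebesgue T \<le> e"
      using em \<open>e > 0\<close> by (simp add: emeasure_eq_measure2)
    ultimately show "\<exists>T. ?Z N \<subseteq> T \<and> T \<in> lmeasurable \<and> measure lebesgue T \<le> e"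
      using T(2) by blast
  qed
qed

section \<open>The surface measure and limits of boundary values\<close>

lemma sets_surface_measure [simp, measurable_cong]: "sets surface_measure = sets borel"
  using sets.sigma_sets_eq[of borel] by (simp add: surface_measure_def)

lemma space_surface_measure [simp]: "space surface_measure = UNIV"
  by (simp add: surface_measure_def)

text \<open>
  \<^const>\<open>measure_of\<close> returns the zero measure unless the set function is countably additive.
  Hence a single set of nonzero measure already rules out this degenerate case.
\<close>

lemma emeasure_surface_measure:
  assumes "emeasure (surface_measure :: 'a::euclidean_space measure) B \<noteq> 0" "A \<in> sets borel"
  shows "emeasure surface_measure (A :: 'a set) = surface_outer_measure A"
  using assms sets.sigma_sets_eq[of "borel :: 'a measure"]
  by (auto simp: surface_measure_def emeasure_measure_of_conv split: if_splits)

text \<open>Along a subsequence with integrals below \<open>(1/2) ^ k\<close> the sum of the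
  functions has a finite integral, so it is finite almost everywhere and its terms vanish
  there.\<close>

lemma nn_integral_tendsto_0_AE_subseq:
  fixes g :: "nat \<Rightarrow> 'a \<Rightarrow> real"
  assumes [measurable]: "\<And>n. g n \<in> borel_measurable M" and nonneg: "\<And>n x. 0 \<le> g n x"
    and lim: "(\<lambda>n. \<integral>\<^sup>+x. ennreal (g n x) \<partial>M) \<longlonglongrightarrow> 0"
  shows "\<exists>r. strict_mono r \<and> (AE x in M. (\<lambda>n. g (r n) x) \<longlonglongrightarrow> 0)"
proof -
  have "\<forall>k. \<exists>N. \<forall>n\<ge>N. (\<integral>\<^sup>+x. ennreal (g n x) \<partial>M) < ennreal ((1/2) ^ k)"
    using order_tendstoD(2)[OF lim] by (auto simp: eventually_sequentially)
  from choice[OF this] obtain N where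
    N: "\<And>k n. n \<ge> N k \<Longrightarrow> (\<integral>\<^sup>+x. ennreal (g n x) \<partial>M) < ennreal ((1/2) ^ k)" by blast
  define r where "r k = (\<Sum>i\<le>k. N i) + k" for k
  have r: "strict_mono r" by (rule strict_monoI_Suc) (simp add: r_def)
  have "N k \<le> r k" for k
    unfolding r_def using member_le_sum[of k "{..k}" N] by simp
  then have small: "(\<integral>\<^sup>+x. ennreal (g (r k) x) \<partial>M) \<le> ennreal ((1/2) ^ k)" for k
    using N by (simp add: less_imp_le)
  have "(\<integral>\<^sup>+x. (\<Sum>k. ennreal (g (r k) x)) \<partial>M) = (\<Sum>k. \<integral>\<^sup>+x. ennreal (g (r k) x) \<partial>M)"
    by (rule nn_integral_suminf) measurable
  also have "\<dots> \<le> (\<Sum>k. ennreal ((1/2) ^ k))"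
    by (intro suminf_le small) auto
  also have "\<dots> = ennreal (\<Sum>k. (1/2) ^ k)"
    by (rule suminf_ennreal2) (auto intro: summable_geometric)
  also have "\<dots> < \<infinity>" by simp
  finally have "AE x in M. (\<Sum>k. ennreal (g (r k) x)) \<noteq> \<infinity>"
    by (intro nn_integral_noteq_infinite) auto
  then have "AE x in M. (\<lambda>n. g (r n) x) \<longlonglongrightarrow> 0"
  proof eventually_elim
    case (elim x)
    then have "summable (\<lambda>k. g (r k) x)"
      using nonneg by (intro summable_suminf_not_top) auto
    then show ?case by (rule summable_LIMSEQ_zero)
  qed
  with r show ?thesis by blast
qed

text \<open>A finite lower limit keeps infinitely many \<open>c n\<close> within a fixed distance of
  the bounded sequence \<open>b\<close>; Bolzano-Weierstrass then applies.\<close>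

lemma convergent_subseq_if_liminf_finite:
  fixes b c :: "nat \<Rightarrow> 'a::euclidean_space"
  assumes b: "b \<longlonglongrightarrow> 0" and fin: "liminf (\<lambda>n. ennreal ((norm (b n - c n))\<^sup>2)) < \<infinity>"
  shows "\<exists>s a. strict_mono s \<and> (c \<circ> s) \<longlonglongrightarrow> a"
proof -
  obtain K where K: "\<And>n. norm (b n) \<le> K"
    using convergent_imp_Bseq[of b] b by (auto simp: convergent_def Bseq_def)
  obtain R0 where R0: "R0 \<ge> 0" "liminf (\<lambda>n. ennreal ((norm (b n - c n))\<^sup>2)) = ennreal R0"
    using fin by (cases "liminf (\<lambda>n. ennreal ((norm (b n - c n))\<^sup>2))") auto
  have "\<exists>\<^sub>F n in sequentially. (norm (b n - c n))\<^sup>2 < R0 + 1"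
  proof (rule ccontr)
    assume "\<not> ?thesis"
    then have "\<forall>\<^sub>F n in sequentially. R0 + 1 \<le> (norm (b n - c n))\<^sup>2"
      by (simp add: not_frequently not_less)
    then have "\<forall>\<^sub>F n in sequentially. ennreal (R0 + 1) \<le> ennreal ((norm (b n - c n))\<^sup>2)"
      by eventually_elim (rule ennreal_leI)
    then have "ennreal (R0 + 1) \<le> ennreal R0" unfolding R0(2)[symmetric] by (rule Liminf_bounded)
    then show False using R0(1) by (subst (asm) ennreal_le_iff) auto
  qed
  then have "infinite {n. (norm (b n - c n))\<^sup>2 < R0 + 1}"
    by (simp add: frequently_cofinite flip: cofinite_eq_sequentially)
  from infinite_enumerate[OF this]
  obtain s :: "nat \<Rightarrow> nat" where s: "strict_mono s" "\<And>n. (norm (b (s n) - c (s n)))\<^sup>2 < R0 + 1"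
    by blast
  have "norm (c (s n)) \<le> sqrt (R0 + 1) + K" for n
  proof -
    have "norm (b (s n) - c (s n)) \<le> sqrt (R0 + 1)"
      using s(2)[of n] by (intro real_le_rsqrt) simp
    moreover have "norm (c (s n)) \<le> norm (b (s n) - c (s n)) + norm (b (s n))"
      using norm_triangle_ineq4[of "b (s n)" "b (s n) - c (s n)"] by simp
    ultimately show ?thesis using K[of "s n"] by linarith
  qed
  then have "bounded (range (c \<circ> s))" by (auto simp: bounded_iff)
  from bounded_imp_convergent_subsequence[OF this]
  obtain a t where t: "strict_mono t" "((c \<circ> s) \<circ> t) \<longlonglongrightarrow> a" by blast
  show ?thesis
    by (rule exI[of _ "s \<circ> t"], rule exI[of _ a])
      (use t s(1) in \<open>simp add: strict_mono_o o_assoc\<close>)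
qed

text \<open>
  The boundary values along the direction of the chart are \<open>L\<^sup>2\<close>-close to the interior values
  with a bound independent of \<open>n\<close>. Since they vanish in the limit, the constants
  \<open>c n\<close> cannot escape to infinity.
\<close>

lemma constants_subconverge_by_trace:
  fixes \<Omega> \<Gamma> :: "(real^'d::finite) set" and \<phi> :: "nat \<Rightarrow> real^'d \<Rightarrow> real^'d"
  assumes dim: "CARD('d) \<ge> 2"
    and \<Omega>: "open \<Omega>" "bounded \<Omega>" "lipschitz_boundary \<Omega>"
    and \<Gamma>: "openin (top_of_set (frontier \<Omega>)) \<Gamma>" "\<Gamma> \<noteq> {}"
    and \<phi>: "\<And>n. smooth_field (\<phi> n)"
    and B: "\<And>n. l2_norm \<Omega> (\<lambda>x. \<phi> n x - c n) \<le> B" "\<And>n. l2_norm \<Omega> (jacobian_matrix (\<phi> n)) \<le> B"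
    and tr: "(\<lambda>n. \<integral>\<^sup>+x\<in>\<Gamma>. ennreal ((norm (\<phi> n x))\<^sup>2) \<partial>surface_measure) \<longlonglongrightarrow> 0"
    and pos: "emeasure surface_measure \<Gamma> \<noteq> 0"
  shows "\<exists>r a. strict_mono r \<and> (c \<circ> r) \<longlonglongrightarrow> a"
proof -
  obtain U p z l where U: "open U" "U \<noteq> {}" "U \<subseteq> \<Omega>" and cp: "continuous_on UNIV p"
    and p\<Gamma>: "\<And>y. y \<in> U \<Longrightarrow> p y \<in> \<Gamma>" and l: "\<And>y. y \<in> U \<Longrightarrow> 0 \<le> l y \<and> l y \<le> (1::real)"
    and pl: "\<And>y. y \<in> U \<Longrightarrow> p y = y + l y *\<^sub>R z"
    and seg: "\<And>y t. y \<in> U \<Longrightarrow> 0 < t \<Longrightarrow> t < l y \<Longrightarrow> y + t *\<^sub>R z \<in> \<Omega>"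
    by (rule boundary_probe[OF \<Omega>(1,3) \<Gamma>]) blast
  have c\<phi>: "continuous_on UNIV (\<phi> n)" for n by (rule smooth_field_continuous[OF \<phi>])
  have [measurable]: "\<phi> n \<in> borel_measurable borel" "p \<in> borel_measurable borel" "U \<in> sets borel" for n
    using c\<phi> cp U(1) by (auto intro: borel_measurable_continuous_onI)
  have \<Gamma>b [measurable]: "\<Gamma> \<in> sets borel"
    using \<Gamma>(1) by (auto simp: openin_open intro: borel_closed)
  have "\<exists>r. strict_mono r \<and> (AE x in surface_measure. (\<lambda>n. (norm (\<phi> (r n) x))\<^sup>2 * indicator \<Gamma> x) \<longlonglongrightarrow> 0)"
  proof (rule nn_integral_tendsto_0_AE_subseq)
    show "(\<lambda>n. \<integral>\<^sup>+x. ennreal ((norm (\<phi> n x))\<^sup>2 * indicator \<Gamma> x) \<partial>surface_measure) \<longlonglongrightarrow> 0"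
      using tr by (simp add: ennreal_mult' ennreal_indicator)
  qed auto
  then obtain r where r: "strict_mono r"
    and ae: "AE x in surface_measure. (\<lambda>n. (norm (\<phi> (r n) x))\<^sup>2 * indicator \<Gamma> x) \<longlonglongrightarrow> 0" by blast
  define N where "N = {x. \<not> (\<lambda>n. (norm (\<phi> (r n) x))\<^sup>2 * indicator \<Gamma> x) \<longlonglongrightarrow> (0::real)}"
  have Nb: "N \<in> sets borel"
  proof -
    have "{x \<in> space borel. (\<lambda>n. (norm (\<phi> (r n) x))\<^sup>2 * indicator \<Gamma> x) \<longlonglongrightarrow> (0::real)} \<in> sets borel"
      by measurable
    then have "UNIV - {x. (\<lambda>n. (norm (\<phi> (r n) x))\<^sup>2 * indicator \<Gamma> x) \<longlonglongrightarrow> (0::real)} \<in> sets borel"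
      by (intro sets.Diff) auto
    also have "UNIV - {x. (\<lambda>n. (norm (\<phi> (r n) x))\<^sup>2 * indicator \<Gamma> x) \<longlonglongrightarrow> (0::real)} = N"
      by (auto simp: N_def)
    finally show ?thesis .
  qed
  have "emeasure surface_measure N = 0"
    using ae Nb by (subst (asm) AE_iff_measurable[OF _ refl]) (auto simp: N_def)
  \<comment> \<open>\<open>pos\<close> excludes the degenerate zero measure, so vanishing
    \<open>emeasure\<close> really means a Hausdorff null set.\<close>
  then have "surface_outer_measure N = 0" using emeasure_surface_measure[OF pos Nb] by simp
  \<comment> \<open>Whenever \<open>p y \<in> N\<close> for some \<open>y\<close> in
    \<open>U\<close>, that \<open>y\<close> belongs to the swept set with \<open>s = l y\<close>; so
    almost every \<open>y\<close> in \<open>U\<close> projects to a good boundary point.\<close>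
  then have "negligible {y. \<exists>s\<in>{0..1}. y + s *\<^sub>R z \<in> N}"
    using dim by (intro negligible_swept_set) simp_all
  then have aeN: "AE y in lebesgue. y \<notin> {y. \<exists>s\<in>{0..1}. y + s *\<^sub>R z \<in> N}"
    by (intro AE_not_in) (simp add: negligible_iff_null_sets)
  let ?h = "\<lambda>n y. ennreal ((norm (\<phi> (r n) (p y) - c (r n)))\<^sup>2) * indicator U y"
  \<comment> \<open>Two contributions: the line integral from \<open>y\<close> to
    \<open>p y\<close>, bounded by the translation estimate, and the distance of the interior values
    from the constant.\<close>
  define M where "M = 2 * (ennreal ((norm z)\<^sup>2) * ennreal (B\<^sup>2)) + 2 * ennreal (B\<^sup>2)"
  have hM: "(\<integral>\<^sup>+y. ?h n y \<partial>lborel) \<le> M" for n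
  proof -
    let ?f = "\<phi> (r n)" and ?c = "c (r n)"
    have "(\<integral>\<^sup>+y. ?h n y \<partial>lborel) \<le> (\<integral>\<^sup>+y. 2 * (ennreal ((norm (?f (p y) - ?f y))\<^sup>2) * indicator U y) +
        2 * (ennreal ((norm (?f y - ?c))\<^sup>2) * indicator U y) \<partial>lborel)"
      using ennreal_norm_diff_sq_le[of "?f (p y)" ?c "?f y" for y]
      by (intro nn_integral_mono) (auto simp: indicator_def)
    also have "\<dots> = 2 * (\<integral>\<^sup>+y. ennreal ((norm (?f (p y) - ?f y))\<^sup>2) * indicator U y \<partial>lborel) +
        2 * (\<integral>\<^sup>+y. ennreal ((norm (?f y - ?c))\<^sup>2) * indicator U y \<partial>lborel)"
      by (simp add: nn_integral_add nn_integral_cmult)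
    also have "\<dots> \<le> M"
      unfolding M_def
    proof (intro add_mono mult_left_mono)
      have "(\<integral>\<^sup>+y. ennreal ((norm (?f (p y) - ?f y))\<^sup>2) * indicator U y \<partial>lborel) =
          (\<integral>\<^sup>+y. ennreal ((norm (?f (y + l y *\<^sub>R z) - ?f y))\<^sup>2) * indicator U y \<partial>lborel)"
        by (intro nn_integral_cong) (auto simp: indicator_def pl)
      also have "\<dots> \<le> ennreal ((norm z)\<^sup>2) * energy_on \<Omega> (\<lambda>x. norm (jacobian_matrix ?f x))"
        by (rule translation_estimate[OF smooth_field_C1_bound[OF \<phi>]]) (use \<Omega> l seg in auto)
      also have "energy_on \<Omega> (\<lambda>x. norm (jacobian_matrix ?f x)) = ennreal ((l2_norm \<Omega> (jacobian_matrix ?f))\<^sup>2)"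
        by (rule energy_on_eq_l2_norm[OF \<Omega>(1) smooth_field_H1(3)[OF \<Omega>(1,2) \<phi>]])
      also have "\<dots> \<le> ennreal (B\<^sup>2)" by (intro ennreal_leI power_mono B) simp
      finally show "(\<integral>\<^sup>+y. ennreal ((norm (?f (p y) - ?f y))\<^sup>2) * indicator U y \<partial>lborel) \<le>
          ennreal ((norm z)\<^sup>2) * ennreal (B\<^sup>2)" by (simp add: mult_left_mono)
      have "(\<integral>\<^sup>+y. ennreal ((norm (?f y - ?c))\<^sup>2) * indicator U y \<partial>lborel) \<le> energy_on \<Omega> (\<lambda>y. norm (?f y - ?c))"
        using U(3) by (intro nn_integral_mono) (auto simp: indicator_def)
      also have "\<dots> = ennreal ((l2_norm \<Omega> (\<lambda>y. ?f y - ?c))\<^sup>2)"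
        by (intro energy_on_eq_l2_norm \<Omega> L2_diff smooth_field_H1(2)[OF \<Omega>(1,2) \<phi>] L2_const)
      also have "\<dots> \<le> ennreal (B\<^sup>2)" by (intro ennreal_leI power_mono B) simp
      finally show "(\<integral>\<^sup>+y. ennreal ((norm (?f y - ?c))\<^sup>2) * indicator U y \<partial>lborel) \<le> ennreal (B\<^sup>2)" .
    qed auto
    finally show ?thesis .
  qed
  \<comment> \<open>Fatou trades the uniform bound on integrals for a finite lower limit at almost
    every \<open>y\<close>; a single such point is enough.\<close>
  have "(\<integral>\<^sup>+y. liminf (\<lambda>n. ?h n y) \<partial>lborel) \<le> liminf (\<lambda>n. \<integral>\<^sup>+y. ?h n y \<partial>lborel)"
    by (rule nn_integral_liminf) measurable
  also have "\<dots> \<le> limsup (\<lambda>n. \<integral>\<^sup>+y. ?h n y \<partial>lborel)"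
    by (rule Liminf_le_Limsup) simp
  also have "\<dots> \<le> M" by (intro Limsup_bounded always_eventually allI hM)
  also have "M < \<infinity>" by (simp add: M_def ennreal_mult_less_top)
  finally have "AE y in lborel. liminf (\<lambda>n. ?h n y) \<noteq> \<infinity>"
    by (intro nn_integral_noteq_infinite) auto
  from AE_completion[OF this] aeN
  have ae2: "AE y in lebesgue. liminf (\<lambda>n. ?h n y) \<noteq> \<infinity> \<and> (\<forall>s\<in>{0..1}. y + s *\<^sub>R z \<notin> N)"
    by eventually_elim blast
  \<comment> \<open>A nonempty open set is not null, so some point of \<open>U\<close> escapes both
    exceptional sets.\<close>
  have "\<exists>y\<in>U. liminf (\<lambda>n. ?h n y) \<noteq> \<infinity> \<and> (\<forall>s\<in>{0..1}. y + s *\<^sub>R z \<notin> N)"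
  proof (rule ccontr)
    assume contr: "\<not> ?thesis"
    from ae2 have "AE y in lebesgue. y \<notin> U"
      by eventually_elim (use contr in blast)
    then have "U \<in> null_sets lebesgue" using U(1) by (simp add: AE_iff_null_sets)
    then have "negligible U" by (simp add: negligible_iff_null_sets)
    then show False using open_not_negligible U by blast
  qed
  then obtain y where y: "y \<in> U" "liminf (\<lambda>n. ?h n y) \<noteq> \<infinity>" "y + l y *\<^sub>R z \<notin> N" using l by force
  have "(\<lambda>n. (norm (\<phi> (r n) (p y)))\<^sup>2) \<longlonglongrightarrow> 0"
    using y(3) p\<Gamma>[OF y(1)] pl[OF y(1)] by (simp add: N_def)
  from tendsto_real_sqrt[OF this] have "(\<lambda>n. \<phi> (r n) (p y)) \<longlonglongrightarrow> 0"
    by (simp add: tendsto_norm_zero_iff)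
  moreover have "liminf (\<lambda>n. ennreal ((norm (\<phi> (r n) (p y) - c (r n)))\<^sup>2)) < \<infinity>"
    using y(1,2) by (simp add: less_top)
  ultimately have "\<exists>s a. strict_mono s \<and> ((\<lambda>n. c (r n)) \<circ> s) \<longlonglongrightarrow> a"
    by (rule convergent_subseq_if_liminf_finite)
  then obtain s a where s: "strict_mono s" "((\<lambda>n. c (r n)) \<circ> s) \<longlonglongrightarrow> a"
    by blast
  show ?thesis
    by (rule exI[of _ "r \<circ> s"], rule exI[of _ a])
      (use s(2) strict_mono_o[OF r s(1)] in \<open>simp add: o_def\<close>)
qed

section \<open>Gradients of fields vanishing on the Dirichlet boundary\<close>

lemma H1_D_mem_H1: "v \<in> H1_D \<Omega> \<Gamma> \<Longrightarrow> H1 \<Omega> v"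
  by (simp add: H1_D_def)

lemma smooth_field_diff:
  "smooth_field \<phi> \<Longrightarrow> smooth_field \<psi> \<Longrightarrow> smooth_field (\<lambda>x. \<phi> x - \<psi> x)"
  by (simp add: smooth_field_def smooth_diff)

lemma smooth_field_add:
  "smooth_field \<phi> \<Longrightarrow> smooth_field \<psi> \<Longrightarrow> smooth_field (\<lambda>x. \<phi> x + \<psi> x)"
  by (simp add: smooth_field_def smooth_add)

lemma smooth_field_scaleR: "smooth_field \<phi> \<Longrightarrow> smooth_field (\<lambda>x. c *\<^sub>R \<phi> x)"
  by (simp add: smooth_field_def smooth_mult)

lemma smooth_field_const: "smooth_field (\<lambda>x. c)"
  by (simp add: smooth_field_def)

lemma jacobian_matrix_diff:
  assumes "smooth_field \<phi>" "smooth_field \<psi>"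
  shows "jacobian_matrix (\<lambda>x. \<phi> x - \<psi> x) x = jacobian_matrix \<phi> x - jacobian_matrix \<psi> x"
proof -
  have "partial_deriv j (\<lambda>x. (\<phi> x - \<psi> x) $ i) x =
      partial_deriv j (\<lambda>x. \<phi> x $ i) x - partial_deriv j (\<lambda>x. \<psi> x $ i) x" for i j
    using has_derivative_diff[OF smooth_has_derivative smooth_has_derivative, of "\<lambda>x. \<phi> x $ i" "\<lambda>x. \<psi> x $ i" x] assms
    by (subst partial_deriv_eq[where D="\<lambda>z. (\<Sum>j\<in>UNIV. partial_deriv j (\<lambda>x. \<phi> x $ i) x * z $ j) - (\<Sum>j\<in>UNIV. partial_deriv j (\<lambda>x. \<psi> x $ i) x * z $ j)"])
      (auto simp: smooth_field_def axis_def if_distrib cong: if_cong)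
  then show ?thesis by (simp add: jacobian_matrix_def vec_eq_iff)
qed

lemma jacobian_matrix_const: "jacobian_matrix (\<lambda>x. c) x = 0"
proof -
  have "partial_deriv j (\<lambda>x. c $ i) x = 0" for i j
    by (subst partial_deriv_eq[OF has_derivative_const]) simp
  then show ?thesis by (simp add: jacobian_matrix_def vec_eq_iff)
qed

lemma jacobian_matrix_diff_const:
  "smooth_field \<phi> \<Longrightarrow> jacobian_matrix (\<lambda>x. \<phi> x - c) = jacobian_matrix \<phi>"
  by (rule ext) (simp add: jacobian_matrix_diff smooth_field_const jacobian_matrix_const)

section \<open>Limits and linear combinations in \<open>H1_D\<close>\<close>

lemma H1_norm_smooth_diff:
  assumes \<Omega>: "open \<Omega>" "bounded \<Omega>" and "smooth_field \<phi>" "H1 \<Omega> v"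
    and G: "L2 \<Omega> G" "AE x in lebesgue_on \<Omega>. grad \<Omega> v x = G x"
  shows "H1_norm \<Omega> (\<lambda>x. \<phi> x - v x) =
    sqrt ((l2_norm \<Omega> (\<lambda>x. \<phi> x - v x))\<^sup>2 + (l2_norm \<Omega> (\<lambda>x. jacobian_matrix \<phi> x - G x))\<^sup>2)"
proof -
  note H = H1_add_scaleR[OF \<Omega> smooth_field_H1(1)[OF \<Omega> assms(3)] assms(4), of "-1"]
  have "l2_norm \<Omega> (grad \<Omega> (\<lambda>x. \<phi> x + (-1) *\<^sub>R v x)) = l2_norm \<Omega> (\<lambda>x. jacobian_matrix \<phi> x - G x)"
  proof (rule l2_norm_cong_AE)
    show "L2 \<Omega> (\<lambda>x. jacobian_matrix \<phi> x - G x)"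
      by (intro L2_diff G smooth_field_H1 \<Omega> assms)
    show "AE x in lebesgue_on \<Omega>. grad \<Omega> (\<lambda>x. \<phi> x + (-1) *\<^sub>R v x) x = jacobian_matrix \<phi> x - G x"
      using H(2) smooth_field_H1(4)[OF \<Omega> assms(3)] G(2) by eventually_elim simp
  qed (rule grad_props(1)[OF H(1)])
  then show ?thesis by (simp add: H1_norm_def)
qed

lemma tendsto_le_0:
  fixes f g :: "nat \<Rightarrow> real"
  assumes "\<And>n. 0 \<le> f n" "\<And>n. f n \<le> g n" "g \<longlonglongrightarrow> 0"
  shows "f \<longlonglongrightarrow> 0"
  by (rule tendsto_sandwich[OF _ _ tendsto_const assms(3)]) (use assms in auto)

text \<open>Both sides of the defining identity are inner products with fixed square-integrable
  fields \<open>h\<close> and \<open>k\<close>, hence continuous under the two convergences.\<close>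

lemma weak_grad_closed:
  fixes v :: "real^'d::finite \<Rightarrow> real^'d"
  assumes \<Omega>: "open \<Omega>" "bounded \<Omega>"
    and "\<And>n. L2 \<Omega> (w n)" "\<And>n. L2 \<Omega> (H n)" "\<And>n. is_weak_grad \<Omega> (w n) (H n)"
    and "L2 \<Omega> v" "L2 \<Omega> G"
    and "(\<lambda>n. l2_norm \<Omega> (\<lambda>x. w n x - v x)) \<longlonglongrightarrow> 0" "(\<lambda>n. l2_norm \<Omega> (\<lambda>x. H n x - G x)) \<longlonglongrightarrow> 0"
  shows "is_weak_grad \<Omega> v G"
  unfolding is_weak_grad_def
proof (intro allI impI)
  fix \<phi> :: "real^'d \<Rightarrow> real" and i j assume t: "test_function \<Omega> \<phi>"
  define h where "h x = partial_deriv j \<phi> x *\<^sub>R (axis i 1 :: real^'d)" for x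
  define k where "k x = \<phi> x *\<^sub>R (axis i (axis j 1) :: real^'d^'d)" for x
  have L: "L2 \<Omega> h" "L2 \<Omega> k"
    unfolding h_def k_def
    by (intro continuous_L2 \<Omega> continuous_intros smooth_continuous smooth_partial_deriv test_function_smooth[OF t])+
  have hk: "l2_inner \<Omega> u h = integral\<^sup>L (lebesgue_on \<Omega>) (\<lambda>x. u x $ i * partial_deriv j \<phi> x)"
      "l2_inner \<Omega> A k = integral\<^sup>L (lebesgue_on \<Omega>) (\<lambda>x. A x $ i $ j * \<phi> x)" for u and A :: "real^'d \<Rightarrow> real^'d^'d"
    by (simp_all add: l2_inner_def h_def k_def inner_axis mult.commute)
  have "l2_inner \<Omega> (w n) h = - l2_inner \<Omega> (H n) k" for n
    using assms(5)[of n] t by (simp add: is_weak_grad_def hk)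
  then have "(\<lambda>n. l2_inner \<Omega> (w n) h) \<longlonglongrightarrow> - l2_inner \<Omega> G k"
    using tendsto_minus[OF l2_inner_tendsto_left[OF assms(4,7) L(2) assms(9)]] by simp
  moreover have "(\<lambda>n. l2_inner \<Omega> (w n) h) \<longlonglongrightarrow> l2_inner \<Omega> v h"
    by (rule l2_inner_tendsto_left[OF assms(3,6) L(1) assms(8)])
  ultimately have "l2_inner \<Omega> v h = - l2_inner \<Omega> G k" by (rule LIMSEQ_unique[rotated])
  then show "integral\<^sup>L (lebesgue_on \<Omega>) (\<lambda>x. v x $ i * partial_deriv j \<phi> x) =
      - integral\<^sup>L (lebesgue_on \<Omega>) (\<lambda>x. G x $ i $ j * \<phi> x)" by (simp add: hk)
qed

text \<open>The approximating sequence itself identifies the weak gradient of the limit, so a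
  candidate \<open>G\<close> suffices and nothing about \<open>grad \<Omega> v\<close> has to be
  known beforehand.\<close>

lemma H1_D_limitI:
  fixes v :: "real^'d::finite \<Rightarrow> real^'d"
  assumes \<Omega>: "open \<Omega>" "bounded \<Omega>"
    and \<xi>: "\<And>n. smooth_field (\<xi> n)" and vG: "L2 \<Omega> v" "L2 \<Omega> G"
    and lim: "(\<lambda>n. l2_norm \<Omega> (\<lambda>x. \<xi> n x - v x)) \<longlonglongrightarrow> 0"
      "(\<lambda>n. l2_norm \<Omega> (\<lambda>x. jacobian_matrix (\<xi> n) x - G x)) \<longlonglongrightarrow> 0"
    and tr: "(\<lambda>n. \<integral>\<^sup>+x\<in>\<Gamma>. ennreal ((norm (\<xi> n x))\<^sup>2) \<partial>surface_measure) \<longlonglongrightarrow> 0"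
  shows "v \<in> H1_D \<Omega> \<Gamma>" "AE x in lebesgue_on \<Omega>. grad \<Omega> v x = G x"
proof -
  have wg: "is_weak_grad \<Omega> v G"
    using \<xi> by (intro weak_grad_closed[OF \<Omega> _ _ _ vG lim] smooth_field_H1 smooth_field_weak_grad \<Omega>)
  have H: "H1 \<Omega> v" using wg vG by (auto simp: H1_def)
  show gr: "AE x in lebesgue_on \<Omega>. grad \<Omega> v x = G x" by (rule grad_eq_AE[OF \<Omega> vG wg])
  have "(\<lambda>n. sqrt ((l2_norm \<Omega> (\<lambda>x. \<xi> n x - v x))\<^sup>2 + (l2_norm \<Omega> (\<lambda>x. jacobian_matrix (\<xi> n) x - G x))\<^sup>2))
      \<longlonglongrightarrow> sqrt (0\<^sup>2 + 0\<^sup>2)"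
    by (intro tendsto_intros lim)
  then have "(\<lambda>n. H1_norm \<Omega> (\<lambda>x. \<xi> n x - v x)) \<longlonglongrightarrow> 0"
    by (simp add: H1_norm_smooth_diff[OF \<Omega> \<xi> H vG(2) gr])
  then show "v \<in> H1_D \<Omega> \<Gamma>"
    using H \<xi> tr unfolding H1_D_def has_boundary_trace_def smooth_field_def by auto
qed

lemma H1_D_approx:
  assumes \<Omega>: "open \<Omega>" "bounded \<Omega>" and v: "v \<in> H1_D \<Omega> \<Gamma>"
  obtains \<xi> where "\<And>n. smooth_field (\<xi> n)"
    "(\<lambda>n. l2_norm \<Omega> (\<lambda>x. \<xi> n x - v x)) \<longlonglongrightarrow> 0"
    "(\<lambda>n. l2_norm \<Omega> (\<lambda>x. jacobian_matrix (\<xi> n) x - grad \<Omega> v x)) \<longlonglongrightarrow> 0"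
    "(\<lambda>n. \<integral>\<^sup>+x\<in>\<Gamma>. ennreal ((norm (\<xi> n x))\<^sup>2) \<partial>surface_measure) \<longlonglongrightarrow> 0"
proof -
  have H: "H1 \<Omega> v" using v by (rule H1_D_mem_H1)
  obtain \<xi> where \<xi>: "\<And>n. smooth_field (\<xi> n)" and lim: "(\<lambda>n. H1_norm \<Omega> (\<lambda>x. \<xi> n x - v x)) \<longlonglongrightarrow> 0"
    and tr: "(\<lambda>n. \<integral>\<^sup>+x\<in>\<Gamma>. ennreal ((norm (\<xi> n x))\<^sup>2) \<partial>surface_measure) \<longlonglongrightarrow> 0"
    using v unfolding H1_D_def has_boundary_trace_def smooth_field_def by auto
  have eq: "H1_norm \<Omega> (\<lambda>x. \<xi> n x - v x) =
    sqrt ((l2_norm \<Omega> (\<lambda>x. \<xi> n x - v x))\<^sup>2 + (l2_norm \<Omega> (\<lambda>x. jacobian_matrix (\<xi> n) x - grad \<Omega> v x))\<^sup>2)" for n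
    by (rule H1_norm_smooth_diff[OF \<Omega> \<xi> H grad_props(1)[OF H]]) simp
  have "(\<lambda>n. l2_norm \<Omega> (\<lambda>x. \<xi> n x - v x)) \<longlonglongrightarrow> 0"
    "(\<lambda>n. l2_norm \<Omega> (\<lambda>x. jacobian_matrix (\<xi> n) x - grad \<Omega> v x)) \<longlonglongrightarrow> 0"
    by (rule tendsto_le_0[OF _ _ lim]; simp add: eq real_le_rsqrt)+
  then show ?thesis using that[of \<xi>] \<xi> tr by blast
qed

lemma boundary_energy_measurable:
  assumes "smooth_field \<phi>"
  shows "(\<lambda>x. ennreal ((norm (\<phi> x))\<^sup>2)) \<in> borel_measurable surface_measure"
proof -
  have [measurable]: "\<phi> \<in> borel_measurable borel"
    by (rule borel_measurable_continuous_onI[OF smooth_field_continuous[OF assms]])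
  show ?thesis by measurable
qed

lemma H1_D_add_scaleR:
  fixes v w :: "real^'d::finite \<Rightarrow> real^'d"
  assumes \<Omega>: "open \<Omega>" "bounded \<Omega>" and \<Gamma> [measurable]: "\<Gamma> \<in> sets borel"
    and v: "v \<in> H1_D \<Omega> \<Gamma>" and w: "w \<in> H1_D \<Omega> \<Gamma>"
  shows "(\<lambda>x. v x + c *\<^sub>R w x) \<in> H1_D \<Omega> \<Gamma>"
proof -
  have Hv: "H1 \<Omega> v" and Hw: "H1 \<Omega> w" using v w by (auto intro: H1_D_mem_H1)
  obtain \<xi> where \<xi>: "\<And>n. smooth_field (\<xi> n)"
    "(\<lambda>n. l2_norm \<Omega> (\<lambda>x. \<xi> n x - v x)) \<longlonglongrightarrow> 0"
    "(\<lambda>n. l2_norm \<Omega> (\<lambda>x. jacobian_matrix (\<xi> n) x - grad \<Omega> v x)) \<longlonglongrightarrow> 0"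
    "(\<lambda>n. \<integral>\<^sup>+x\<in>\<Gamma>. ennreal ((norm (\<xi> n x))\<^sup>2) \<partial>surface_measure) \<longlonglongrightarrow> 0"
    by (rule H1_D_approx[OF \<Omega> v]) blast
  obtain \<psi> where \<psi>: "\<And>n. smooth_field (\<psi> n)"
    "(\<lambda>n. l2_norm \<Omega> (\<lambda>x. \<psi> n x - w x)) \<longlonglongrightarrow> 0"
    "(\<lambda>n. l2_norm \<Omega> (\<lambda>x. jacobian_matrix (\<psi> n) x - grad \<Omega> w x)) \<longlonglongrightarrow> 0"
    "(\<lambda>n. \<integral>\<^sup>+x\<in>\<Gamma>. ennreal ((norm (\<psi> n x))\<^sup>2) \<partial>surface_measure) \<longlonglongrightarrow> 0"
    by (rule H1_D_approx[OF \<Omega> w]) blast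
  let ?u = "\<lambda>x. v x + c *\<^sub>R w x" and ?\<theta> = "\<lambda>n x. \<xi> n x + c *\<^sub>R \<psi> n x"
  note Hu = H1_add_scaleR[OF \<Omega> Hv Hw, of c]
  have sm: "smooth_field (?\<theta> n)" for n by (intro smooth_field_add smooth_field_scaleR \<xi> \<psi>)
  have combine: "(\<lambda>n. l2_norm \<Omega> (\<lambda>x. a n x + c *\<^sub>R b n x)) \<longlonglongrightarrow> 0"
    if "\<And>n. L2 \<Omega> (a n)" "\<And>n. L2 \<Omega> (b n)" "(\<lambda>n. l2_norm \<Omega> (a n)) \<longlonglongrightarrow> 0" "(\<lambda>n. l2_norm \<Omega> (b n)) \<longlonglongrightarrow> 0"
    for a b :: "nat \<Rightarrow> real^'d \<Rightarrow> 'z::euclidean_space"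
  proof (rule tendsto_le_0)
    show "l2_norm \<Omega> (\<lambda>x. a n x + c *\<^sub>R b n x) \<le> l2_norm \<Omega> (a n) + \<bar>c\<bar> * l2_norm \<Omega> (b n)" for n
      using l2_norm_triangle[OF that(1)[of n] L2_scaleR[OF that(2)[of n]]] by (simp add: l2_norm_scaleR)
    show "(\<lambda>n. l2_norm \<Omega> (a n) + \<bar>c\<bar> * l2_norm \<Omega> (b n)) \<longlonglongrightarrow> 0"
      using tendsto_add[OF that(3) tendsto_mult_right_zero[OF that(4), of "\<bar>c\<bar>"]] by simp
  qed simp
  have J: "AE x in lebesgue_on \<Omega>. jacobian_matrix (?\<theta> n) x = jacobian_matrix (\<xi> n) x + c *\<^sub>R jacobian_matrix (\<psi> n) x" for n
    using H1_add_scaleR(2)[OF \<Omega> smooth_field_H1(1)[OF \<Omega> \<xi>(1)[of n]] smooth_field_H1(1)[OF \<Omega> \<psi>(1)[of n]], of c]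
      smooth_field_H1(4)[OF \<Omega> sm[of n]] smooth_field_H1(4)[OF \<Omega> \<xi>(1)[of n]] smooth_field_H1(4)[OF \<Omega> \<psi>(1)[of n]]
    by eventually_elim simp
  have L: "L2 \<Omega> (\<lambda>x. \<xi> n x - v x)" "L2 \<Omega> (\<lambda>x. \<psi> n x - w x)"
    "L2 \<Omega> (\<lambda>x. jacobian_matrix (\<xi> n) x - grad \<Omega> v x)" "L2 \<Omega> (\<lambda>x. jacobian_matrix (\<psi> n) x - grad \<Omega> w x)" for n
    by (intro L2_diff smooth_field_H1(2,3)[OF \<Omega>] \<xi> \<psi> H1_L2 Hv Hw grad_props(1))+
  have Lg: "L2 \<Omega> (\<lambda>x. grad \<Omega> v x + c *\<^sub>R grad \<Omega> w x)"
    by (intro L2_add L2_scaleR grad_props(1) Hv Hw)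
  show ?thesis
  proof (rule H1_D_limitI(1)[OF \<Omega> sm H1_L2[OF Hu(1)] Lg])
    have eq: "\<xi> n x + c *\<^sub>R \<psi> n x - (v x + c *\<^sub>R w x) = (\<xi> n x - v x) + c *\<^sub>R (\<psi> n x - w x)" for n x
      by (simp add: algebra_simps)
    show "(\<lambda>n. l2_norm \<Omega> (\<lambda>x. ?\<theta> n x - ?u x)) \<longlonglongrightarrow> 0"
      unfolding eq by (rule combine[OF L(1,2) \<xi>(2) \<psi>(2)])
    have "l2_norm \<Omega> (\<lambda>x. jacobian_matrix (?\<theta> n) x - (grad \<Omega> v x + c *\<^sub>R grad \<Omega> w x)) =
        l2_norm \<Omega> (\<lambda>x. (jacobian_matrix (\<xi> n) x - grad \<Omega> v x) + c *\<^sub>R (jacobian_matrix (\<psi> n) x - grad \<Omega> w x))" for n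
    proof (rule l2_norm_cong_AE)
      show "AE x in lebesgue_on \<Omega>. jacobian_matrix (?\<theta> n) x - (grad \<Omega> v x + c *\<^sub>R grad \<Omega> w x) =
          (jacobian_matrix (\<xi> n) x - grad \<Omega> v x) + c *\<^sub>R (jacobian_matrix (\<psi> n) x - grad \<Omega> w x)"
        using J[of n] by eventually_elim (simp add: algebra_simps)
      show "L2 \<Omega> (\<lambda>x. (jacobian_matrix (\<xi> n) x - grad \<Omega> v x) + c *\<^sub>R (jacobian_matrix (\<psi> n) x - grad \<Omega> w x))"
        by (intro L2_add L2_scaleR L)
      show "L2 \<Omega> (\<lambda>x. jacobian_matrix (?\<theta> n) x - (grad \<Omega> v x + c *\<^sub>R grad \<Omega> w x))"
        by (rule L2_diff[OF smooth_field_H1(3)[OF \<Omega> sm] Lg])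
    qed
    then show "(\<lambda>n. l2_norm \<Omega> (\<lambda>x. jacobian_matrix (?\<theta> n) x - (grad \<Omega> v x + c *\<^sub>R grad \<Omega> w x))) \<longlonglongrightarrow> 0"
      using combine[OF L(3,4) \<xi>(3) \<psi>(3)] by simp
    let ?I = "\<lambda>\<phi>. \<integral>\<^sup>+x\<in>\<Gamma>. ennreal ((norm (\<phi> x))\<^sup>2) \<partial>surface_measure"
    have le: "?I (?\<theta> n) \<le> 2 * ?I (\<xi> n) + ennreal (2 * c\<^sup>2) * ?I (\<psi> n)" for n
    proof -
      note [measurable] = boundary_energy_measurable[OF \<xi>(1)] boundary_energy_measurable[OF \<psi>(1)]
      \<comment> \<open>The quadratic triangle inequality between \<open>\<xi> n x\<close> and
        \<open>- c *\<^sub>R \<psi> n x\<close> through the intermediate point 0.\<close>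
      have "ennreal ((norm (?\<theta> n x))\<^sup>2) \<le> 2 * ennreal ((norm (\<xi> n x))\<^sup>2) + ennreal (2 * c\<^sup>2) * ennreal ((norm (\<psi> n x))\<^sup>2)" for x
        using ennreal_norm_diff_sq_le[of "\<xi> n x" "- c *\<^sub>R \<psi> n x" 0]
        by (simp add: power_mult_distrib ennreal_mult mult.assoc)
      then have "?I (?\<theta> n) \<le> (\<integral>\<^sup>+x. 2 * (ennreal ((norm (\<xi> n x))\<^sup>2) * indicator \<Gamma> x) +
          ennreal (2 * c\<^sup>2) * (ennreal ((norm (\<psi> n x))\<^sup>2) * indicator \<Gamma> x) \<partial>surface_measure)"
        by (intro nn_integral_mono) (auto simp: indicator_def)
      also have "\<dots> = 2 * ?I (\<xi> n) + ennreal (2 * c\<^sup>2) * ?I (\<psi> n)"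
        by (simp add: nn_integral_add nn_integral_cmult)
      finally show ?thesis .
    qed
    have "(\<lambda>n. 2 * ?I (\<xi> n) + ennreal (2 * c\<^sup>2) * ?I (\<psi> n)) \<longlonglongrightarrow> 2 * 0 + ennreal (2 * c\<^sup>2) * 0"
      by (intro tendsto_add ennreal_tendsto_cmult \<xi>(4) \<psi>(4)) auto
    then have "(\<lambda>n. 2 * ?I (\<xi> n) + ennreal (2 * c\<^sup>2) * ?I (\<psi> n)) \<longlonglongrightarrow> 0" by simp
    then show "(\<lambda>n. ?I (?\<theta> n)) \<longlonglongrightarrow> 0"
      by (rule tendsto_sandwich[OF _ _ tendsto_const, rotated 2]) (use le in \<open>auto intro: always_eventually\<close>)
  qed
qed

section \<open>Closedness of the gradients and orthogonal projection\<close>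

text \<open>Only gradients are assumed to converge. Subtracting mean values makes the approximants
  converge by the Poincare inequality; the difficulty is to put convergent constants back so that
  the trace condition survives.\<close>

theorem grad_H1_D_closed:
  fixes \<Omega> \<Gamma> :: "(real^'d::finite) set" and w :: "nat \<Rightarrow> real^'d \<Rightarrow> real^'d"
  assumes dim: "CARD('d) \<ge> 2"
    and \<Omega>: "open \<Omega>" "bounded \<Omega>" "connected \<Omega>" "\<Omega> \<noteq> {}" "lipschitz_boundary \<Omega>"
    and \<Gamma>: "openin (top_of_set (frontier \<Omega>)) \<Gamma>" "\<Gamma> \<noteq> {}"
    and w: "\<And>n. w n \<in> H1_D \<Omega> \<Gamma>" and G: "L2 \<Omega> G"
    and lim: "(\<lambda>n. l2_norm \<Omega> (\<lambda>x. grad \<Omega> (w n) x - G x)) \<longlonglongrightarrow> 0"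
  shows "\<exists>v\<in>H1_D \<Omega> \<Gamma>. AE x in lebesgue_on \<Omega>. grad \<Omega> v x = G x"
proof -
  note \<Omega>' = \<Omega>(1,2)
  let ?I = "\<lambda>\<phi>. \<integral>\<^sup>+x\<in>\<Gamma>. ennreal ((norm (\<phi> x))\<^sup>2) \<partial>surface_measure"
  \<comment> \<open>Diagonal choice among the approximants of each \<open>w n\<close>, by gradient
    and boundary integral alone, since the values of \<open>w n\<close> are not known to
    converge.\<close>
  have "\<forall>n. \<exists>\<phi>. smooth_field \<phi> \<and> l2_norm \<Omega> (\<lambda>x. jacobian_matrix \<phi> x - grad \<Omega> (w n) x) < 1 / real (Suc n)
      \<and> ?I \<phi> < ennreal (1 / real (Suc n))"
  proof
    fix n
    obtain \<xi> where \<xi>: "\<And>k. smooth_field (\<xi> k)"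
      "(\<lambda>k. l2_norm \<Omega> (\<lambda>x. jacobian_matrix (\<xi> k) x - grad \<Omega> (w n) x)) \<longlonglongrightarrow> 0"
      "(\<lambda>k. ?I (\<xi> k)) \<longlonglongrightarrow> 0"
      by (rule H1_D_approx[OF \<Omega>' w[of n]]) blast
    have "\<forall>\<^sub>F k in sequentially. l2_norm \<Omega> (\<lambda>x. jacobian_matrix (\<xi> k) x - grad \<Omega> (w n) x) < 1 / real (Suc n)"
      by (rule order_tendstoD(2)[OF \<xi>(2)]) simp
    moreover have "\<forall>\<^sub>F k in sequentially. ?I (\<xi> k) < ennreal (1 / real (Suc n))"
      by (rule order_tendstoD(2)[OF \<xi>(3)]) simp
    ultimately have "\<forall>\<^sub>F k in sequentially. smooth_field (\<xi> k) \<and>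
        l2_norm \<Omega> (\<lambda>x. jacobian_matrix (\<xi> k) x - grad \<Omega> (w n) x) < 1 / real (Suc n) \<and>
        ?I (\<xi> k) < ennreal (1 / real (Suc n))"
      by eventually_elim (simp add: \<xi>(1))
    from eventually_happens'[OF sequentially_bot this]
    show "\<exists>\<phi>. smooth_field \<phi> \<and> l2_norm \<Omega> (\<lambda>x. jacobian_matrix \<phi> x - grad \<Omega> (w n) x) < 1 / real (Suc n)
      \<and> ?I \<phi> < ennreal (1 / real (Suc n))" by blast
  qed
  from choice[OF this] obtain \<phi> where sm: "\<And>n. smooth_field (\<phi> n)"
    and \<phi>J: "\<And>n. l2_norm \<Omega> (\<lambda>x. jacobian_matrix (\<phi> n) x - grad \<Omega> (w n) x) < 1 / real (Suc n)"
    and \<phi>I: "\<And>n. ?I (\<phi> n) < ennreal (1 / real (Suc n))" by blast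
  let ?J = "\<lambda>n. jacobian_matrix (\<phi> n)"
  have LJ: "L2 \<Omega> (?J n)" and L\<phi>: "L2 \<Omega> (\<phi> n)" for n
    by (rule smooth_field_H1[OF \<Omega>' sm])+
  have one_over: "(\<lambda>n. 1 / real (Suc n)) \<longlonglongrightarrow> 0"
    using LIMSEQ_inverse_real_of_nat by (simp add: inverse_eq_divide)
  define a where "a n = l2_norm \<Omega> (\<lambda>x. ?J n x - G x)" for n
  have a: "a \<longlonglongrightarrow> 0"
  proof (rule tendsto_le_0)
    show "a n \<le> 1 / real (Suc n) + l2_norm \<Omega> (\<lambda>x. grad \<Omega> (w n) x - G x)" for n
      using l2_norm_triangle_diff[OF LJ[of n] grad_props(1)[OF H1_D_mem_H1[OF w[of n]]] G] \<phi>J[of n]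
      by (simp add: a_def)
    show "(\<lambda>n. 1 / real (Suc n) + l2_norm \<Omega> (\<lambda>x. grad \<Omega> (w n) x - G x)) \<longlonglongrightarrow> 0"
      using tendsto_add[OF one_over lim] by simp
  qed (simp add: a_def)
  have tr: "(\<lambda>n. ?I (\<phi> n)) \<longlonglongrightarrow> 0"
  proof (rule tendsto_sandwich[OF _ _ tendsto_const])
    show "(\<lambda>n. ennreal (1 / real (Suc n))) \<longlonglongrightarrow> 0"
      using tendsto_ennrealI[OF one_over] by simp
  qed (use \<phi>I in \<open>auto intro!: always_eventually less_imp_le\<close>)
  obtain C where C: "C \<ge> 0" and poincare: "\<And>\<phi>. smooth_field \<phi> \<Longrightarrow>
      l2_norm \<Omega> (\<lambda>x. \<phi> x - mean_value \<Omega> \<phi>) \<le> C * l2_norm \<Omega> (jacobian_matrix \<phi>)"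
    by (rule poincare_smooth_field[OF \<Omega>]) blast
  define c where "c n = mean_value \<Omega> (\<phi> n)" for n
  let ?\<psi> = "\<lambda>n x. \<phi> n x - c n"
  have L\<psi>: "L2 \<Omega> (?\<psi> n)" for n by (intro L2_diff L\<phi> L2_const \<Omega>')
  \<comment> \<open>By linearity of the mean value, the difference of two members is again a field
    minus its mean, so the Poincare inequality applies to
    \<open>\<phi> m - \<phi> n\<close>.\<close>
  have \<psi>diff: "l2_norm \<Omega> (\<lambda>x. ?\<psi> m x - ?\<psi> n x) \<le> C * a m + C * a n" for m n
  proof -
    have "(\<lambda>x. ?\<psi> m x - ?\<psi> n x) = (\<lambda>x. (\<phi> m x - \<phi> n x) - mean_value \<Omega> (\<lambda>x. \<phi> m x - \<phi> n x))"
      by (simp add: c_def mean_value_diff[OF \<Omega>' L\<phi> L\<phi>] algebra_simps)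
    then have "l2_norm \<Omega> (\<lambda>x. ?\<psi> m x - ?\<psi> n x) \<le> C * l2_norm \<Omega> (jacobian_matrix (\<lambda>x. \<phi> m x - \<phi> n x))"
      using poincare[OF smooth_field_diff[OF sm sm]] by simp
    also have "jacobian_matrix (\<lambda>x. \<phi> m x - \<phi> n x) = (\<lambda>x. ?J m x - ?J n x)"
      by (rule ext) (rule jacobian_matrix_diff[OF sm sm])
    also have "l2_norm \<Omega> (\<lambda>x. ?J m x - ?J n x) \<le> a m + a n"
      using l2_norm_triangle_diff[OF LJ G LJ, of m n] l2_norm_minus_commute[of \<Omega> "?J n" G] by (simp add: a_def)
    finally show ?thesis using C by (simp add: mult_left_mono distrib_left)
  qed
  have Ca: "(\<lambda>n. C * a n) \<longlonglongrightarrow> 0" by (rule tendsto_mult_right_zero[OF a])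
  have "\<exists>v. L2 \<Omega> v \<and> (\<lambda>n. l2_norm \<Omega> (\<lambda>x. ?\<psi> n x - v x)) \<longlonglongrightarrow> 0"
  proof (rule L2_complete[OF L\<psi>])
    fix e :: real assume "e > 0"
    then obtain N where N: "\<And>n. n \<ge> N \<Longrightarrow> C * a n < e / 2"
      using order_tendstoD(2)[OF Ca, of "e/2"] by (auto simp: eventually_sequentially)
    have "l2_norm \<Omega> (\<lambda>x. ?\<psi> m x - ?\<psi> n x) < e" if "m \<ge> N" "n \<ge> N" for m n
      using \<psi>diff[of m n] N[OF that(1)] N[OF that(2)] by linarith
    then show "\<exists>N. \<forall>m\<ge>N. \<forall>n\<ge>N. l2_norm \<Omega> (\<lambda>x. ?\<psi> m x - ?\<psi> n x) < e" by blast
  qed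
  then obtain v where v: "L2 \<Omega> v" "(\<lambda>n. l2_norm \<Omega> (\<lambda>x. ?\<psi> n x - v x)) \<longlonglongrightarrow> 0" by blast
  show ?thesis
  proof (cases "emeasure surface_measure \<Gamma> = 0")
    case True
    text \<open>The trace condition is void, so the constants can simply be subtracted.\<close>
    have \<Gamma>b: "\<Gamma> \<in> sets borel"
      using \<Gamma>(1) by (auto simp: openin_open intro: borel_closed)
    then have "AE x in surface_measure. x \<notin> \<Gamma>"
      using True by (intro AE_not_in) (simp add: null_sets_def)
    then have tr0: "?I \<theta> = 0" for \<theta> :: "real^'d \<Rightarrow> real^'d"
    proof -
      have "?I \<theta> = (\<integral>\<^sup>+x. 0 \<partial>(surface_measure :: (real^'d) measure))"
        using \<open>AE x in surface_measure. x \<notin> \<Gamma>\<close> by (intro nn_integral_cong_AE) (auto elim: eventually_mono)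
      then show ?thesis by simp
    qed
    have "(\<lambda>n. l2_norm \<Omega> (\<lambda>x. jacobian_matrix (?\<psi> n) x - G x)) \<longlonglongrightarrow> 0"
      using a by (simp add: jacobian_matrix_diff_const[OF sm] a_def[abs_def])
    note H1_D_limitI[OF \<Omega>' smooth_field_diff[OF sm smooth_field_const] v(1) G v(2) this, of \<Gamma>]
    then show ?thesis by (auto simp: tr0)
  next
    case False
    obtain A where A: "\<And>n. \<bar>a n\<bar> \<le> A" using convergent_imp_Bseq[of a] a by (auto simp: convergent_def Bseq_def)
    \<comment> \<open>The factor \<open>max 1 C\<close> lets one bound serve for the Jacobians and,
      through the Poincare inequality, for the fields minus their means.\<close>
    define B where "B = max 1 C * (A + l2_norm \<Omega> G)"
    have A0: "A \<ge> 0" using A[of 0] by linarith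
    have Jb: "l2_norm \<Omega> (?J n) \<le> A + l2_norm \<Omega> G" for n
      using l2_norm_triangle[OF L2_diff[OF LJ[of n] G] G] A[of n] by (simp add: a_def)
    have "\<exists>r b. strict_mono r \<and> (c \<circ> r) \<longlonglongrightarrow> b"
    proof (rule constants_subconverge_by_trace[OF dim \<Omega>' \<Omega>(5) \<Gamma> sm _ _ tr False])
      show "l2_norm \<Omega> (?J n) \<le> B" for n
      proof -
        have "l2_norm \<Omega> (?J n) \<le> 1 * (A + l2_norm \<Omega> G)" using Jb by simp
        also have "\<dots> \<le> B" unfolding B_def using A0 by (intro mult_right_mono) auto
        finally show ?thesis .
      qed
      show "l2_norm \<Omega> (\<lambda>x. \<phi> n x - c n) \<le> B" for n
      proof -
        have "l2_norm \<Omega> (\<lambda>x. \<phi> n x - c n) \<le> C * l2_norm \<Omega> (?J n)"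
          unfolding c_def by (rule poincare[OF sm])
        also have "\<dots> \<le> max 1 C * (A + l2_norm \<Omega> G)"
          using Jb C by (intro mult_mono) auto
        finally show ?thesis by (simp add: B_def)
      qed
    qed
    then obtain r b where r: "strict_mono r" and b: "(c \<circ> r) \<longlonglongrightarrow> b" by blast
    \<comment> \<open>Along the subsequence the unshifted approximants converge as well, and it is
      these whose boundary integrals tend to zero.\<close>
    let ?v = "\<lambda>x. v x + b"
    have Lv: "L2 \<Omega> ?v" by (intro L2_add v(1) L2_const \<Omega>')
    have lim1: "(\<lambda>n. l2_norm \<Omega> (\<lambda>x. \<phi> (r n) x - ?v x)) \<longlonglongrightarrow> 0"
    proof (rule tendsto_le_0)
      have const: "l2_norm \<Omega> (\<lambda>x. k) = sqrt (measure lebesgue \<Omega>) * norm k" for k :: "real^'d"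
      proof -
        interpret finite_measure "lebesgue_on \<Omega>" by (rule finite_measure_lebesgue_on[OF \<Omega>'])
        show ?thesis using \<Omega>(1)
          by (simp add: l2_norm_def l2_inner_def measure_restrict_space space_restrict_space
              real_sqrt_mult flip: power2_norm_eq_inner)
      qed
      show "l2_norm \<Omega> (\<lambda>x. \<phi> (r n) x - ?v x) \<le>
          l2_norm \<Omega> (\<lambda>x. ?\<psi> (r n) x - v x) + sqrt (measure lebesgue \<Omega>) * norm (c (r n) - b)" for n
      proof -
        have "(\<lambda>x. \<phi> (r n) x - ?v x) = (\<lambda>x. (?\<psi> (r n) x - v x) + (c (r n) - b))"
          by (simp add: algebra_simps)
        then show ?thesis
          using l2_norm_triangle[OF L2_diff[OF L\<psi>[of "r n"] v(1)] L2_const[OF \<Omega>', of "c (r n) - b"]]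
          by (simp add: const)
      qed
      have "(\<lambda>n. l2_norm \<Omega> (\<lambda>x. ?\<psi> (r n) x - v x)) \<longlonglongrightarrow> 0"
        using LIMSEQ_subseq_LIMSEQ[OF v(2) r] by (simp add: o_def)
      moreover have "(\<lambda>n. c (r n) - b) \<longlonglongrightarrow> 0"
        using b by (simp add: o_def LIM_zero_iff)
      ultimately show "(\<lambda>n. l2_norm \<Omega> (\<lambda>x. ?\<psi> (r n) x - v x) +
          sqrt (measure lebesgue \<Omega>) * norm (c (r n) - b)) \<longlonglongrightarrow> 0"
        using tendsto_add[OF _ tendsto_mult_right_zero[OF tendsto_norm_zero]] by fastforce
    qed simp
    have lim2: "(\<lambda>n. l2_norm \<Omega> (\<lambda>x. jacobian_matrix (\<phi> (r n)) x - G x)) \<longlonglongrightarrow> 0"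
      using LIMSEQ_subseq_LIMSEQ[OF a r] by (simp add: o_def a_def)
    have lim3: "(\<lambda>n. ?I (\<phi> (r n))) \<longlonglongrightarrow> 0"
      using LIMSEQ_subseq_LIMSEQ[OF tr r] by (simp add: o_def)
    show ?thesis
      using H1_D_limitI[OF \<Omega>' sm Lv G lim1 lim2 lim3] by blast
  qed
qed

text \<open>The projection theorem for the space of gradients, carried out on the fields: a
  minimising sequence for the distance to \<open>E\<close> has Cauchy gradients, and closedness
  provides the minimiser. The field \<open>u\<close> witnesses that the infimum is over a nonempty
  set.\<close>

lemma grad_H1_D_projection:
  fixes \<Omega> \<Gamma> :: "(real^'d::finite) set"
  assumes dim: "CARD('d) \<ge> 2"
    and \<Omega>: "open \<Omega>" "bounded \<Omega>" "connected \<Omega>" "\<Omega> \<noteq> {}" "lipschitz_boundary \<Omega>"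
    and \<Gamma>: "openin (top_of_set (frontier \<Omega>)) \<Gamma>" "\<Gamma> \<noteq> {}"
    and E: "L2 \<Omega> E" and u: "u \<in> H1_D \<Omega> \<Gamma>"
  shows "\<exists>w\<in>H1_D \<Omega> \<Gamma>. \<forall>v\<in>H1_D \<Omega> \<Gamma>. l2_inner \<Omega> (\<lambda>x. E x - grad \<Omega> w x) (grad \<Omega> v) = 0"
proof -
  note \<Omega>' = \<Omega>(1,2)
  let ?V = "H1_D \<Omega> \<Gamma>"
  have \<Gamma>b: "\<Gamma> \<in> sets borel" using \<Gamma>(1) by (auto simp: openin_open intro: borel_closed)
  have Lg: "L2 \<Omega> (grad \<Omega> w)" if "w \<in> ?V" for w by (rule grad_props(1)[OF H1_D_mem_H1[OF that]])
  have LE: "L2 \<Omega> (\<lambda>x. E x - grad \<Omega> w x)" if "w \<in> ?V" for w by (intro L2_diff E Lg that)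
  define q where "q w = l2_inner \<Omega> (\<lambda>x. E x - grad \<Omega> w x) (\<lambda>x. E x - grad \<Omega> w x)" for w
  \<comment> \<open>Along every line \<open>q\<close> is an exact quadratic; the parallelogram law
    and the Euler equation are both read off from it.\<close>
  have q_step: "q (\<lambda>x. w x + t *\<^sub>R h x) = q w - 2 * t * l2_inner \<Omega> (\<lambda>x. E x - grad \<Omega> w x) (grad \<Omega> h)
      + t\<^sup>2 * l2_inner \<Omega> (grad \<Omega> h) (grad \<Omega> h)" if w: "w \<in> ?V" and h: "h \<in> ?V" for w h t
  proof -
    let ?u = "\<lambda>x. w x + t *\<^sub>R h x"
    note H = H1_add_scaleR[OF \<Omega>' H1_D_mem_H1[OF w] H1_D_mem_H1[OF h], of t]
    have "q ?u = l2_inner \<Omega> (\<lambda>x. (E x - grad \<Omega> w x) + (- t) *\<^sub>R grad \<Omega> h x)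
        (\<lambda>x. (E x - grad \<Omega> w x) + (- t) *\<^sub>R grad \<Omega> h x)"
      unfolding q_def
    proof (rule l2_inner_cong_AE)
      show "L2 \<Omega> (\<lambda>x. E x - grad \<Omega> ?u x)" by (intro L2_diff E grad_props(1) H(1))
      then show "L2 \<Omega> (\<lambda>x. E x - grad \<Omega> ?u x)" .
      show "L2 \<Omega> (\<lambda>x. (E x - grad \<Omega> w x) + (- t) *\<^sub>R grad \<Omega> h x)"
        by (intro L2_add L2_scaleR LE Lg w h)
      then show "L2 \<Omega> (\<lambda>x. (E x - grad \<Omega> w x) + (- t) *\<^sub>R grad \<Omega> h x)" .
      show "AE x in lebesgue_on \<Omega>. E x - grad \<Omega> ?u x = (E x - grad \<Omega> w x) + (- t) *\<^sub>R grad \<Omega> h x"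
        using H(2) by eventually_elim simp
      then show "AE x in lebesgue_on \<Omega>. E x - grad \<Omega> ?u x = (E x - grad \<Omega> w x) + (- t) *\<^sub>R grad \<Omega> h x" .
    qed
    then show ?thesis using l2_inner_expand[OF LE[OF w] Lg[OF h], of "- t"] by (simp add: q_def)
  qed
  have q0: "0 \<le> q w" for w unfolding q_def by (rule l2_inner_self_nonneg)
  define \<delta> where "\<delta> = Inf (q ` ?V)"
  have bdd: "bdd_below (q ` ?V)" using q0 by (auto intro!: bdd_belowI)
  have \<delta>le: "\<delta> \<le> q w" if "w \<in> ?V" for w unfolding \<delta>_def using bdd that by (intro cInf_lower) auto
  have "\<forall>n. \<exists>w. w \<in> ?V \<and> q w < \<delta> + 1 / real (Suc n)"
  proof
    fix n
    have "\<delta> < \<delta> + 1 / real (Suc n)" by simp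
    then show "\<exists>w. w \<in> ?V \<and> q w < \<delta> + 1 / real (Suc n)"
      unfolding \<delta>_def using cInf_less_iff[OF _ bdd] u by blast
  qed
  from choice[OF this] obtain w where w: "\<And>n. w n \<in> ?V" and wq: "\<And>n. q (w n) < \<delta> + 1 / real (Suc n)" by blast
  text \<open>Expanding \<open>q\<close> along \<open>w m + t (w n - w m)\<close> for \<open>t = 1\<close> and \<open>t = 1/2\<close> gives the parallelogram law.\<close>
  have close: "(l2_norm \<Omega> (\<lambda>x. grad \<Omega> (w m) x - grad \<Omega> (w n) x))\<^sup>2 \<le> 2 / real (Suc m) + 2 / real (Suc n)" for m n
  proof -
    let ?h = "\<lambda>x. w n x + (-1) *\<^sub>R w m x"
    have h: "?h \<in> ?V" by (rule H1_D_add_scaleR[OF \<Omega>' \<Gamma>b w w])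
    let ?b = "l2_inner \<Omega> (\<lambda>x. E x - grad \<Omega> (w m) x) (grad \<Omega> ?h)" and ?g = "l2_inner \<Omega> (grad \<Omega> ?h) (grad \<Omega> ?h)"
    have "q (\<lambda>x. w m x + 1 *\<^sub>R ?h x) = q (w m) - 2 * 1 * ?b + 1\<^sup>2 * ?g" by (rule q_step[OF w h])
    then have n: "q (w n) = q (w m) - 2 * ?b + ?g" by simp
    have "\<delta> \<le> q (\<lambda>x. w m x + (1/2) *\<^sub>R ?h x)" by (intro \<delta>le H1_D_add_scaleR[OF \<Omega>' \<Gamma>b w h])
    also have "\<dots> = q (w m) - 2 * (1/2) * ?b + (1/2)\<^sup>2 * ?g" by (rule q_step[OF w h])
    finally have "?g \<le> 2 * q (w m) + 2 * q (w n) - 4 * \<delta>" using n by (simp add: power2_eq_square)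
    also have "\<dots> \<le> 2 / real (Suc m) + 2 / real (Suc n)"
      using wq[of m] wq[of n] by simp
    finally have g: "?g \<le> 2 / real (Suc m) + 2 / real (Suc n)" .
    have "l2_norm \<Omega> (grad \<Omega> ?h) = l2_norm \<Omega> (\<lambda>x. grad \<Omega> (w n) x - grad \<Omega> (w m) x)"
    proof (rule l2_norm_cong_AE)
      show "AE x in lebesgue_on \<Omega>. grad \<Omega> ?h x = grad \<Omega> (w n) x - grad \<Omega> (w m) x"
        using H1_add_scaleR(2)[OF \<Omega>' H1_D_mem_H1[OF w[of n]] H1_D_mem_H1[OF w[of m]], of "-1"]
        by eventually_elim simp
    qed (intro Lg h L2_diff w)+
    then show ?thesis
      using g l2_norm_minus_commute[of \<Omega> "grad \<Omega> (w m)" "grad \<Omega> (w n)"] by (simp add: l2_norm_sq[symmetric])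
  qed
  have "\<exists>G. L2 \<Omega> G \<and> (\<lambda>n. l2_norm \<Omega> (\<lambda>x. grad \<Omega> (w n) x - G x)) \<longlonglongrightarrow> 0"
  proof (rule L2_complete[OF Lg[OF w]])
    fix e :: real assume e: "e > 0"
    obtain N where N: "1 / real (Suc N) < e\<^sup>2 / 4"
      using e reals_Archimedean[of "e\<^sup>2 / 4"] by (auto simp: inverse_eq_divide)
    have "l2_norm \<Omega> (\<lambda>x. grad \<Omega> (w m) x - grad \<Omega> (w n) x) < e" if "m \<ge> N" "n \<ge> N" for m n
    proof (rule power2_less_imp_less)
      have "1 / real (Suc m) \<le> 1 / real (Suc N)" "1 / real (Suc n) \<le> 1 / real (Suc N)"
        using that by (auto intro!: divide_left_mono)
      then show "(l2_norm \<Omega> (\<lambda>x. grad \<Omega> (w m) x - grad \<Omega> (w n) x))\<^sup>2 < e\<^sup>2"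
        using close[of m n] N by simp
    qed (use e in simp)
    then show "\<exists>N. \<forall>m\<ge>N. \<forall>n\<ge>N. l2_norm \<Omega> (\<lambda>x. grad \<Omega> (w m) x - grad \<Omega> (w n) x) < e" by blast
  qed
  then obtain G where G: "L2 \<Omega> G" "(\<lambda>n. l2_norm \<Omega> (\<lambda>x. grad \<Omega> (w n) x - G x)) \<longlonglongrightarrow> 0" by blast
  obtain z where z: "z \<in> ?V" "AE x in lebesgue_on \<Omega>. grad \<Omega> z x = G x"
    using grad_H1_D_closed[OF dim \<Omega> \<Gamma> w G] by blast
  \<comment> \<open>The comparison runs through the square root of \<open>q\<close>, the distance to
    \<open>E\<close>, where the triangle inequality passes to the limit.\<close>
  have qz: "q z \<le> \<delta>"
  proof -
    have "l2_norm \<Omega> (\<lambda>x. E x - grad \<Omega> z x) = l2_norm \<Omega> (\<lambda>x. E x - G x)"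
    proof (rule l2_norm_cong_AE)
      show "AE x in lebesgue_on \<Omega>. E x - grad \<Omega> z x = E x - G x" using z(2) by eventually_elim simp
    qed (intro LE z L2_diff E G)+
    then have "sqrt (q z) = l2_norm \<Omega> (\<lambda>x. E x - G x)" by (simp add: q_def l2_norm_def)
    moreover have "l2_norm \<Omega> (\<lambda>x. E x - G x) \<le> sqrt (\<delta> + 1 / real (Suc n)) + l2_norm \<Omega> (\<lambda>x. grad \<Omega> (w n) x - G x)" for n
    proof -
      have "l2_norm \<Omega> (\<lambda>x. E x - grad \<Omega> (w n) x) \<le> sqrt (\<delta> + 1 / real (Suc n))"
        using wq[of n] by (simp add: q_def l2_norm_def)
      then show ?thesis using l2_norm_triangle_diff[OF E Lg[OF w] G(1), of n] by linarith
    qed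
    moreover have "(\<lambda>n. sqrt (\<delta> + 1 / real (Suc n)) + l2_norm \<Omega> (\<lambda>x. grad \<Omega> (w n) x - G x)) \<longlonglongrightarrow> sqrt (\<delta> + 0) + 0"
      using LIMSEQ_inverse_real_of_nat by (intro tendsto_intros G(2)) (simp add: inverse_eq_divide)
    ultimately have "sqrt (q z) \<le> sqrt (\<delta> + 0) + 0"
      by (intro LIMSEQ_le_const) auto
    then show ?thesis by simp
  qed
  have "l2_inner \<Omega> (\<lambda>x. E x - grad \<Omega> z x) (grad \<Omega> h) = 0" if h: "h \<in> ?V" for h
  proof -
    have "- l2_inner \<Omega> (\<lambda>x. E x - grad \<Omega> z x) (grad \<Omega> h) = 0"
    proof (rule nonneg_quadratic_linear_coeff)
      fix t
      show "0 \<le> 2 * t * - l2_inner \<Omega> (\<lambda>x. E x - grad \<Omega> z x) (grad \<Omega> h) + t\<^sup>2 * l2_inner \<Omega> (grad \<Omega> h) (grad \<Omega> h)"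
        using \<delta>le[OF H1_D_add_scaleR[OF \<Omega>' \<Gamma>b z(1) h, of t]] q_step[OF z(1) h, of t] qz by simp
    qed
    then show ?thesis by simp
  qed
  then show ?thesis using z(1) by blast
qed

section \<open>Stresses orthogonal to all gradients\<close>

text \<open>A constant sequence serves as approximation: the support lies in
  \<open>\<Omega>\<close>, which \<open>\<Gamma>\<close> does not meet, so the boundary integrals
  vanish identically.\<close>

lemma test_field_H1_D:
  fixes \<Omega> \<Gamma> :: "(real^'d::finite) set" and i :: 'd
  assumes \<Omega>: "open \<Omega>" "bounded \<Omega>" and \<Gamma>: "\<Gamma> \<inter> \<Omega> = {}" and t: "test_function \<Omega> \<phi>"
  shows "(\<lambda>x. \<phi> x *\<^sub>R axis i 1) \<in> H1_D \<Omega> \<Gamma>"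
    and "AE x in lebesgue_on \<Omega>. grad \<Omega> (\<lambda>x. \<phi> x *\<^sub>R axis i 1) x =
      (\<chi> k j. if k = i then partial_deriv j \<phi> x else 0)"
proof -
  let ?v = "\<lambda>x. \<phi> x *\<^sub>R (axis i 1 :: real^'d)"
  have sm: "smooth_field ?v"
    using test_function_smooth[OF t] by (simp add: smooth_field_def smooth_mult)
  have "?v x = 0" if "x \<in> \<Gamma>" for x
    using that \<Gamma> t closure_subset[of "{x. \<phi> x \<noteq> 0}"] by (auto simp: test_function_def)
  then have "(\<integral>\<^sup>+x\<in>\<Gamma>. ennreal ((norm (?v x))\<^sup>2) \<partial>surface_measure) = (\<integral>\<^sup>+x. 0 \<partial>(surface_measure :: (real^'d) measure))"
    by (intro nn_integral_cong) (auto simp: indicator_def)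
  then have tr: "(\<lambda>n::nat. \<integral>\<^sup>+x\<in>\<Gamma>. ennreal ((norm (?v x))\<^sup>2) \<partial>surface_measure) \<longlonglongrightarrow> 0" by simp
  have zero: "(\<lambda>n::nat. l2_norm \<Omega> (\<lambda>x. f x - f x)) \<longlonglongrightarrow> 0" for f :: "real^'d \<Rightarrow> 'z::euclidean_space"
    by (simp add: l2_norm_def)
  show "?v \<in> H1_D \<Omega> \<Gamma>"
    by (rule H1_D_limitI(1)[OF \<Omega> sm smooth_field_H1(2,3)[OF \<Omega> sm] zero zero tr])
  have "jacobian_matrix ?v x = (\<chi> k j. if k = i then partial_deriv j \<phi> x else 0)" for x
  proof -
    have "partial_deriv j (\<lambda>x. ?v x $ k) x = (if k = i then partial_deriv j \<phi> x else 0)" for k j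
    proof (cases "k = i")
      case False
      then have "(\<lambda>x. ?v x $ k) = (\<lambda>x. 0)" by (auto simp: axis_def)
      then show ?thesis using False partial_deriv_eq[OF has_derivative_const] by simp
    qed (simp add: axis_def)
    then show ?thesis by (simp add: jacobian_matrix_def)
  qed
  then show "AE x in lebesgue_on \<Omega>. grad \<Omega> ?v x = (\<chi> k j. if k = i then partial_deriv j \<phi> x else 0)"
    using smooth_field_H1(4)[OF \<Omega> sm] by simp
qed

text \<open>Testing with one component at a time reproduces the definition of the weak divergence;
  once this is zero, the Neumann condition in \<open>HN_div\<close> is the assumed orthogonality
  itself.\<close>

lemma orthogonal_imp_divergence_free:
  fixes \<Omega> \<Gamma> :: "(real^'d::finite) set"
  assumes \<Omega>: "open \<Omega>" "bounded \<Omega>" and \<Gamma>: "\<Gamma> \<inter> \<Omega> = {}" and \<sigma>: "L2 \<Omega> \<sigma>"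
    and orth: "\<And>v. v \<in> H1_D \<Omega> \<Gamma> \<Longrightarrow> l2_inner \<Omega> \<sigma> (grad \<Omega> v) = 0"
  shows "is_weak_div \<Omega> \<sigma> (\<lambda>x. 0)" "\<sigma> \<in> HN_div \<Omega> \<Gamma>"
proof -
  show wd: "is_weak_div \<Omega> \<sigma> (\<lambda>x. 0)"
    unfolding is_weak_div_def
  proof (intro allI impI)
    fix \<phi> :: "real^'d \<Rightarrow> real" and i assume t: "test_function \<Omega> \<phi>"
    let ?v = "\<lambda>x. \<phi> x *\<^sub>R (axis i 1 :: real^'d)"
    let ?J = "\<lambda>x. (\<chi> k j. if k = i then partial_deriv j \<phi> x else 0) :: real^'d^'d"
    note tf = test_field_H1_D[OF \<Omega> \<Gamma> t, of i]
    have "continuous_on UNIV ?J"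
    proof (intro continuous_on_vec_lambda)
      show "continuous_on UNIV (\<lambda>x. if k = i then partial_deriv j \<phi> x else 0)" for k j
        using smooth_continuous[OF smooth_partial_deriv[OF test_function_smooth[OF t]], of j]
        by (cases "k = i") auto
    qed
    then have LJ: "L2 \<Omega> ?J" by (rule continuous_L2[OF \<Omega>])
    have "AE x in lebesgue_on \<Omega>. ?J x = grad \<Omega> ?v x" using tf(2) by eventually_elim simp
    then have "l2_inner \<Omega> \<sigma> ?J = l2_inner \<Omega> \<sigma> (grad \<Omega> ?v)"
      using \<sigma> LJ grad_props(1)[OF H1_D_mem_H1[OF tf(1)]] by (intro l2_inner_cong_AE) simp_all
    also have "\<dots> = 0" by (rule orth[OF tf(1)])
    also have "l2_inner \<Omega> \<sigma> ?J = integral\<^sup>L (lebesgue_on \<Omega>) (\<lambda>x. \<Sum>j\<in>UNIV. \<sigma> x $ i $ j * partial_deriv j \<phi> x)"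
    proof -
      have "\<sigma> x \<bullet> ?J x = (\<Sum>j\<in>UNIV. \<sigma> x $ i $ j * partial_deriv j \<phi> x)" for x
      proof -
        have "\<sigma> x $ k \<bullet> ?J x $ k = (if k = i then (\<Sum>j\<in>UNIV. \<sigma> x $ i $ j * partial_deriv j \<phi> x) else 0)" for k
          by (simp add: inner_vec_def)
        then have "\<sigma> x \<bullet> ?J x = (\<Sum>k\<in>UNIV. if k = i then (\<Sum>j\<in>UNIV. \<sigma> x $ i $ j * partial_deriv j \<phi> x) else 0)"
          by (simp only: inner_vec_def[of "\<sigma> x" "?J x"])
        then show ?thesis by simp
      qed
      then show ?thesis by (simp only: l2_inner_def)
    qed
    finally show "integral\<^sup>L (lebesgue_on \<Omega>) (\<lambda>x. \<Sum>j\<in>UNIV. \<sigma> x $ i $ j * partial_deriv j \<phi> x) =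
        - integral\<^sup>L (lebesgue_on \<Omega>) (\<lambda>x. (0 :: real^'d) $ i * \<phi> x)" by simp
  qed
  have Hd: "Hdiv \<Omega> \<sigma>" unfolding Hdiv_def using wd \<sigma> L2_zero by blast
  have ae: "AE x in lebesgue_on \<Omega>. mat_div \<Omega> \<sigma> x = 0"
    by (rule mat_div_eq_AE[OF \<Omega> \<sigma> L2_zero wd])
  have "l2_inner \<Omega> (mat_div \<Omega> \<sigma>) v = 0" if "v \<in> H1_D \<Omega> \<Gamma>" for v
  proof -
    have Lv: "L2 \<Omega> v" by (rule H1_L2[OF H1_D_mem_H1[OF that]])
    have "l2_inner \<Omega> (mat_div \<Omega> \<sigma>) v = l2_inner \<Omega> (\<lambda>x. 0) v"
      by (rule l2_inner_cong_AE[OF mat_div_props(1)[OF Hd] L2_zero Lv Lv ae]) simp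
    then show ?thesis by simp
  qed
  then show "\<sigma> \<in> HN_div \<Omega> \<Gamma>" using Hd orth by (simp add: HN_div_def)
qed

section \<open>Strong duality\<close>

lemma inner_mat_1: "mat 1 \<bullet> A = trace A" for A :: "real^'d^'d"
proof -
  have "(mat 1 :: real^'d^'d) $ i \<bullet> A $ i = A $ i $ i" for i
    by (simp add: inner_vec_def mat_def if_distrib[of "\<lambda>c. c * _"] cong: if_cong)
  then show ?thesis by (simp add: inner_vec_def[of "mat 1"] trace_def)
qed

lemma trace_mat_1: "trace (mat 1 :: real^'d^'d) = real CARD('d)"
  by (simp add: trace_def mat_def)

lemma trace_scaleR: "trace (c *\<^sub>R A) = c * trace A" for A :: "real^'d^'d"
  by (simp add: trace_def sum_distrib_left)

lemma trace_dev: "trace (dev A) = 0"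
  by (simp add: dev_def trace_sub trace_scaleR trace_mat_1)

text \<open>The deviator differs from its argument by a multiple of the identity, whose inner
  product with \<open>B\<close> is a multiple of the trace.\<close>

lemma dev_inner: "trace B = 0 \<Longrightarrow> dev A \<bullet> B = A \<bullet> B"
  by (simp add: dev_def inner_diff_left inner_mat_1)

lemma bounded_linear_dev: "bounded_linear (dev :: real^'d^'d \<Rightarrow> real^'d::finite^'d)"
proof -
  have "linear (dev :: real^'d^'d \<Rightarrow> real^'d^'d)"
    by (rule linearI) (simp_all add: dev_def trace_add trace_scaleR algebra_simps add_divide_distrib)
  then show ?thesis by (simp add: linear_linear)
qed

lemma dev_add_scaleR: "dev (A + c *\<^sub>R B) = dev A + c *\<^sub>R dev B"
  by (simp add: linear_add[OF bounded_linear.linear[OF bounded_linear_dev]]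
      linear_scale[OF bounded_linear.linear[OF bounded_linear_dev]])

lemma L2_dev: "L2 \<Omega> \<tau> \<Longrightarrow> L2 \<Omega> (\<lambda>x. dev (\<tau> x))"
  by (rule L2_linear[OF bounded_linear_dev])

lemma l2_inner_dev:
  assumes "L2 \<Omega> \<tau>" "L2 \<Omega> B" "AE x in lebesgue_on \<Omega>. trace (B x) = 0"
  shows "l2_inner \<Omega> (\<lambda>x. dev (\<tau> x)) B = l2_inner \<Omega> \<tau> B"
  unfolding l2_inner_def
proof (rule integral_cong_AE)
  show "AE x in lebesgue_on \<Omega>. dev (\<tau> x) \<bullet> B x = \<tau> x \<bullet> B x"
    using assms(3) by eventually_elim (rule dev_inner)
qed (use L2_inner_integrable[OF assms(1,2)] L2_inner_integrable[OF L2_dev[OF assms(1)] assms(2)] in auto)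

lemma K_T_L2: "L2 \<Omega> F \<Longrightarrow> \<tau> \<in> K_T \<Omega> \<Gamma> f F \<Longrightarrow> L2 \<Omega> \<tau>"
  using L2_add[of \<Omega> "\<lambda>x. \<tau> x - F x" F] by (auto simp: K_T_def HN_div_def Hdiv_def)

text \<open>The Neumann condition for \<open>\<tau> - F\<close> tested with \<open>v\<close>, after
  its divergence is replaced by \<open>- f\<close>. Every admissible stress thus represents the load
  on all of \<open>H1_D\<close>.\<close>

lemma load_eq_stress_power:
  assumes "L2 \<Omega> f" "L2 \<Omega> F" and \<tau>: "\<tau> \<in> K_T \<Omega> \<Gamma> f F" and v: "v \<in> H1_D \<Omega> \<Gamma>"
  shows "load \<Omega> f F v = l2_inner \<Omega> \<tau> (grad \<Omega> v)"
proof -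
  have Lv: "L2 \<Omega> v" and Lg: "L2 \<Omega> (grad \<Omega> v)"
    using H1_D_mem_H1[OF v] by (auto intro: H1_L2 grad_props(1))
  have Hd: "Hdiv \<Omega> (\<lambda>x. \<tau> x - F x)" using \<tau> by (simp add: K_T_def HN_div_def)
  have "AE x in lebesgue_on \<Omega>. mat_div \<Omega> (\<lambda>x. \<tau> x - F x) x = - f x" using \<tau> by (simp add: K_T_def)
  then have "l2_inner \<Omega> (mat_div \<Omega> (\<lambda>x. \<tau> x - F x)) v = l2_inner \<Omega> (\<lambda>x. (-1) *\<^sub>R f x) v"
    using assms(1) by (intro l2_inner_cong_AE mat_div_props(1)[OF Hd] Lv) (auto intro: L2_minus)
  moreover have "l2_inner \<Omega> (\<lambda>x. \<tau> x - F x) (grad \<Omega> v) + l2_inner \<Omega> (mat_div \<Omega> (\<lambda>x. \<tau> x - F x)) v = 0"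
    using \<tau> v by (simp add: K_T_def HN_div_def)
  ultimately have "l2_inner \<Omega> \<tau> (grad \<Omega> v) - l2_inner \<Omega> F (grad \<Omega> v) - l2_inner \<Omega> f v = 0"
    using l2_inner_diff_left[OF K_T_L2[OF assms(2) \<tau>] assms(2) Lg] l2_inner_scaleR_left[of \<Omega> "-1" f v] by simp
  then show ?thesis by (simp add: load_def)
qed

text \<open>Supplies the directions in which the dual maximiser is varied; they may have any
  trace.\<close>

lemma K_T_add_divergence_free:
  assumes \<Omega>: "open \<Omega>" "bounded \<Omega>" and \<tau>: "\<tau> \<in> K_T \<Omega> \<Gamma> f F" and \<sigma>: "L2 \<Omega> \<sigma>" "is_weak_div \<Omega> \<sigma> (\<lambda>x. 0)"
    and orth: "\<And>v. v \<in> H1_D \<Omega> \<Gamma> \<Longrightarrow> l2_inner \<Omega> \<sigma> (grad \<Omega> v) = 0"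
  shows "(\<lambda>x. \<tau> x + t *\<^sub>R \<sigma> x) \<in> K_T \<Omega> \<Gamma> f F"
proof -
  let ?\<rho> = "\<lambda>x. \<tau> x - F x" and ?\<mu> = "\<lambda>x. (\<tau> x - F x) + t *\<^sub>R \<sigma> x"
  have Hd: "Hdiv \<Omega> ?\<rho>" and L: "L2 \<Omega> ?\<rho>" using \<tau> by (auto simp: K_T_def HN_div_def Hdiv_def)
  have L\<mu>: "L2 \<Omega> ?\<mu>" by (intro L2_add L2_scaleR L \<sigma>)
  have wd: "is_weak_div \<Omega> ?\<mu> (\<lambda>x. mat_div \<Omega> ?\<rho> x + t *\<^sub>R 0)"
    by (rule weak_div_add_scaleR[OF \<Omega> L \<sigma>(1) mat_div_props(1)[OF Hd] L2_zero mat_div_props(2)[OF Hd] \<sigma>(2)])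
  then have wd: "is_weak_div \<Omega> ?\<mu> (mat_div \<Omega> ?\<rho>)" by simp
  have Hd\<mu>: "Hdiv \<Omega> ?\<mu>" using L\<mu> wd mat_div_props(1)[OF Hd] by (auto simp: Hdiv_def)
  have ae: "AE x in lebesgue_on \<Omega>. mat_div \<Omega> ?\<mu> x = mat_div \<Omega> ?\<rho> x"
    by (rule mat_div_eq_AE[OF \<Omega> L\<mu> mat_div_props(1)[OF Hd] wd])
  have "l2_inner \<Omega> ?\<mu> (grad \<Omega> v) + l2_inner \<Omega> (mat_div \<Omega> ?\<mu>) v = 0" if v: "v \<in> H1_D \<Omega> \<Gamma>" for v
  proof -
    have Lv: "L2 \<Omega> v" and Lg: "L2 \<Omega> (grad \<Omega> v)"
      using H1_D_mem_H1[OF v] by (auto intro: H1_L2 grad_props(1))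
    have "l2_inner \<Omega> (mat_div \<Omega> ?\<mu>) v = l2_inner \<Omega> (mat_div \<Omega> ?\<rho>) v"
      by (rule l2_inner_cong_AE[OF mat_div_props(1)[OF Hd\<mu>] mat_div_props(1)[OF Hd] Lv Lv ae]) simp
    moreover have "l2_inner \<Omega> ?\<mu> (grad \<Omega> v) = l2_inner \<Omega> ?\<rho> (grad \<Omega> v)"
      using l2_inner_add_left[OF L L2_scaleR[OF \<sigma>(1)] Lg, of t] orth[OF v] by (simp add: l2_inner_scaleR_left)
    ultimately show ?thesis using \<tau> v by (simp add: K_T_def HN_div_def)
  qed
  then have "?\<mu> \<in> HN_div \<Omega> \<Gamma>" using Hd\<mu> by (simp add: HN_div_def)
  moreover have "AE x in lebesgue_on \<Omega>. mat_div \<Omega> ?\<mu> x = - f x"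
  proof -
    have "AE x in lebesgue_on \<Omega>. mat_div \<Omega> ?\<rho> x = - f x" using \<tau> by (simp add: K_T_def)
    with ae show ?thesis by eventually_elim simp
  qed
  moreover have "?\<mu> = (\<lambda>x. (\<tau> x + t *\<^sub>R \<sigma> x) - F x)" by (simp add: algebra_simps)
  ultimately show ?thesis by (simp add: K_T_def)
qed

lemma K_u_add_scaleR:
  assumes \<Omega>: "open \<Omega>" "bounded \<Omega>" and \<Gamma>: "\<Gamma> \<in> sets borel"
    and u: "u \<in> K_u \<Omega> \<Gamma>" and w: "w \<in> K_u \<Omega> \<Gamma>"
  shows "(\<lambda>x. u x + t *\<^sub>R w x) \<in> K_u \<Omega> \<Gamma>"
proof -
  have m: "u \<in> H1_D \<Omega> \<Gamma>" "w \<in> H1_D \<Omega> \<Gamma>" using u w by (auto simp: K_u_def)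
  have "AE x in lebesgue_on \<Omega>. trace (grad \<Omega> u x) = 0" "AE x in lebesgue_on \<Omega>. trace (grad \<Omega> w x) = 0"
    using u w by (auto simp: K_u_def vec_div_def)
  with H1_add_scaleR(2)[OF \<Omega> H1_D_mem_H1[OF m(1)] H1_D_mem_H1[OF m(2)], of t]
  have "AE x in lebesgue_on \<Omega>. vec_div \<Omega> (\<lambda>x. u x + t *\<^sub>R w x) x = 0"
    by eventually_elim (simp add: vec_div_def trace_add trace_scaleR)
  then show ?thesis using H1_D_add_scaleR[OF \<Omega> \<Gamma> m] by (simp add: K_u_def)
qed

theorem strong_duality:
  fixes \<Omega> \<Gamma>D \<Gamma>N :: "(real^'d::finite) set"
  assumes dim: "CARD('d) \<ge> 2"
    and dom: "bounded_polyhedral_lipschitz_domain \<Omega>"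
    and part: "boundary_partition \<Omega> \<Gamma>D \<Gamma>N"
    and \<nu>: "\<nu> > 0"
    and uD: "H1 \<Omega> uD" "AE x in lebesgue_on \<Omega>. vec_div \<Omega> uD x = 0"
    and f: "L2 \<Omega> f" and F: "L2 \<Omega> F"
    and u: "is_arg_min (primal_energy \<Omega> \<nu> uD f F) (\<lambda>w. w \<in> K_u \<Omega> \<Gamma>D) u"
    and T: "is_arg_max (dual_energy \<Omega> \<nu> uD) (\<lambda>\<sigma>. \<sigma> \<in> K_T \<Omega> \<Gamma>D f F) T"
  shows "primal_energy \<Omega> \<nu> uD f F u = dual_energy \<Omega> \<nu> uD T"
proof -
  have \<Omega>: "open \<Omega>" "bounded \<Omega>" "connected \<Omega>" "\<Omega> \<noteq> {}" "lipschitz_boundary \<Omega>"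
    using dom by (auto simp: bounded_polyhedral_lipschitz_domain_def)
  note \<Omega>' = \<Omega>(1,2)
  have \<Gamma>: "openin (top_of_set (frontier \<Omega>)) \<Gamma>D" "\<Gamma>D \<noteq> {}" using part by (auto simp: boundary_partition_def)
  have \<Gamma>b: "\<Gamma>D \<in> sets borel" using \<Gamma>(1) by (auto simp: openin_open intro: borel_closed)
  have \<Gamma>\<Omega>: "\<Gamma>D \<inter> \<Omega> = {}"
    using openin_imp_subset[OF \<Gamma>(1)] \<Omega>(1) by (auto simp: frontier_def interior_open)
  let ?I = "primal_energy \<Omega> \<nu> uD f F" and ?D = "dual_energy \<Omega> \<nu> uD"
  let ?ip = "l2_inner \<Omega>"
  have uK: "u \<in> K_u \<Omega> \<Gamma>D" and umin: "\<And>w. w \<in> K_u \<Omega> \<Gamma>D \<Longrightarrow> ?I u \<le> ?I w"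
    using u by (auto simp: is_arg_min_def not_less)
  have TK: "T \<in> K_T \<Omega> \<Gamma>D f F" and Tmax: "\<And>\<sigma>. \<sigma> \<in> K_T \<Omega> \<Gamma>D f F \<Longrightarrow> ?D \<sigma> \<le> ?D T"
    using T by (auto simp: is_arg_max_def not_less)
  have KV: "w \<in> H1_D \<Omega> \<Gamma>D" if "w \<in> K_u \<Omega> \<Gamma>D" for w using that by (simp add: K_u_def)
  have KH: "H1 \<Omega> w" if "w \<in> K_u \<Omega> \<Gamma>D" for w by (rule H1_D_mem_H1[OF KV[OF that]])
  have Ktr: "AE x in lebesgue_on \<Omega>. trace (grad \<Omega> w x) = 0" if "w \<in> K_u \<Omega> \<Gamma>D" for w
    using that by (simp add: K_u_def vec_div_def)
  have uDtr: "AE x in lebesgue_on \<Omega>. trace (grad \<Omega> uD x) = 0" using uD(2) by (simp add: vec_div_def)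
  have LT: "L2 \<Omega> T" by (rule K_T_L2[OF F TK])
  define b where "b x = dev (T x)" for x
  have Lb: "L2 \<Omega> b" unfolding b_def by (rule L2_dev[OF LT])
  define g where "g x = grad \<Omega> u x + grad \<Omega> uD x" for x
  have LuD: "L2 \<Omega> (grad \<Omega> uD)" by (rule grad_props(1)[OF uD(1)])
  have Lu: "L2 \<Omega> (grad \<Omega> u)" by (rule grad_props(1)[OF KH[OF uK]])
  have Lg: "L2 \<Omega> g" unfolding g_def by (rule L2_add[OF Lu LuD])
  \<comment> \<open>Gradients of divergence-free fields do not see the trace of the stress, so the
    load in the primal energy is expressed by the same \<open>b\<close> that enters the dual
    energy.\<close>
  have load_K: "load \<Omega> f F w = ?ip b (grad \<Omega> w)" if w: "w \<in> K_u \<Omega> \<Gamma>D" for w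
    using load_eq_stress_power[OF f F TK KV[OF w]] l2_inner_dev[OF LT grad_props(1)[OF KH[OF w]] Ktr[OF w]]
    by (simp add: b_def[abs_def])
  have I_step: "?I (\<lambda>x. u x + t *\<^sub>R w x) = \<nu> / 2 * (?ip g g + 2 * t * ?ip g (grad \<Omega> w) + t\<^sup>2 * ?ip (grad \<Omega> w) (grad \<Omega> w))
      - (?ip b (grad \<Omega> u) + t * ?ip b (grad \<Omega> w))" if w: "w \<in> K_u \<Omega> \<Gamma>D" for w t
  proof -
    let ?v = "\<lambda>x. u x + t *\<^sub>R w x"
    have vK: "?v \<in> K_u \<Omega> \<Gamma>D" by (rule K_u_add_scaleR[OF \<Omega>' \<Gamma>b uK w])
    note Hv = H1_add_scaleR[OF \<Omega>' KH[OF uK] KH[OF w], of t]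
    note HvD = H1_add_scaleR[OF \<Omega>' KH[OF vK] uD(1), of 1]
    have Lw: "L2 \<Omega> (grad \<Omega> w)" by (rule grad_props(1)[OF KH[OF w]])
    have "l2_norm \<Omega> (grad \<Omega> (\<lambda>x. ?v x + uD x)) = l2_norm \<Omega> (\<lambda>x. g x + t *\<^sub>R grad \<Omega> w x)"
    proof (rule l2_norm_cong_AE)
      show "L2 \<Omega> (grad \<Omega> (\<lambda>x. ?v x + uD x))" using grad_props(1)[OF HvD(1)] by simp
      show "L2 \<Omega> (\<lambda>x. g x + t *\<^sub>R grad \<Omega> w x)" by (intro L2_add L2_scaleR Lg Lw)
      show "AE x in lebesgue_on \<Omega>. grad \<Omega> (\<lambda>x. ?v x + uD x) x = g x + t *\<^sub>R grad \<Omega> w x"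
        using Hv(2) HvD(2) by eventually_elim (simp add: g_def algebra_simps)
    qed
    then have 1: "(l2_norm \<Omega> (grad \<Omega> (\<lambda>x. ?v x + uD x)))\<^sup>2 =
        ?ip g g + 2 * t * ?ip g (grad \<Omega> w) + t\<^sup>2 * ?ip (grad \<Omega> w) (grad \<Omega> w)"
      using l2_inner_expand[OF Lg Lw, of t] by (simp add: l2_norm_sq)
    have "?ip b (grad \<Omega> ?v) = ?ip b (\<lambda>x. grad \<Omega> u x + t *\<^sub>R grad \<Omega> w x)"
      by (rule l2_inner_cong_AE[OF Lb Lb grad_props(1)[OF KH[OF vK]] L2_add[OF Lu L2_scaleR[OF Lw]] _ Hv(2)]) simp
    also have "\<dots> = ?ip b (grad \<Omega> u) + t * ?ip b (grad \<Omega> w)"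
      by (simp add: l2_inner_add_right[OF Lu L2_scaleR[OF Lw] Lb] l2_inner_scaleR_right)
    finally show ?thesis using 1 load_K[OF vK] by (simp add: primal_energy_def)
  qed
  have Iu: "?I u = \<nu> / 2 * ?ip g g - ?ip b (grad \<Omega> u)"
    using I_step[OF uK, of 0] by simp
  \<comment> \<open>First variation of the primal energy at \<open>u\<close>, read off from the
    exact quadratic \<open>I_step\<close>; the halving inside only fits the shape of
    \<open>nonneg_quadratic_linear_coeff\<close>.\<close>
  have primal: "\<nu> * ?ip g (grad \<Omega> w) - ?ip b (grad \<Omega> w) = 0" if w: "w \<in> K_u \<Omega> \<Gamma>D" for w
  proof -
    have "(\<nu> * ?ip g (grad \<Omega> w) - ?ip b (grad \<Omega> w)) / 2 = 0"
    proof (rule nonneg_quadratic_linear_coeff)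
      fix t
      have "?I u \<le> ?I (\<lambda>x. u x + t *\<^sub>R w x)" by (intro umin K_u_add_scaleR[OF \<Omega>' \<Gamma>b uK w])
      then show "0 \<le> 2 * t * ((\<nu> * ?ip g (grad \<Omega> w) - ?ip b (grad \<Omega> w)) / 2) + t\<^sup>2 * (\<nu> / 2 * ?ip (grad \<Omega> w) (grad \<Omega> w))"
        unfolding I_step[OF w] Iu by (simp add: algebra_simps add_divide_distrib diff_divide_distrib)
    qed
    then show ?thesis by simp
  qed
  have DT: "?D T = - (1 / (2 * \<nu>)) * ?ip b b + ?ip b (grad \<Omega> uD)"
    by (simp add: dual_energy_def l2_norm_sq b_def[abs_def])
  \<comment> \<open>First variation of the dual energy at \<open>T\<close>. The energy sees only the
    deviator of the variation, so \<open>\<sigma>\<close> may have any trace.\<close>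
  have dual: "?ip b (\<lambda>x. dev (\<sigma> x)) = \<nu> * ?ip (\<lambda>x. dev (\<sigma> x)) (grad \<Omega> uD)"
    if \<sigma>: "L2 \<Omega> \<sigma>" and orth: "\<And>v. v \<in> H1_D \<Omega> \<Gamma>D \<Longrightarrow> ?ip \<sigma> (grad \<Omega> v) = 0" for \<sigma>
  proof -
    let ?s = "\<lambda>x. dev (\<sigma> x)"
    have Ls: "L2 \<Omega> ?s" by (rule L2_dev[OF \<sigma>])
    have "(?ip b ?s / \<nu> - ?ip ?s (grad \<Omega> uD)) / 2 = 0"
    proof (rule nonneg_quadratic_linear_coeff)
      fix t
      have "?D (\<lambda>x. T x + t *\<^sub>R \<sigma> x) \<le> ?D T"
        by (intro Tmax K_T_add_divergence_free[OF \<Omega>' TK \<sigma> orthogonal_imp_divergence_free(1)[OF \<Omega>' \<Gamma>\<Omega> \<sigma> orth] orth])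
      moreover have "?D (\<lambda>x. T x + t *\<^sub>R \<sigma> x) =
          - (1 / (2 * \<nu>)) * (?ip b b + 2 * t * ?ip b ?s + t\<^sup>2 * ?ip ?s ?s) + (?ip b (grad \<Omega> uD) + t * ?ip ?s (grad \<Omega> uD))"
        using l2_inner_expand[OF Lb Ls, of t] l2_inner_add_left[OF Lb L2_scaleR[OF Ls] LuD, of t]
        by (simp add: dual_energy_def l2_norm_sq dev_add_scaleR l2_inner_scaleR_left flip: b_def)
      ultimately have "0 \<le> (1 / (2 * \<nu>)) * (2 * t * ?ip b ?s + t\<^sup>2 * ?ip ?s ?s) - t * ?ip ?s (grad \<Omega> uD)"
        unfolding DT by (simp add: algebra_simps)
      also have "\<dots> = 2 * t * ((?ip b ?s / \<nu> - ?ip ?s (grad \<Omega> uD)) / 2) + t\<^sup>2 * (1 / (2 * \<nu>) * ?ip ?s ?s)"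
        using \<nu> by (simp add: field_simps)
      finally show "0 \<le> 2 * t * ((?ip b ?s / \<nu> - ?ip ?s (grad \<Omega> uD)) / 2) + t\<^sup>2 * (1 / (2 * \<nu>) * ?ip ?s ?s)" .
    qed
    then show ?thesis using \<nu> by (simp add: field_simps)
  qed
  define E where "E x = \<nu> *\<^sub>R g x - b x" for x
  have LE: "L2 \<Omega> E" unfolding E_def by (intro L2_diff L2_scaleR Lg Lb)
  have gtr: "AE x in lebesgue_on \<Omega>. trace (g x) = 0"
    using Ktr[OF uK] uDtr by eventually_elim (simp add: g_def trace_add)
  have Etr: "AE x in lebesgue_on \<Omega>. trace (E x) = 0"
    using gtr by eventually_elim (simp add: E_def b_def trace_sub trace_scaleR trace_dev)
  have E_ip: "?ip E h = \<nu> * ?ip g h - ?ip b h" if "L2 \<Omega> h" for h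
    unfolding E_def using l2_inner_diff_left[OF L2_scaleR[OF Lg] Lb that, of \<nu>] by (simp add: l2_inner_scaleR_left)
  \<comment> \<open>As \<open>E\<close> is trace-free, \<open>\<sigma>\<close> may be exchanged for
    its deviator. The dual identity then cancels \<open>b\<close> against the part of
    \<open>g\<close> that comes from \<open>uD\<close>, and what is left,
    \<open>grad \<Omega> u\<close>, is orthogonal to \<open>\<sigma>\<close>.\<close>
  have E_\<sigma>: "?ip E \<sigma> = 0"
    if \<sigma>: "L2 \<Omega> \<sigma>" and orth: "\<And>v. v \<in> H1_D \<Omega> \<Gamma>D \<Longrightarrow> ?ip \<sigma> (grad \<Omega> v) = 0" for \<sigma>
  proof -
    let ?s = "\<lambda>x. dev (\<sigma> x)"
    have Ls: "L2 \<Omega> ?s" by (rule L2_dev[OF \<sigma>])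
    have "?ip E \<sigma> = ?ip E ?s"
      using l2_inner_dev[OF \<sigma> LE Etr] by (simp add: l2_inner_commute)
    also have "\<dots> = \<nu> * ?ip g ?s - ?ip b ?s" by (rule E_ip[OF Ls])
    also have "\<dots> = \<nu> * ?ip (grad \<Omega> u) ?s"
      using dual[OF \<sigma> orth] l2_inner_add_left[OF Lu LuD Ls]
      by (simp add: g_def[abs_def] algebra_simps l2_inner_commute[of _ ?s])
    also have "?ip (grad \<Omega> u) ?s = ?ip \<sigma> (grad \<Omega> u)"
      using l2_inner_dev[OF \<sigma> Lu Ktr[OF uK]] by (simp add: l2_inner_commute)
    also have "\<dots> = 0" by (rule orth[OF KV[OF uK]])
    finally show ?thesis by simp
  qed
  obtain w where w: "w \<in> H1_D \<Omega> \<Gamma>D"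
    and orth: "\<And>v. v \<in> H1_D \<Omega> \<Gamma>D \<Longrightarrow> ?ip (\<lambda>x. E x - grad \<Omega> w x) (grad \<Omega> v) = 0"
    using grad_H1_D_projection[OF dim \<Omega> \<Gamma> LE KV[OF uK]] by blast
  have Lw: "L2 \<Omega> (grad \<Omega> w)" by (rule grad_props(1)[OF H1_D_mem_H1[OF w]])
  let ?\<sigma> = "\<lambda>x. E x - grad \<Omega> w x"
  have L\<sigma>: "L2 \<Omega> ?\<sigma>" by (rule L2_diff[OF LE Lw])
  \<comment> \<open>The rest \<open>E - grad \<Omega> w\<close> is orthogonal to all gradients of
    \<open>H1_D\<close>, so it is orthogonal to \<open>grad \<Omega> w\<close> and, by
    \<open>E_\<sigma>\<close>, to \<open>E\<close>; hence to itself.\<close>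
  have "?ip ?\<sigma> ?\<sigma> = ?ip E ?\<sigma> - ?ip (grad \<Omega> w) ?\<sigma>" by (rule l2_inner_diff_left[OF LE Lw L\<sigma>])
  also have "\<dots> = 0" using E_\<sigma>[OF L\<sigma> orth] orth[OF w] by (simp add: l2_inner_commute)
  finally have "l2_norm \<Omega> ?\<sigma> = 0" by (simp add: l2_norm_def)
  from l2_norm_zero_AE[OF L\<sigma> this]
  have Ew: "AE x in lebesgue_on \<Omega>. E x = grad \<Omega> w x" by eventually_elim simp
  \<comment> \<open>The trace-free \<open>E\<close> forces \<open>w\<close> to be divergence-free;
    only after this may \<open>primal\<close>, restricted to \<open>K_u\<close>, be tested with
    \<open>w\<close>.\<close>
  with Etr have "AE x in lebesgue_on \<Omega>. vec_div \<Omega> w x = 0"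
    by eventually_elim (simp add: vec_div_def)
  then have "w \<in> K_u \<Omega> \<Gamma>D" using w by (simp add: K_u_def)
  then have "?ip E (grad \<Omega> w) = 0" using primal E_ip[OF Lw] by simp
  moreover have "?ip E E = ?ip E (grad \<Omega> w)"
    by (rule l2_inner_cong_AE[OF LE LE LE Lw _ Ew]) simp
  ultimately have "?ip E E = 0" by simp
  \<comment> \<open>Completing the square: this expression is \<open>2 * \<nu>\<close> times the gap
    between the two extremal energies.\<close>
  moreover have "?ip E E = \<nu>\<^sup>2 * ?ip g g - 2 * \<nu> * ?ip g b + ?ip b b"
  proof -
    have "?ip E E = \<nu> * ?ip g E - ?ip b E" by (rule E_ip[OF LE])
    moreover have "?ip g E = \<nu> * ?ip g g - ?ip b g" using E_ip[OF Lg] by (simp add: l2_inner_commute)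
    moreover have "?ip b E = \<nu> * ?ip g b - ?ip b b" using E_ip[OF Lb] by (simp add: l2_inner_commute)
    ultimately show ?thesis by (simp add: l2_inner_commute[of \<Omega> b g] power2_eq_square algebra_simps)
  qed
  ultimately have "\<nu>\<^sup>2 * ?ip g g - 2 * \<nu> * ?ip g b + ?ip b b = 0" by simp
  moreover have "?ip g b = ?ip b (grad \<Omega> u) + ?ip b (grad \<Omega> uD)"
    using l2_inner_add_right[OF Lu LuD Lb] by (simp add: g_def[abs_def] l2_inner_commute[of _ b])
  moreover have "2 * \<nu> * (?I u - ?D T) = \<nu>\<^sup>2 * ?ip g g - 2 * \<nu> * (?ip b (grad \<Omega> u) + ?ip b (grad \<Omega> uD)) + ?ip b b"
    unfolding Iu DT using \<nu> by (simp add: field_simps power2_eq_square)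
  ultimately show ?thesis using \<nu> by simp
qed

text \<open>\<open>v\<close> and \<open>\<tau>\<close> enter both sides through the same two
  energies and cancel; what remains is the equality of the extremal energies.\<close>

theorem theorem3:
  fixes \<Omega> \<Gamma>D \<Gamma>N :: "(real^'d::finite) set"
    and \<nu> :: real
    and uD f u v :: "real^'d \<Rightarrow> real^'d"
    and F T \<tau> :: "real^'d \<Rightarrow> real^'d^'d"
  assumes "CARD('d) \<ge> 2"
    and "bounded_polyhedral_lipschitz_domain \<Omega>"
    and "boundary_partition \<Omega> \<Gamma>D \<Gamma>N"
    and "\<nu> > 0"
    and "H1 \<Omega> uD" and "AE x in lebesgue_on \<Omega>. vec_div \<Omega> uD x = 0"
    and "L2 \<Omega> f" and "L2 \<Omega> F"
    and "is_arg_min (primal_energy \<Omega> \<nu> uD f F) (\<lambda>w. w \<in> K_u \<Omega> \<Gamma>D) u"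
    and "is_arg_max (dual_energy \<Omega> \<nu> uD) (\<lambda>\<sigma>. \<sigma> \<in> K_T \<Omega> \<Gamma>D f F) T"
    and "v \<in> K_u \<Omega> \<Gamma>D" and "\<tau> \<in> K_T \<Omega> \<Gamma>D f F"
  shows "rho_tot_sq \<Omega> \<nu> uD f F u T v \<tau> = eta_gap_sq \<Omega> \<nu> uD f F v \<tau>"
  using strong_duality[OF assms(1-10)] by (simp add: rho_tot_sq_def eta_gap_sq_def)

end
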